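(* Let $d>0$ and $\omega>\frac{\pi}{4d}$, and suppose that $\phi,\psi$ satisfy (C1) or (C2) on $\Delta$. Then the functions $\eta^{\pm}(u,\xi)$ have the factorial expansions $$\eta^{\pm}(u,\xi)=\sum_{n=0}^{\infty}\frac{\mathsf{B}_{n+1}^{\pm}(\omega,\xi)}{u(u+\omega)\cdots(u+n\omega)},$$ which are absolutely convergent for $\Re u>\sigma>0$ ($\sigma$ arbitrary), uniformly for $\xi\in\Gamma^{\pm}(d)$. The errors committed by truncating these series after $N\ge0$ terms do not exceed in absolute value $$\frac{C^{\pm}}{2^{\sigma/\omega}}\,\frac{\Gamma(\Re u/\omega-1)}{\omega-\sigma}\,\frac{e^{V^{\pm}(\sigma,\xi)}}{\max\left(1,\mp\operatorname{sgn}(\Re\xi)|\Re\xi|^{\rho}\right)}\left(N+\frac12\right)^{1-\Re u/\omega},$$ provided that $\Re u>\omega>\sigma>0$ and $\xi\in\Gamma^{\pm}(d)$, where $C^{\pm}=C^{\pm}(r)$ with $r=\frac{\pi}{4\omega}$, and $\Gamma(\cdot)$ applied to $\Re u/\omega-1$ is the gamma function.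
   Context: Setting. $u$ is a complex parameter. $\mathbf{G}$ is a domain in the complex $\xi$-plane (or, more generally, a domain of a Riemann surface spread over the $\xi$-plane, in which case $|\xi|,\Re\xi,\Im\xi$ refer to the projection of $\xi$), and $\phi,\psi$ are holomorphic in $\mathbf{G}$ and independent of $u$. $\Delta\subset\mathbf{G}$ is a domain. Upper signs go with upper signs and lower with lower throughout. Condition (C1): there are positive constants $c,\rho$, independent of $u$ and $\xi$, such that for all $\xi\in\Delta$, $|\phi(\xi)|\le\frac{c}{1+|\xi|^{1+\rho}}$ and $|\psi(\xi)|\le\frac{c}{1+|\xi|^{1+\rho}}$. Condition (C2): there are positive constants $c,\rho$, independent of $u$ and $\xi$, such that for all $\xi\in\Delta$, $|\phi(\xi)|\le\frac{c}{1+|\xi|^{1/2+\rho}}$, $|\phi'(\xi)|\le\frac{c}{1+|\xi|^{1+\rho}}$ and $|\psi(\xi)|\le\frac{c}{1+|\xi|^{1+\rho}}$. The number $\rho$ in the claim is the one from whichever condition is assumed. Domains $\Gamma^{\pm}(d)$. For $d>0$, $\Gamma^{\pm}(d)$ denote any non-empty subdomains of $\Delta$ such that (i) the distance between each point of $\Gamma^{\pm}(d)$ and each boundary point of $\Delta$ is at least $d$ (i.e. the open disc of radius $d$ about each point of $\Gamma^{\pm}(d)$ lies in $\Delta$); (ii) if $\xi\in\Gamma^{\pm}(d)$ then $\xi\mp x\in\Gamma^{\pm}(d)$ for all $x>0$. It is assumed that $d$ is such that these domains are non-empty. Paths. For $\xi\in\Gamma^{+}(d)$, $\mathscr{P}(-\infty,\xi)$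 is the horizontal half-line running from $-\infty+i\Im\xi$ to $\xi$; for $\xi\in\Gamma^{-}(d)$, $\mathscr{P}(+\infty,\xi)$ is the horizontal half-line running from $+\infty+i\Im\xi$ to $\xi$. Coefficients. $\mathsf{A}_0^{\pm}(\xi)=1$ and, for $n\ge0$ and $\xi\in\Gamma^{\pm}(d)$, $$\mathsf{A}_{n+1}^{\pm}(\xi)=-\frac12\phi(\xi)\mathsf{A}_n^{\pm}(\xi)\mp\frac12\frac{d\mathsf{A}_n^{\pm}(\xi)}{d\xi}\mp\frac12\int_{\mathscr{P}(\mp\infty,\xi)}\left(\frac14\phi^2(t)\mp\frac12\phi'(t)-\psi(t)\right)\mathsf{A}_n^{\pm}(t)\,dt .$$ Further, $\mathsf{B}_1^{\pm}(\omega,\xi)=\mathsf{A}_1^{\pm}(\xi)$ and, for $n\ge1$ and $\xi\in\Gamma^{\pm}(d)$, $$\mathsf{B}_{n+1}^{\pm}(\omega,\xi)=\left((n-1)\omega-\frac12\phi(\xi)\right)\mathsf{B}_n^{\pm}(\omega,\xi)\mp\frac12\frac{d\mathsf{B}_n^{\pm}(\omega,\xi)}{d\xi}\mp\frac12\int_{\mathscr{P}(\mp\infty,\xi)}\left(\frac14\phi^2(t)\mp\frac12\phi'(t)-\psi(t)\right)\mathsf{B}_n^{\pm}(\omega,t)\,dt .$$ Regions. For $r>0$, $B(r)=\{t\in\mathbb{C}:|t|<r\}$ and $U(r)=\{t\in\mathbb{C}:\Re t>0,\ |\Im t|<r\}\cup B(r)$. The functions $\eta^{\pm}$ and $F^{\pm}$.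 Under (C1) or (C2) the equation $\frac{d^2W}{d\xi^2}=(u^2+u\phi(\xi)+\psi(\xi))W$ has unique solutions of the form $W^{\pm}(u,\xi)=\exp\left(\pm u\xi\pm\frac12\int_{\alpha^{\pm}}^{\xi}\phi(t)\,dt\right)(1+\eta^{\pm}(u,\xi))$ for $\Re u>0$, $\xi\in\Gamma^{\pm}(d)$ (with $\alpha^{\pm}\in\mathbf{G}$ fixed, integration contours in $\mathbf{G}$, possibly infinite if the integrals converge), such that $\eta^{\pm}$ is analytic in $\{\Re u>0\}\times\Gamma^{\pm}(d)$ and $\lim_{\Re\xi\to\mp\infty}\eta^{\pm}(u,\xi)=0$. Moreover $\eta^{\pm}(u,\xi)=\int_0^{+\infty}e^{-ut}F^{\pm}(t,\xi)\,dt$, where $F^{\pm}$ is analytic in $U(2d)\times\Gamma^{\pm}(d)$, $F^{\pm}(t,\xi)=\sum_{n\ge0}\frac{\mathsf{A}_{n+1}^{\pm}(\xi)}{n!}t^n$ for $(t,\xi)\in B(2d)\times\Gamma^{\pm}(d)$, and for each $\sigma>0$, $0<r<d$ there is $K^{\pm}=K^{\pm}(\sigma,r)>0$ with $|F^{\pm}(t,\xi)|\le K^{\pm}e^{\sigma\Re t}/\max(1,\mp\operatorname{sgn}(\Re\xi)|\Re\xi|^{\rho})$ on $U(2r)\times\Gamma^{\pm}(d)$. The quantities $V^{\pm}$ and $C^{\pm}$. For $\sigma>0$ and $\xi\in\Gamma^{\pm}(d)$, $$V^{\pm}(\sigma,\xi)=\begin{cases}\displaystyle\frac{6}{\sigma}\int_{\mathscr{P}(\mp\infty,\xi)}\left(\frac14|\phi^2(t)|+\left|\frac12\phi'(t)\pm\psi(t)\right|\right)|dt|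 & \text{if }\phi\not\equiv0,\\[2mm] \displaystyle\frac1\sigma\int_{\mathscr{P}(\mp\infty,\xi)}|\psi(t)|\,|dt| & \text{if }\phi\equiv0,\end{cases}$$ and for $0<r<d$, $$C^{\pm}(r)=2\sup_{|t|=2r,\ \xi\in\Gamma^{\pm}(d)}\left(\max\left(1,\mp\operatorname{sgn}(\Re\xi)|\Re\xi|^{\rho}\right)|F^{\pm}(t,\xi)|\right).$$ *)

theory Defs
  imports "HOL-Analysis.Analysis"
begin

text \<open>
  Domains of a Riemann surface spread over the \<open>\<xi>\<close>-plane: points live in an arbitrary Hausdorff
  space and \<open>p\<close> is the projection to the complex plane, a local homeomorphism (so that \<open>\<xi> = p x\<close> is
  a local coordinate everywhere). A plane domain is the case \<open>p = (\<lambda>x. x)\<close> on type \<^typ>\<open>complex\<close>.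

  The double signs are encoded by a real \<open>\<epsilon>\<close>: upper signs are \<open>\<epsilon> = 1\<close>, lower signs \<open>\<epsilon> = -1\<close>.
\<close>

definition spread_domain :: "('a::t2_space \<Rightarrow> complex) \<Rightarrow> 'a set \<Rightarrow> bool" where
  "spread_domain p G \<longleftrightarrow> open G \<and> connected G \<and> G \<noteq> {} \<and>
     (\<forall>x\<in>G. \<exists>V g. open V \<and> x \<in> V \<and> V \<subseteq> G \<and> open (p ` V) \<and> homeomorphism V (p ` V) p g)"

definition subdomain :: "'a::topological_space set \<Rightarrow> 'a set \<Rightarrow> bool" where
  "subdomain S T \<longleftrightarrow> open S \<and> connected S \<and> S \<noteq> {} \<and> S \<subseteq> T"

text \<open>Differentiation with respect to \<open>\<xi> = p x\<close>.\<close>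

definition has_xi_derivative ::
    "('a::t2_space \<Rightarrow> complex) \<Rightarrow> ('a \<Rightarrow> complex) \<Rightarrow> complex \<Rightarrow> 'a \<Rightarrow> bool" where
  "has_xi_derivative p f D x \<longleftrightarrow> ((\<lambda>y. (f y - f x) / (p y - p x)) \<longlongrightarrow> D) (at x)"

definition xi_deriv :: "('a::t2_space \<Rightarrow> complex) \<Rightarrow> ('a \<Rightarrow> complex) \<Rightarrow> 'a \<Rightarrow> complex" where
  "xi_deriv p f x = Lim (at x) (\<lambda>y. (f y - f x) / (p y - p x))"

definition xi_holomorphic_on ::
    "('a::t2_space \<Rightarrow> complex) \<Rightarrow> ('a \<Rightarrow> complex) \<Rightarrow> 'a set \<Rightarrow> bool" where
  "xi_holomorphic_on p f S \<longleftrightarrow> (\<forall>x\<in>S. \<exists>D. has_xi_derivative p f D x)"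

lemma has_xi_derivative_plane:
  "has_xi_derivative (\<lambda>x. x) f D x \<longleftrightarrow> (f has_field_derivative D) (at x)"
  by (simp add: has_xi_derivative_def has_field_derivative_iff)

text \<open>Analyticity of a function of the two complex variables \<open>(t, \<xi>)\<close> on \<open>T \<times> S\<close>
  (open sets): continuous and holomorphic in each variable.\<close>

definition analytic_in_both ::
    "('a::t2_space \<Rightarrow> complex) \<Rightarrow> (complex \<Rightarrow> 'a \<Rightarrow> complex) \<Rightarrow> complex set \<Rightarrow> 'a set \<Rightarrow> bool" where
  "analytic_in_both p f T S \<longleftrightarrow>
     continuous_on (T \<times> S) (\<lambda>(t, x). f t x) \<and>
     (\<forall>x\<in>S. (\<lambda>t. f t x) holomorphic_on T) \<and>
     (\<forall>t\<in>T. xi_holomorphic_on p (f t) S)"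

definition cond_C1 ::
    "('a::t2_space \<Rightarrow> complex) \<Rightarrow> ('a \<Rightarrow> complex) \<Rightarrow> ('a \<Rightarrow> complex) \<Rightarrow> 'a set \<Rightarrow> real \<Rightarrow> real \<Rightarrow> bool" where
  "cond_C1 p \<phi> \<psi> \<Delta> c \<rho> \<longleftrightarrow> (\<forall>x\<in>\<Delta>.
     norm (\<phi> x) \<le> c / (1 + norm (p x) powr (1 + \<rho>)) \<and>
     norm (\<psi> x) \<le> c / (1 + norm (p x) powr (1 + \<rho>)))"

definition cond_C2 ::
    "('a::t2_space \<Rightarrow> complex) \<Rightarrow> ('a \<Rightarrow> complex) \<Rightarrow> ('a \<Rightarrow> complex) \<Rightarrow> 'a set \<Rightarrow> real \<Rightarrow> real \<Rightarrow> bool" where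
  "cond_C2 p \<phi> \<psi> \<Delta> c \<rho> \<longleftrightarrow> (\<forall>x\<in>\<Delta>.
     norm (\<phi> x) \<le> c / (1 + norm (p x) powr (1/2 + \<rho>)) \<and>
     norm (xi_deriv p \<phi> x) \<le> c / (1 + norm (p x) powr (1 + \<rho>)) \<and>
     norm (\<psi> x) \<le> c / (1 + norm (p x) powr (1 + \<rho>)))"

text \<open>\<open>h s\<close> is the point \<open>\<xi> - \<epsilon> s\<close> for \<open>s \<ge> 0\<close>: on the surface this is the endpoint of the
  lifted horizontal segment. The lift is unique because \<open>p\<close> is a local homeomorphism.\<close>

definition horizontal_ray ::
    "('a::t2_space \<Rightarrow> complex) \<Rightarrow> 'a set \<Rightarrow> real \<Rightarrow> 'a \<Rightarrow> (real \<Rightarrow> 'a) \<Rightarrow> bool" where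
  "horizontal_ray p S \<epsilon> x h \<longleftrightarrow> continuous_on {0..} h \<and> h 0 = x \<and>
     (\<forall>s\<ge>0. h s \<in> S \<and> p (h s) = p x - of_real (\<epsilon> * s))"

definition ray :: "('a::t2_space \<Rightarrow> complex) \<Rightarrow> 'a set \<Rightarrow> real \<Rightarrow> 'a \<Rightarrow> real \<Rightarrow> 'a" where
  "ray p S \<epsilon> x = (SOME h. horizontal_ray p S \<epsilon> x h)"

lemma ray_plane:
  assumes "\<And>r. r \<ge> 0 \<Longrightarrow> x - of_real (\<epsilon> * r) \<in> S" and "s \<ge> 0"
  shows "ray (\<lambda>x. x) S \<epsilon> x s = x - of_real (\<epsilon> * s)"
proof -
  have "horizontal_ray (\<lambda>x. x) S \<epsilon> x (\<lambda>s. x - of_real (\<epsilon> * s))"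
    using assms(1) by (auto simp: horizontal_ray_def intro!: continuous_intros)
  then have "horizontal_ray (\<lambda>x. x) S \<epsilon> x (ray (\<lambda>x. x) S \<epsilon> x)"
    unfolding ray_def by (rule someI[of "horizontal_ray (\<lambda>x. x) S \<epsilon> x"])
  then show ?thesis
    using assms(2) by (auto simp: horizontal_ray_def)
qed

text \<open>The open disc of radius \<open>d\<close> about \<open>x\<close> is the sheet \<open>V\<close> mapped homeomorphically onto
  the plane disc about \<open>p x\<close>.\<close>

definition Gamma_domain ::
    "('a::t2_space \<Rightarrow> complex) \<Rightarrow> 'a set \<Rightarrow> real \<Rightarrow> real \<Rightarrow> 'a set \<Rightarrow> bool" where
  "Gamma_domain p \<Delta> d \<epsilon> \<Gamma> \<longleftrightarrow> subdomain \<Gamma> \<Delta> \<and>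
     (\<forall>x\<in>\<Gamma>. \<exists>V g. open V \<and> x \<in> V \<and> V \<subseteq> \<Delta> \<and> homeomorphism V (ball (p x) d) p g) \<and>
     (\<forall>x\<in>\<Gamma>. \<exists>h. horizontal_ray p \<Gamma> \<epsilon> x h)"

text \<open>The integrals of \<open>f(t) dt\<close> and \<open>f(t) |dt|\<close> over the half-line running from
  \<open>-\<epsilon>\<infinity> + i Im \<xi>\<close> to \<open>\<xi>\<close>, parametrised by \<open>t = \<xi> - \<epsilon> s\<close> with \<open>s\<close>
  decreasing from \<open>\<infinity>\<close> to \<open>0\<close>; hence the factor \<open>\<epsilon>\<close> in the first one.\<close>

definition path_integral ::
    "('a::t2_space \<Rightarrow> complex) \<Rightarrow> 'a set \<Rightarrow> real \<Rightarrow> ('a \<Rightarrow> complex) \<Rightarrow> 'a \<Rightarrow> complex" where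
  "path_integral p \<Gamma> \<epsilon> f x = of_real \<epsilon> * integral {0..} (\<lambda>s. f (ray p \<Gamma> \<epsilon> x s))"

definition path_integral_abs ::
    "('a::t2_space \<Rightarrow> complex) \<Rightarrow> 'a set \<Rightarrow> real \<Rightarrow> ('a \<Rightarrow> real) \<Rightarrow> 'a \<Rightarrow> real" where
  "path_integral_abs p \<Gamma> \<epsilon> f x = integral {0..} (\<lambda>s. f (ray p \<Gamma> \<epsilon> x s))"

definition kern ::
    "('a::t2_space \<Rightarrow> complex) \<Rightarrow> ('a \<Rightarrow> complex) \<Rightarrow> ('a \<Rightarrow> complex) \<Rightarrow> real \<Rightarrow> 'a \<Rightarrow> complex" where
  "kern p \<phi> \<psi> \<epsilon> x = 1/4 * (\<phi> x)^2 - of_real \<epsilon> * (1/2) * xi_deriv p \<phi> x - \<psi> x"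

fun coeffA ::
    "('a::t2_space \<Rightarrow> complex) \<Rightarrow> ('a \<Rightarrow> complex) \<Rightarrow> ('a \<Rightarrow> complex) \<Rightarrow> 'a set \<Rightarrow> real
      \<Rightarrow> nat \<Rightarrow> 'a \<Rightarrow> complex" where
  "coeffA p \<phi> \<psi> \<Gamma> \<epsilon> 0 = (\<lambda>x. 1)"
| "coeffA p \<phi> \<psi> \<Gamma> \<epsilon> (Suc n) = (\<lambda>x.
     - (1/2) * \<phi> x * coeffA p \<phi> \<psi> \<Gamma> \<epsilon> n x
     - of_real \<epsilon> * (1/2) * xi_deriv p (coeffA p \<phi> \<psi> \<Gamma> \<epsilon> n) x
     - of_real \<epsilon> * (1/2) *
         path_integral p \<Gamma> \<epsilon> (\<lambda>y. kern p \<phi> \<psi> \<epsilon> y * coeffA p \<phi> \<psi> \<Gamma> \<epsilon> n y) x)"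

text \<open>Numbering starts at 1; the value at index 0 is a dummy. The recursion step is the one for
  \<open>B\<^sub>m\<^sub>+\<^sub>1\<close> with \<open>m = Suc n\<close>, whence the factor \<open>(m - 1) \<omega> = n \<omega>\<close>.\<close>

fun coeffB ::
    "('a::t2_space \<Rightarrow> complex) \<Rightarrow> ('a \<Rightarrow> complex) \<Rightarrow> ('a \<Rightarrow> complex) \<Rightarrow> 'a set \<Rightarrow> real
      \<Rightarrow> real \<Rightarrow> nat \<Rightarrow> 'a \<Rightarrow> complex" where
  "coeffB p \<phi> \<psi> \<Gamma> \<epsilon> \<omega> 0 = (\<lambda>x. 0)"
| "coeffB p \<phi> \<psi> \<Gamma> \<epsilon> \<omega> (Suc 0) = coeffA p \<phi> \<psi> \<Gamma> \<epsilon> 1"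
| "coeffB p \<phi> \<psi> \<Gamma> \<epsilon> \<omega> (Suc (Suc n)) = (\<lambda>x.
     (of_nat n * of_real \<omega> - (1/2) * \<phi> x) * coeffB p \<phi> \<psi> \<Gamma> \<epsilon> \<omega> (Suc n) x
     - of_real \<epsilon> * (1/2) * xi_deriv p (coeffB p \<phi> \<psi> \<Gamma> \<epsilon> \<omega> (Suc n)) x
     - of_real \<epsilon> * (1/2) *
         path_integral p \<Gamma> \<epsilon> (\<lambda>y. kern p \<phi> \<psi> \<epsilon> y * coeffB p \<phi> \<psi> \<Gamma> \<epsilon> \<omega> (Suc n) y) x)"

definition U_region :: "real \<Rightarrow> complex set" where
  "U_region r = {t. Re t > 0 \<and> \<bar>Im t\<bar> < r} \<union> ball 0 r"

definition weight :: "('a::t2_space \<Rightarrow> complex) \<Rightarrow> real \<Rightarrow> real \<Rightarrow> 'a \<Rightarrow> real" where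
  "weight p \<epsilon> \<rho> x = max 1 (- \<epsilon> * sgn (Re (p x)) * \<bar>Re (p x)\<bar> powr \<rho>)"

definition wkb_solution ::
    "('a::t2_space \<Rightarrow> complex) \<Rightarrow> real \<Rightarrow> ('a \<Rightarrow> complex) \<Rightarrow> (complex \<Rightarrow> 'a \<Rightarrow> complex)
      \<Rightarrow> complex \<Rightarrow> 'a \<Rightarrow> complex" where
  "wkb_solution p \<epsilon> \<Phi> \<eta> u x =
     exp (of_real \<epsilon> * u * p x + of_real \<epsilon> * (1/2) * \<Phi> x) * (1 + \<eta> u x)"

text \<open>\<open>\<Phi>\<close> plays the role of \<open>\<integral>\<^sub>\<alpha> \<phi>(t) dt\<close>: whatever the base point (finite or infinite) and
  the contours, this integral is a primitive of \<open>\<phi>\<close> on the domain \<open>\<Gamma>\<close>, determined up to an additive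
  constant, and the constant only multiplies the solution by a nonzero factor.\<close>

definition eta_function ::
    "('a::t2_space \<Rightarrow> complex) \<Rightarrow> ('a \<Rightarrow> complex) \<Rightarrow> ('a \<Rightarrow> complex) \<Rightarrow> 'a set \<Rightarrow> real
      \<Rightarrow> ('a \<Rightarrow> complex) \<Rightarrow> (complex \<Rightarrow> 'a \<Rightarrow> complex) \<Rightarrow> bool" where
  "eta_function p \<phi> \<psi> \<Gamma> \<epsilon> \<Phi> \<eta> \<longleftrightarrow>
     (\<forall>x\<in>\<Gamma>. has_xi_derivative p \<Phi> (\<phi> x) x) \<and>
     analytic_in_both p \<eta> {u. Re u > 0} \<Gamma> \<and>
     (\<forall>u x. Re u > 0 \<longrightarrow> x \<in> \<Gamma> \<longrightarrow>
        xi_deriv p (xi_deriv p (wkb_solution p \<epsilon> \<Phi> \<eta> u)) x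
          = (u^2 + u * \<phi> x + \<psi> x) * wkb_solution p \<epsilon> \<Phi> \<eta> u x) \<and>
     (\<forall>u. Re u > 0 \<longrightarrow>
        (\<eta> u \<longlongrightarrow> 0) (inf (filtercomap (\<lambda>x. - \<epsilon> * Re (p x)) at_top) (principal \<Gamma>)))"

definition borel_transform ::
    "('a::t2_space \<Rightarrow> complex) \<Rightarrow> ('a \<Rightarrow> complex) \<Rightarrow> ('a \<Rightarrow> complex) \<Rightarrow> 'a set \<Rightarrow> real \<Rightarrow> real \<Rightarrow> real
      \<Rightarrow> (complex \<Rightarrow> 'a \<Rightarrow> complex) \<Rightarrow> (complex \<Rightarrow> 'a \<Rightarrow> complex) \<Rightarrow> bool" where
  "borel_transform p \<phi> \<psi> \<Gamma> \<epsilon> d \<rho> \<eta> F \<longleftrightarrow>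
     (\<forall>u x. Re u > 0 \<longrightarrow> x \<in> \<Gamma> \<longrightarrow>
        ((\<lambda>t. exp (- u * of_real t) * F (of_real t) x) has_integral \<eta> u x) {0..}) \<and>
     analytic_in_both p F (U_region (2 * d)) \<Gamma> \<and>
     (\<forall>t x. t \<in> ball 0 (2 * d) \<longrightarrow> x \<in> \<Gamma> \<longrightarrow>
        (\<lambda>n. coeffA p \<phi> \<psi> \<Gamma> \<epsilon> (n + 1) x / fact n * t ^ n) sums F t x) \<and>
     (\<forall>\<sigma> r. \<sigma> > 0 \<longrightarrow> 0 < r \<longrightarrow> r < d \<longrightarrow>
        (\<exists>K>0. \<forall>t\<in>U_region (2 * r). \<forall>x\<in>\<Gamma>.
           norm (F t x) \<le> K * exp (\<sigma> * Re t) / weight p \<epsilon> \<rho> x))"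

definition V_bound ::
    "('a::t2_space \<Rightarrow> complex) \<Rightarrow> 'a set \<Rightarrow> ('a \<Rightarrow> complex) \<Rightarrow> ('a \<Rightarrow> complex) \<Rightarrow> 'a set \<Rightarrow> real
      \<Rightarrow> real \<Rightarrow> 'a \<Rightarrow> real" where
  "V_bound p G \<phi> \<psi> \<Gamma> \<epsilon> \<sigma> x =
     (if \<forall>y\<in>G. \<phi> y = 0
      then 1 / \<sigma> * path_integral_abs p \<Gamma> \<epsilon> (\<lambda>y. norm (\<psi> y)) x
      else 6 / \<sigma> * path_integral_abs p \<Gamma> \<epsilon>
             (\<lambda>y. 1/4 * norm ((\<phi> y)^2) + norm (1/2 * xi_deriv p \<phi> y + of_real \<epsilon> * \<psi> y)) x)"

definition C_bound ::
    "('a::t2_space \<Rightarrow> complex) \<Rightarrow> 'a set \<Rightarrow> real \<Rightarrow> real \<Rightarrow> (complex \<Rightarrow> 'a \<Rightarrow> complex) \<Rightarrow> real \<Rightarrow> real" where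
  "C_bound p \<Gamma> \<epsilon> \<rho> F r =
     2 * (SUP (t, x) \<in> {t. norm t = 2 * r} \<times> \<Gamma>. weight p \<epsilon> \<rho> x * norm (F t x))"

definition factorial_term ::
    "('a::t2_space \<Rightarrow> complex) \<Rightarrow> ('a \<Rightarrow> complex) \<Rightarrow> ('a \<Rightarrow> complex) \<Rightarrow> 'a set \<Rightarrow> real \<Rightarrow> real
      \<Rightarrow> complex \<Rightarrow> nat \<Rightarrow> 'a \<Rightarrow> complex" where
  "factorial_term p \<phi> \<psi> \<Gamma> \<epsilon> \<omega> u n x =
     coeffB p \<phi> \<psi> \<Gamma> \<epsilon> \<omega> (n + 1) x / (\<Prod>k\<le>n. u + of_nat k * of_real \<omega>)"

end

theory Submission
  imports Defs "HOL-Complex_Analysis.Complex_Analysis" "HOL-Real_Asymp.Real_Asymp"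
begin

text \<open>
  The recurrence for the \<open>A\<^sub>n\<close> says that the Borel transform satisfies \<open>\<partial>F/\<partial>t = L F\<close>, where \<open>L\<close> is the
  integro-differential operator of the recurrence: both sides have the same Taylor coefficients at
  \<open>t = 0\<close>, and the identity theorem extends the equation to \<open>U(2d)\<close>. Under \<open>s = 1 - exp (- \<omega> t)\<close> the
  unit disc is mapped into \<open>U(\<pi> / (2 \<omega>))\<close>, and the \<open>n\<close>-th Taylor coefficient of \<open>F\<close> in the variable \<open>s\<close>
  is \<open>B\<^sub>n\<^sub>+\<^sub>1 / (n! \<omega>\<^sup>n)\<close>, because \<open>L\<close> commutes with \<open>\<partial>/\<partial>t\<close>. Integrating the series termwise against \<open>exp (- u t)\<close>
  gives the factorial series, since the Laplace transform of \<open>(1 - exp (- \<omega> t))\<^sup>n\<close> is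
  \<open>n! \<omega>\<^sup>n / (u (u + \<omega>) \<cdots> (u + n \<omega>))\<close>.

  For the error bound, integrating the equation along the characteristics \<open>\<xi> - \<epsilon> t / 2 = const\<close>, from the
  circle \<open>|t| = \<pi> / (2 \<omega>)\<close> outwards, and absorbing \<open>|\<phi>|\<close> by \<open>2 \<sigma> |\<phi>| \<le> \<sigma>\<^sup>2 + |\<phi>|\<^sup>2\<close>, a Gronwall argument
  bounds \<open>|F(t, \<xi>)|\<close> by \<open>C exp (\<sigma> Re t + V(\<xi>))\<close> over the weight. On the disc this is a bound by a multiple of
  \<open>|1 - s|\<^bsup>-\<sigma>/\<omega>\<^esup>\<close>, so Cauchy's formula on circles of radius tending to \<open>1\<close> bounds all Taylor coefficients;
  the tails of the resulting majorant telescope, and \<open>\<Gamma>(N + v) \<ge> N! (N + 1/2)\<^bsup>v-1\<^esup>\<close>.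
\<close>

section \<open>Integrals and the gamma function\<close>

text \<open>Along a single characteristic the equation does not close: its integral term involves
  \<open>F\<close> on the whole half-line from the current point to infinity. The estimate is
  therefore made for all points of \<open>\<Gamma>\<close> at once and improved repeatedly. The
  factor exp V is adapted to this: the integral of \<open>kern_bound\<close> times exp V along a
  half-line is at most \<open>\<sigma> / \<kappa>\<close> times exp V at the starting point. The
  derivative of \<open>F\<close> along a characteristic is then at most half the decrease of the
  majorant, so each pass halves the constant, until only the supremum over the circle is left. The
  factor 6 in V pays for |\<phi>|. The factor 2 in C pays for the part of the image of the disc with
  Re t < 0, where exp (\<sigma> Re t) falls below 1, but not below 1/2.

  The other obstacle is the infinite length of the half-lines. Differentiating under the integral in
  L needs bounds that are uniform over all of \<open>\<Gamma>\<close>, not only over compact sets;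
  the a priori bound on \<open>F\<close> supplies them, and Cauchy's inequality in t passes them on
  to the derivatives.\<close>

lemma gamma_ratio_lower:
  fixes v :: real
  assumes v: "v > 1"
  shows "fact N * (real N + 1/2) powr (v - 1) \<le> Gamma (real N + v)"
proof -
  \<comment> \<open>\<open>f\<close> is the quotient of the two sides; it decreases to 1. The
    decrease is the midpoint inequality for the convex function 1/t on [n + 1/2, n + 3/2], which is
    where the shift 1/2 comes from.\<close>
  define f where "f n = Gamma (real n + v) / (fact n * (real n + 1/2) powr (v - 1))" for n
  have notin: "v + real k \<notin> \<int>\<^sub>\<le>\<^sub>0" for k
    using v by (auto elim!: nonpos_Ints_cases)
  have "decseq f"
  proof (rule decseq_SucI)
    fix n :: nat
    have L: "ln (real n + 3/2) - ln (real n + 1/2) \<ge> 1 / (real n + 1)"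
      using ln_inverse_approx_ge[of "real n + 1/2" "real n + 3/2"] by (simp add: field_simps)
    have "(real n + v) / (real n + 1) = 1 + (v - 1) / (real n + 1)"
      by (simp add: field_simps)
    also have "\<dots> \<le> exp ((v - 1) / (real n + 1))" by (rule exp_ge_add_one_self)
    also have "\<dots> \<le> exp ((v - 1) * (ln (real n + 3/2) - ln (real n + 1/2)))"
      using mult_left_mono[OF L, of "v - 1"] v by simp
    also have "\<dots> = (real n + 3/2) powr (v - 1) / (real n + 1/2) powr (v - 1)"
      by (simp add: powr_def exp_diff[symmetric] right_diff_distrib)
    finally have le: "(real n + v) / (real n + 1) \<le> (real n + 3/2) powr (v - 1) / (real n + 1/2) powr (v - 1)" .
    have G: "Gamma (real (Suc n) + v) = (real n + v) * Gamma (real n + v)"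
      using Gamma_plus1[of "real n + v"] notin[of n] by (simp add: add_ac)
    have Gp: "Gamma (real n + v) > 0" using v by (intro Gamma_real_pos) auto
    have "f (Suc n) = Gamma (real n + v) / fact n * ((real n + v) / (real n + 1)) / (real n + 3/2) powr (v - 1)"
      unfolding f_def G by (simp add: field_simps add_ac)
    also have "\<dots> \<le> Gamma (real n + v) / fact n * ((real n + 3/2) powr (v - 1) / (real n + 1/2) powr (v - 1)) / (real n + 3/2) powr (v - 1)"
      using Gp by (intro divide_right_mono mult_left_mono le) auto
    also have "\<dots> = f n"
      unfolding f_def by (simp add: field_simps)
    finally show "f (Suc n) \<le> f n" .
  qed
  moreover have "f \<longlonglongrightarrow> 1"
  proof -
    have Gnz: "Gamma v \<noteq> 0" using Gamma_real_pos[of v] v by linarith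
    \<comment> \<open>The first factor tends to 1 by Euler's limit formula for the gamma function,
      the second by elementary asymptotics; their product is \<open>f n\<close>.\<close>
    have "(\<lambda>n. Gamma v / Gamma_series' v n * (real n powr v / (real n * (real n + 1/2) powr (v - 1)))) \<longlonglongrightarrow> Gamma v / Gamma v * 1"
    proof (intro tendsto_mult tendsto_divide tendsto_const Gamma_series'_LIMSEQ Gnz)
      show "(\<lambda>n. real n powr v / (real n * (real n + 1/2) powr (v - 1))) \<longlonglongrightarrow> 1"
        by real_asymp
    qed
    moreover have "\<forall>\<^sub>F n in sequentially. Gamma v / Gamma_series' v n * (real n powr v / (real n * (real n + 1/2) powr (v - 1))) = f n"
    proof (rule eventually_sequentiallyI[of 1])
      fix n :: nat assume n: "n \<ge> 1"
      have P: "Gamma (real n + v) = pochhammer v n * Gamma v"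
        using pochhammer_Gamma[of v n] notin[of 0] Gnz by (simp add: add_ac)
      have pn: "pochhammer v n \<noteq> 0" using v by (simp add: pochhammer_pos less_imp_neq[symmetric])
      have Fa: "fact n = real n * fact (n - 1)" using n by (simp add: fact_reduce)
      show "Gamma v / Gamma_series' v n * (real n powr v / (real n * (real n + 1/2) powr (v - 1))) = f n"
        unfolding f_def P Gamma_series'_def Fa using n pn
        by (simp add: powr_def field_simps)
    qed
    ultimately show ?thesis
      using Gnz by (simp add: tendsto_cong)
  qed
  ultimately have "1 \<le> f N" by (rule decseq_ge)
  then show ?thesis
    unfolding f_def by (subst (asm) le_divide_eq) auto
qed

section \<open>Integrals over half-lines and Laplace transforms\<close>

lemma absolutely_integrable_continuous_bound:
  fixes f :: "real \<Rightarrow> 'b::euclidean_space"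
  assumes "continuous_on {a..} f" "g integrable_on {a..}" "\<And>x. x \<ge> a \<Longrightarrow> norm (f x) \<le> g x"
  shows "f absolutely_integrable_on {a..}"
proof (rule measurable_bounded_by_integrable_imp_absolutely_integrable)
  show "f \<in> borel_measurable (lebesgue_on {a..})"
    using assms(1) by (intro continuous_imp_measurable_on_sets_lebesgue) auto
qed (use assms in auto)

lemma integral_split_atLeast:
  fixes f :: "real \<Rightarrow> 'b::euclidean_space"
  assumes "f absolutely_integrable_on {a..}" "a \<le> b"
  shows "integral {a..} f = integral {a..b} f + integral {b..} f"
proof -
  have i1: "f integrable_on {a..b}" "f integrable_on {b..}"
    using assms by (auto intro!: set_lebesgue_integral_eq_integral(1) intro: set_integrable_subset[OF assms(1)])
  have "(f has_integral (integral {a..b} f + integral {b..} f)) ({a..b} \<union> {b..})"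
    by (rule has_integral_Un) (use i1 in \<open>auto simp: integrable_integral intro: negligible_subset[of "{b}"]\<close>)
  moreover have "{a..b} \<union> {b..} = {a..}" using assms(2) by auto
  ultimately show ?thesis by (auto intro: integral_unique)
qed

lemma integral_atLeastAtMost_tendsto:
  fixes f :: "real \<Rightarrow> 'b::euclidean_space"
  assumes f: "f absolutely_integrable_on {a..}"
  shows "(\<lambda>n. integral {a..real n} f) \<longlonglongrightarrow> integral {a..} f"
proof -
  have "(\<lambda>n. integral {a..} (\<lambda>x. if x \<in> {a..real n} then f x else 0)) \<longlonglongrightarrow> integral {a..} f"
  proof (rule dominated_convergence(2)[where h = "\<lambda>x. norm (f x)"])
    show "(\<lambda>x. norm (f x)) integrable_on {a..}"
      using f by (simp add: absolutely_integrable_on_def)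
    fix k :: nat
    have "f integrable_on {a..real k}"
      using f by (auto intro!: set_lebesgue_integral_eq_integral(1) intro: set_integrable_subset[OF f])
    then show "(\<lambda>x. if x \<in> {a..real k} then f x else 0) integrable_on {a..}"
      by (subst integrable_restrict_Int) (simp add: Int_absorb2 Int_absorb1)
  next
    fix x assume "x \<in> {a..}"
    then have "\<forall>\<^sub>F k in sequentially. (if x \<in> {a..real k} then f x else 0) = f x"
      by (intro eventually_sequentiallyI[of "nat \<lceil>x\<rceil>"]) (auto simp: ceiling_le_iff nat_le_iff)
    then show "(\<lambda>k. if x \<in> {a..real k} then f x else 0) \<longlonglongrightarrow> f x"
      by (simp add: tendsto_eventually)
  qed auto
  moreover have "integral {a..} (\<lambda>x. if x \<in> {a..real n} then f x else 0) = integral {a..real n} f" for n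
    by (subst integral_restrict_Int) (simp add: Int_absorb2 Int_absorb1)
  ultimately show ?thesis by simp
qed

lemma integral_atLeast_tendsto_0:
  fixes f :: "real \<Rightarrow> 'b::euclidean_space"
  assumes f: "f absolutely_integrable_on {0..}"
  shows "(\<lambda>n. integral {real n..} f) \<longlonglongrightarrow> 0"
proof -
  have "(\<lambda>n. integral {0..} f - integral {0..real n} f) \<longlonglongrightarrow> integral {0..} f - integral {0..} f"
    by (intro tendsto_diff tendsto_const integral_atLeastAtMost_tendsto f)
  moreover have "integral {0..} f - integral {0..real n} f = integral {real n..} f" for n
    using integral_split_atLeast[OF f, of "real n"] by simp
  ultimately show ?thesis by simp
qed

lemma has_integral_cexp_atLeast_0:
  fixes u :: complex
  assumes u: "Re u > 0"
  shows "((\<lambda>t. exp (- u * of_real t)) has_integral 1 / u) {0..}"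
    and "(\<lambda>t. exp (- u * of_real t)) absolutely_integrable_on {0..}"
proof -
  have "(\<lambda>t. exp (- Re u * t)) integrable_on {0..}"
    using integrable_on_exp_minus_to_infinity[OF u, of 0] by simp
  then show ai: "(\<lambda>t. exp (- u * of_real t)) absolutely_integrable_on {0..}"
    by (rule absolutely_integrable_continuous_bound[rotated]) (auto intro!: continuous_intros)
  have nz: "u \<noteq> 0" using u by auto
  have "integral {0..real n} (\<lambda>t. exp (- u * of_real t)) = (1 - exp (- u * of_real (real n))) / u" for n
  proof -
    have "((\<lambda>t. exp (- u * of_real t)) has_integral (- exp (- u * of_real (real n)) / u - (- exp (- u * of_real 0) / u))) {0..real n}"
      using nz by (intro fundamental_theorem_of_calculus)
        (auto intro!: derivative_eq_intros has_vector_derivative_real_field)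
    then show ?thesis by (simp add: integral_unique diff_divide_distrib)
  qed
  moreover have "(\<lambda>n. (1 - exp (- u * of_real (real n))) / u) \<longlonglongrightarrow> (1 - 0) / u"
  proof (intro tendsto_intros nz)
    show "(\<lambda>n. exp (- u * of_real (real n))) \<longlonglongrightarrow> 0"
    proof (rule tendsto_norm_zero_cancel)
      show "(\<lambda>n. norm (exp (- u * of_real (real n)))) \<longlonglongrightarrow> 0"
        using u by simp real_asymp
    qed
  qed
  ultimately have "integral {0..} (\<lambda>t. exp (- u * of_real t)) = 1 / u"
    using integral_atLeastAtMost_tendsto[OF ai] by (auto intro: LIMSEQ_unique)
  moreover have "(\<lambda>t. exp (- u * of_real t)) integrable_on {0..}"
    using ai by (rule set_lebesgue_integral_eq_integral(1))
  ultimately show "((\<lambda>t. exp (- u * of_real t)) has_integral 1 / u) {0..}"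
    by (simp add: has_integral_iff)
qed

text \<open>Induction with \<open>u\<close> arbitrary: another factor 1 - exp (-\<omega> t) replaces
  the transform at \<open>u\<close> by its difference with the transform at
  \<open>u + \<omega>\<close>. The two denominators share the product \<open>?Q\<close>, which
  leaves (n + 1) \<omega> in the numerator.\<close>

lemma laplace_exp_power:
  fixes u :: complex and \<omega> :: real
  assumes u: "Re u > 0" and \<omega>: "\<omega> > 0"
  shows "((\<lambda>t. exp (- u * of_real t) * of_real (1 - exp (- \<omega> * t)) ^ n) has_integral
           fact n * of_real \<omega> ^ n / (\<Prod>k\<le>n. u + of_nat k * of_real \<omega>)) {0..}"
  using u
proof (induction n arbitrary: u)
  case 0
  then show ?case using has_integral_cexp_atLeast_0[of u] by simp
next
  case (Suc n)
  have u': "Re (u + of_real \<omega>) > 0" using Suc.prems \<omega> by simp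
  have nz: "u + of_nat k * of_real \<omega> \<noteq> 0" for k
  proof
    assume "u + of_nat k * of_real \<omega> = 0"
    then have "Re (u + of_nat k * of_real \<omega>) = 0" by simp
    then show False using Suc.prems \<omega> by (simp add: add_pos_nonneg less_imp_neq[symmetric])
  qed
  let ?P = "\<lambda>u. \<Prod>k\<le>n. u + of_nat k * of_real \<omega> :: complex"
  let ?Q = "\<Prod>k<n. u + of_nat (Suc k) * of_real \<omega> :: complex"
  have P1: "?P u = u * ?Q"
    by (simp add: lessThan_Suc_atMost[symmetric] prod.lessThan_Suc_shift del: prod.lessThan_Suc)
  have P2: "?P (u + of_real \<omega>) = ?Q * (u + of_nat (Suc n) * of_real \<omega>)"
    by (simp add: lessThan_Suc_atMost[symmetric] algebra_simps)
  have P3: "(\<Prod>k\<le>Suc n. u + of_nat k * of_real \<omega>) = u * ?Q * (u + of_nat (Suc n) * of_real \<omega>)"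
    using P1 by simp
  have Qnz: "?Q \<noteq> 0" using nz[of "Suc _"] by auto
  have eq: "fact n * of_real \<omega> ^ n / ?P u - fact n * of_real \<omega> ^ n / ?P (u + of_real \<omega>)
      = fact (Suc n) * of_real \<omega> ^ Suc n / (\<Prod>k\<le>Suc n. u + of_nat k * of_real \<omega>)"
    unfolding P1 P2 P3 using Qnz nz[of 0] nz[of "Suc n"] by (simp add: divide_simps) (simp add: algebra_simps)
  have "((\<lambda>t. exp (- u * of_real t) * of_real (1 - exp (- \<omega> * t)) ^ n
          - exp (- (u + of_real \<omega>) * of_real t) * of_real (1 - exp (- \<omega> * t)) ^ n) has_integral
        (fact n * of_real \<omega> ^ n / ?P u - fact n * of_real \<omega> ^ n / ?P (u + of_real \<omega>))) {0..}"
    by (rule has_integral_diff[OF Suc.IH[OF Suc.prems] Suc.IH[OF u']])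
  moreover have "exp (- u * of_real t) * of_real (1 - exp (- \<omega> * t)) ^ n
          - exp (- (u + of_real \<omega>) * of_real t) * of_real (1 - exp (- \<omega> * t)) ^ n
      = exp (- u * of_real t) * of_real (1 - exp (- \<omega> * t)) ^ Suc n" for t :: real
  proof -
    have "exp (- (u + of_real \<omega>) * of_real t) = exp (- u * of_real t) * of_real (exp (- \<omega> * t))"
      by (simp add: exp_add[symmetric] exp_of_real[symmetric] algebra_simps)
    then show ?thesis by (simp add: algebra_simps)
  qed
  ultimately show ?case by (simp only: eq)
qed

text \<open>The summand is an exact difference \<open>T n - T (Suc n)\<close>, since (v + n) - (n +
  1) = v - 1. As v > 1, the last term of the telescoped sum may be dropped, and the bound does not
  depend on \<open>m\<close>.\<close>

lemma telescoping_factorial_bound: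
  fixes v :: real
  assumes v: "v > 1"
  shows "(\<Sum>n<m. fact (n + N) / pochhammer v (n + N + 1)) \<le> fact N / ((v - 1) * pochhammer v N)"
proof -
  define T where "T n = fact n / ((v - 1) * pochhammer v n)" for n
  have pos: "pochhammer v n > 0" for n using v by (simp add: pochhammer_pos)
  have step: "fact n / pochhammer v (n + 1) = T n - T (Suc n)" for n
  proof -
    have nz: "pochhammer v n \<noteq> 0" "v - 1 \<noteq> 0" "v + real n \<noteq> 0"
      using pos[of n] v by (auto simp: add_pos_nonneg less_imp_neq[symmetric])
    show ?thesis unfolding T_def using nz by (simp add: pochhammer_Suc divide_simps) (simp add: algebra_simps)
  qed
  have "(\<Sum>n<m. fact (n + N) / pochhammer v (n + N + 1)) = (\<Sum>n<m. T (n + N) - T (Suc n + N))"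
    by (intro sum.cong refl) (use step in simp)
  also have "\<dots> = T N - T (m + N)"
    using sum_lessThan_telescope'[of "\<lambda>n. T (n + N)" m] by simp
  also have "\<dots> \<le> T N"
    unfolding T_def using pos[of "m+N"] v by auto
  finally show ?thesis by (simp add: T_def)
qed

section \<open>Cauchy's formula on circles and the regions U(r)\<close>

abbreviation circ :: "real \<Rightarrow> complex" where
  "circ s \<equiv> exp (2 * pi * \<i> * of_real s)"

text \<open>Cauchy's formula read as a Fourier coefficient. In this form it is an integral over the
  fixed interval [0, 1], to which the theorems on parameter integrals apply, and which can be folded
  at s = 1/2.\<close>

lemma deriv_circle_mean:
  assumes f: "f holomorphic_on A" and A: "open A" "cball t \<delta> \<subseteq> A" and \<delta>: "\<delta> > 0"
  shows "((\<lambda>s. f (t + of_real \<delta> * circ s) * exp (- (2 * pi * \<i> * of_nat n * of_real s))) has_integral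
           (deriv ^^ n) f t / fact n * of_real \<delta> ^ n) {0..1::real}"
proof -
  have "((\<lambda>u. f u / (u - t) ^ Suc n) has_contour_integral ((2 * pi * \<i>) / (fact n) * (deriv ^^ n) f t))
           (circlepath t \<delta>)"
  proof (rule Cauchy_has_contour_integral_higher_derivative_circlepath)
    show "f holomorphic_on ball t \<delta>"
      using A ball_subset_cball[of t \<delta>] by (intro holomorphic_on_subset[OF f]) auto
    show "continuous_on (cball t \<delta>) f"
      using A by (intro holomorphic_on_imp_continuous_on holomorphic_on_subset[OF f])
  qed (use \<delta> in auto)
  then have "((\<lambda>x::real. f (t + \<delta> * circ x) / (t + \<delta> * circ x - t) ^ Suc n *
       (2 * pi * \<i> * \<delta> * circ x)) has_integral ((2 * pi * \<i>) / (fact n) * (deriv ^^ n) f t)) {0..1}"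
    unfolding has_contour_integral_def
  proof (rule has_integral_eq[rotated])
    fix x :: real assume "x \<in> {0..1}"
    then have "vector_derivative (circlepath t \<delta>) (at x within {0..1}) = 2 * pi * \<i> * \<delta> * circ x"
      by (simp add: vector_derivative_circlepath01)
    then show "f (circlepath t \<delta> x) / (circlepath t \<delta> x - t) ^ Suc n * vector_derivative (circlepath t \<delta>) (at x within {0..1})
      = f (t + \<delta> * circ x) / (t + \<delta> * circ x - t) ^ Suc n * (2 * pi * \<i> * \<delta> * circ x)"
      by (simp add: circlepath)
  qed
  then have "((\<lambda>x::real. f (t + \<delta> * circ x) / (t + \<delta> * circ x - t) ^ Suc n *
       (2 * pi * \<i> * \<delta> * circ x) * (of_real \<delta> ^ n / (2 * pi * \<i>))) has_integral
        ((2 * pi * \<i>) / (fact n) * (deriv ^^ n) f t) * (of_real \<delta> ^ n / (2 * pi * \<i>))) {0..1}"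
    by (rule has_integral_mult_left)
  moreover have "((2 * pi * \<i>) / (fact n) * (deriv ^^ n) f t) * (of_real \<delta> ^ n / (2 * pi * \<i>))
      = (deriv ^^ n) f t / fact n * of_real \<delta> ^ n"
    by (simp add: field_simps)
  moreover have "f (t + \<delta> * circ x) / (t + \<delta> * circ x - t) ^ Suc n *
       (2 * pi * \<i> * \<delta> * circ x) * (of_real \<delta> ^ n / (2 * pi * \<i>)) =
       f (t + of_real \<delta> * circ x) * exp (- (2 * pi * \<i> * of_nat n * of_real x))" for x :: real
  proof -
    have "exp (- (2 * pi * \<i> * of_nat n * of_real x)) = inverse (circ x ^ n)"
      by (simp add: exp_minus exp_of_nat_mult[symmetric] mult_ac)
    then show ?thesis
      using \<delta> by (simp add: field_simps power_mult_distrib)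
  qed
  ultimately show ?thesis by (simp only:)
qed

lemma open_connected_U_region: "r > 0 \<Longrightarrow> open (U_region r)" "r > 0 \<Longrightarrow> connected (U_region r)" "r > 0 \<Longrightarrow> 0 \<in> U_region r"
proof -
  have "U_region r = ({t. Re t > 0} \<inter> {t. Im t < r} \<inter> {t. Im t > -r}) \<union> ball 0 r"
    by (auto simp: U_region_def)
  then show "open (U_region r)"
    by (auto intro!: open_Int open_Un open_halfspace_Re_gt open_halfspace_Im_lt open_halfspace_Im_gt)
  assume r: "r > 0"
  show "0 \<in> U_region r" using r by (simp add: U_region_def)
  have "starlike (U_region r)"
    unfolding starlike_def
  proof (intro bexI[of _ 0] ballI)
    fix x assume x: "x \<in> U_region r"
    show "closed_segment 0 x \<subseteq> U_region r"
    proof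
      fix y assume "y \<in> closed_segment 0 x"
      then obtain u where u: "0 \<le> u" "u \<le> 1" "y = u *\<^sub>R x" by (auto simp: in_segment)
      show "y \<in> U_region r"
      proof (cases "u = 0")
        case False
        have "\<bar>u * Im x\<bar> \<le> \<bar>Im x\<bar>" "u * norm x \<le> norm x"
          using u by (auto simp: abs_mult intro: mult_left_le_one_le)
        then show ?thesis using x u False by (auto simp: U_region_def)
      qed (use u r in \<open>auto simp: U_region_def\<close>)
    qed
  qed (use \<open>0 \<in> U_region r\<close> in auto)
  then show "connected (U_region r)" by (rule starlike_imp_connected)
qed

lemma ball_subset_U_region:
  assumes t: "t \<in> U_region r" and rs: "r + \<delta> \<le> s"
  shows "ball t \<delta> \<subseteq> U_region s"
proof
  fix t' assume "t' \<in> ball t \<delta>"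
  then have d: "norm (t' - t) < \<delta>" by (simp add: dist_norm norm_minus_commute)
  show "t' \<in> U_region s"
  proof (cases "norm t < r")
    case True
    have "norm t' \<le> norm t + norm (t' - t)" using norm_triangle_ineq[of t "t' - t"] by simp
    then show ?thesis using True d rs by (auto simp: U_region_def)
  next
    case False
    then have t: "Re t > 0" "\<bar>Im t\<bar> < r" using t by (auto simp: U_region_def)
    have I: "\<bar>Im t' - Im t\<bar> < \<delta>" using d abs_Im_le_cmod[of "t' - t"] by simp
    show ?thesis
    proof (cases "Re t' > 0")
      case True
      then show ?thesis using I t rs by (auto simp: U_region_def)
    next
      case False
      \<comment> \<open>With Re t' \<le> 0 < Re t, the projection of \<open>t\<close> to the
        imaginary axis is at most as far from \<open>t'\<close> as \<open>t\<close> is; this moves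
        the estimate into the disc part of the region.\<close>
      have "norm (t' - Complex 0 (Im t)) \<le> norm (t' - t)"
      proof -
        have "(Re t')\<^sup>2 \<le> (Re t' - Re t)\<^sup>2"
          using False t by (intro abs_le_square_iff[THEN iffD1]) auto
        then show ?thesis by (simp add: cmod_def)
      qed
      then have "norm t' \<le> norm (t' - t) + \<bar>Im t\<bar>"
        using norm_triangle_ineq[of "t' - Complex 0 (Im t)" "Complex 0 (Im t)"] by (simp add: complex_norm)
      then show ?thesis using d t rs by (auto simp: U_region_def)
    qed
  qed
qed

section \<open>Functions on a Riemann surface\<close>

text \<open>A sheet is given by a local inverse \<open>g\<close> of \<open>p\<close> on a disc about
  \<open>p x\<close>. Local statements about the surface are proved by composing with
  \<open>g\<close> and quoting plane complex analysis.\<close>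

definition sheet :: "('a::t2_space \<Rightarrow> complex) \<Rightarrow> 'a \<Rightarrow> real \<Rightarrow> (complex \<Rightarrow> 'a) \<Rightarrow> bool" where
  "sheet p x r g \<longleftrightarrow> r > 0 \<and> open (g ` ball (p x) r) \<and> x \<in> g ` ball (p x) r \<and>
     homeomorphism (g ` ball (p x) r) (ball (p x) r) p g"

lemma sheetD:
  assumes "sheet p x r g"
  shows "r > 0" "open (g ` ball (p x) r)" "g (p x) = x" "continuous_on (g ` ball (p x) r) p"
    "continuous_on (ball (p x) r) g" "\<And>z. z \<in> ball (p x) r \<Longrightarrow> p (g z) = z"
    "\<And>y. y \<in> g ` ball (p x) r \<Longrightarrow> g (p y) = y"
    "\<And>y. y \<in> g ` ball (p x) r \<Longrightarrow> p y \<in> ball (p x) r"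
  using assms unfolding sheet_def homeomorphism_def by (auto simp del: mem_ball)

lemma sheet_exists:
  assumes G: "spread_domain p G" and S: "open S" "S \<subseteq> G" "x \<in> S"
  obtains r g where "sheet p x r g" "g ` ball (p x) r \<subseteq> S"
proof -
  have xG: "x \<in> G" using S by (rule_tac subsetD)
  have "\<forall>x\<in>G. \<exists>V g. open V \<and> x \<in> V \<and> V \<subseteq> G \<and> open (p ` V) \<and> homeomorphism V (p ` V) p g"
    using G by (simp add: spread_domain_def)
  with xG obtain V g where V: "open V" "x \<in> V" "V \<subseteq> G" "open (p ` V)" "homeomorphism V (p ` V) p g"
    by metis
  have "openin (top_of_set (p ` V)) (p ` (V \<inter> S))"
    by (rule homeomorphism_imp_open_map[OF V(5)]) (use S in auto)
  then have "open (p ` (V \<inter> S))" using V(4) by (simp add: openin_open_eq)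
  then obtain r where r: "r > 0" "ball (p x) r \<subseteq> p ` (V \<inter> S)"
    by (rule openE[of _ "p x"]) (use V(2) S(3) in auto)
  have gS: "g ` ball (p x) r \<subseteq> V \<inter> S"
  proof
    fix y assume "y \<in> g ` ball (p x) r"
    then obtain z where "z \<in> ball (p x) r" "y = g z" by (rule imageE) simp
    moreover from this r obtain v where "v \<in> V \<inter> S" "z = p v" by auto
    ultimately have "v \<in> V \<inter> S" "y = g (p v)" by auto
    then show "y \<in> V \<inter> S" using V(5) by (auto simp: homeomorphism_def)
  qed
  have bV: "ball (p x) r \<subseteq> p ` V" using r(2) by (rule subset_trans) auto
  have "openin (top_of_set V) (g ` ball (p x) r)"
    by (rule homeomorphism_imp_open_map[OF homeomorphism_symD[OF V(5)]]) (use bV in \<open>auto intro: open_subset\<close>)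
  then have "open (g ` ball (p x) r)" using V(1) by (simp add: openin_open_eq)
  moreover have "homeomorphism (g ` ball (p x) r) (ball (p x) r) p g"
  proof (rule homeomorphismI)
    have V5: "continuous_on V p" "continuous_on (p ` V) g" "\<And>z. z \<in> p ` V \<Longrightarrow> p (g z) = z"
      using V(5) by (auto simp: homeomorphism_def)
    show "continuous_on (g ` ball (p x) r) p" by (rule continuous_on_subset[OF V5(1)]) (use gS in auto)
    show "continuous_on (ball (p x) r) g" by (rule continuous_on_subset[OF V5(2) bV])
    show "p (g z) = z" if "z \<in> ball (p x) r" for z using V5(3)[of z] bV that by (simp add: subset_iff)
    then show "p ` g ` ball (p x) r \<subseteq> ball (p x) r" by (auto simp del: mem_ball)
    fix y assume "y \<in> g ` ball (p x) r"
    then show "g (p y) = y" using \<open>\<And>z. z \<in> ball (p x) r \<Longrightarrow> p (g z) = z\<close> by (auto simp del: mem_ball)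
  qed auto
  moreover have "x \<in> g ` ball (p x) r"
  proof -
    have "g (p x) = x" using V by (auto simp: homeomorphism_def)
    then show ?thesis using r(1) by (metis centre_in_ball imageI)
  qed
  ultimately have "sheet p x r g" using r(1) by (simp add: sheet_def)
  then show thesis using gS by (intro that) auto
qed

lemma sheet_filterlim:
  assumes sh: "sheet p x r g" and z: "z \<in> ball (p x) r"
  shows "filterlim g (at (g z)) (at z)" "filterlim p (at z) (at (g z))"
proof -
  note D = sheetD[OF sh]
  have ev: "\<forall>\<^sub>F w in at z. w \<in> ball (p x) r"
    using z by (intro eventually_at_in_open') auto
  have ev2: "\<forall>\<^sub>F y in at (g z). y \<in> g ` ball (p x) r"
    using z D(2) by (intro eventually_at_in_open') auto
  show "filterlim g (at (g z)) (at z)"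
    unfolding filterlim_at
  proof
    show "\<forall>\<^sub>F w in at z. g w \<in> UNIV \<and> g w \<noteq> g z"
      using ev eventually_neq_at_within[of z z UNIV] by eventually_elim (metis D(6) UNIV_I z)
    show "g \<midarrow>z\<rightarrow> g z"
      using D(5) z by (metis continuous_on_eq_continuous_at isContD open_ball)
  qed
  show "filterlim p (at z) (at (g z))"
    unfolding filterlim_at
  proof
    show "\<forall>\<^sub>F y in at (g z). p y \<in> UNIV \<and> p y \<noteq> z"
      using ev2 eventually_neq_at_within[of "g z" "g z" UNIV] by eventually_elim (metis D(7) UNIV_I)
    have "p \<midarrow>g z\<rightarrow> p (g z)"
      using D(2,4) z by (metis continuous_on_eq_continuous_at isContD imageI)
    then show "p \<midarrow>g z\<rightarrow> z" using D(6)[OF z] by simp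
  qed
qed

text \<open>The difference quotients agree under z = p y. The point is that \<open>g\<close> and
  \<open>p\<close> carry the punctured neighbourhoods into each other, by continuity and injectivity
  on the sheet.\<close>

lemma has_xi_derivative_sheet:
  assumes sh: "sheet p x r g" and z: "z \<in> ball (p x) r"
  shows "has_xi_derivative p f D (g z) \<longleftrightarrow> ((\<lambda>w. f (g w)) has_field_derivative D) (at z)"
proof -
  note D = sheetD[OF sh]
  have pz: "p (g z) = z" using D(6)[OF z] .
  have ev: "\<forall>\<^sub>F w in at z. w \<in> ball (p x) r"
    using z by (intro eventually_at_in_open') auto
  have ev2: "\<forall>\<^sub>F y in at (g z). y \<in> g ` ball (p x) r"
    using z D(2) by (intro eventually_at_in_open') auto
  show ?thesis
    unfolding has_xi_derivative_def has_field_derivative_iff pz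
  proof
    assume "((\<lambda>y. (f y - f (g z)) / (p y - z)) \<longlongrightarrow> D) (at (g z))"
    then have "((\<lambda>w. (f (g w) - f (g z)) / (p (g w) - z)) \<longlongrightarrow> D) (at z)"
      by (rule filterlim_compose[OF _ sheet_filterlim(1)[OF sh z]])
    moreover have "\<forall>\<^sub>F w in at z. (f (g w) - f (g z)) / (p (g w) - z) = (f (g w) - f (g z)) / (w - z)"
      using ev by eventually_elim (simp add: D(6) del: mem_ball)
    ultimately show "((\<lambda>w. (f (g w) - f (g z)) / (w - z)) \<longlongrightarrow> D) (at z)"
      by (simp add: tendsto_cong)
  next
    assume "((\<lambda>w. (f (g w) - f (g z)) / (w - z)) \<longlongrightarrow> D) (at z)"
    then have "((\<lambda>y. (f (g (p y)) - f (g z)) / (p y - z)) \<longlongrightarrow> D) (at (g z))"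
      by (rule filterlim_compose[OF _ sheet_filterlim(2)[OF sh z]])
    moreover have "\<forall>\<^sub>F y in at (g z). (f (g (p y)) - f (g z)) / (p y - z) = (f y - f (g z)) / (p y - z)"
      using ev2 by eventually_elim (metis D(7))
    ultimately show "((\<lambda>y. (f y - f (g z)) / (p y - z)) \<longlongrightarrow> D) (at (g z))"
      by (simp add: tendsto_cong)
  qed
qed

text \<open>\<open>xi_deriv\<close> is a \<open>Lim\<close>, which is determined only at a point
  that is not isolated; the sheet transports this property from the plane.\<close>

lemma xi_deriv_sheet:
  assumes sh: "sheet p x r g" and z: "z \<in> ball (p x) r" and D: "has_xi_derivative p f D (g z)"
  shows "xi_deriv p f (g z) = D"
proof -
  have "at (g z) \<noteq> bot"
    using sheet_filterlim(1)[OF sh z] trivial_limit_at[of z]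
    by (auto simp: filterlim_def bot_unique filtermap_bot_iff)
  then show ?thesis
    using D unfolding has_xi_derivative_def xi_deriv_def by (intro tendsto_Lim)
qed

lemma xi_holomorphic_on_sheet:
  assumes sh: "sheet p x r g"
  shows "xi_holomorphic_on p f (g ` ball (p x) r) \<longleftrightarrow> (\<lambda>w. f (g w)) holomorphic_on ball (p x) r"
  unfolding xi_holomorphic_on_def holomorphic_on_open[OF open_ball] ball_simps
  using has_xi_derivative_sheet[OF sh] by (metis image_iff)

lemma xi_deriv_sheet_eq:
  assumes sh: "sheet p x r g" and z: "z \<in> ball (p x) r"
    and f: "(\<lambda>w. f (g w)) holomorphic_on ball (p x) r"
  shows "xi_deriv p f (g z) = deriv (\<lambda>w. f (g w)) z"
  using xi_deriv_sheet[OF sh z] has_xi_derivative_sheet[OF sh z] holomorphic_derivI[OF f open_ball z] by blast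

lemma xi_holomorphic_on_subset: "xi_holomorphic_on p f S \<Longrightarrow> T \<subseteq> S \<Longrightarrow> xi_holomorphic_on p f T"
  by (auto simp: xi_holomorphic_on_def)

lemma xi_deriv_eqI:
  assumes G: "spread_domain p G" and x: "x \<in> G" and D: "has_xi_derivative p f D x"
  shows "xi_deriv p f x = D"
proof -
  obtain r g where sh: "sheet p x r g"
    using sheet_exists[OF G _ order.refl x] G unfolding spread_domain_def by metis
  show ?thesis
    using xi_deriv_sheet[OF sh, of "p x" f D] sheetD(1,3)[OF sh] D by simp
qed

lemma xi_holomorphic_on_deriv:
  assumes G: "spread_domain p G" and S: "open S" "S \<subseteq> G" and f: "xi_holomorphic_on p f S"
  shows "xi_holomorphic_on p (xi_deriv p f) S"
  unfolding xi_holomorphic_on_def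
proof
  fix x assume x: "x \<in> S"
  obtain r g where sh: "sheet p x r g" and gS: "g ` ball (p x) r \<subseteq> S"
    using sheet_exists[OF G S x] .
  have hol: "(\<lambda>w. f (g w)) holomorphic_on ball (p x) r"
    using xi_holomorphic_on_sheet[OF sh] xi_holomorphic_on_subset[OF f gS] by simp
  have "(\<lambda>w. xi_deriv p f (g w)) holomorphic_on ball (p x) r"
    using holomorphic_deriv[OF hol open_ball] xi_deriv_sheet_eq[OF sh _ hol]
    by (subst holomorphic_cong[OF refl]) auto
  then have "xi_holomorphic_on p (xi_deriv p f) (g ` ball (p x) r)"
    using xi_holomorphic_on_sheet[OF sh] by simp
  moreover have "x \<in> g ` ball (p x) r" using sh by (simp add: sheet_def)
  ultimately show "\<exists>D. has_xi_derivative p (xi_deriv p f) D x"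
    by (auto simp: xi_holomorphic_on_def)
qed

lemma xi_holomorphic_on_imp_continuous_on:
  assumes G: "spread_domain p G" and S: "open S" "S \<subseteq> G" and f: "xi_holomorphic_on p f S"
  shows "continuous_on S f"
proof (subst continuous_on_eq_continuous_at[OF S(1)], intro ballI)
  fix x assume x: "x \<in> S"
  obtain r g where sh: "sheet p x r g" and gS: "g ` ball (p x) r \<subseteq> S"
    using sheet_exists[OF G S x] .
  note D = sheetD[OF sh]
  have hol: "(\<lambda>w. f (g w)) holomorphic_on ball (p x) r"
    using xi_holomorphic_on_sheet[OF sh] xi_holomorphic_on_subset[OF f gS] by simp
  have "continuous_on (g ` ball (p x) r) (\<lambda>y. f (g (p y)))"
    by (rule continuous_on_compose2[OF holomorphic_on_imp_continuous_on[OF hol] D(4)]) (use D(8) in auto)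
  then have "continuous_on (g ` ball (p x) r) f"
    using D(7) by (metis (mono_tags, lifting) continuous_on_cong)
  moreover have "x \<in> g ` ball (p x) r" using sh by (simp add: sheet_def)
  ultimately show "isCont f x" using D(2) continuous_on_eq_continuous_at by blast
qed

section \<open>Rules of differentiation, and rays on the surface\<close>

lemma has_xi_derivative_add:
  "has_xi_derivative p f D x \<Longrightarrow> has_xi_derivative p g E x \<Longrightarrow> has_xi_derivative p (\<lambda>y. f y + g y) (D + E) x"
  unfolding has_xi_derivative_def
  by (drule (1) tendsto_add) (simp add: add_divide_distrib[symmetric] algebra_simps)

lemma has_xi_derivative_cmult:
  "has_xi_derivative p f D x \<Longrightarrow> has_xi_derivative p (\<lambda>y. c * f y) (c * D) x"
  unfolding has_xi_derivative_def
  by (drule tendsto_mult_left[where c = c]) (simp add: right_diff_distrib[symmetric])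

text \<open>Along the ray \<open>p\<close> changes by -\<epsilon> times the parameter, so the chain
  rule contributes the factor -\<epsilon>. Since \<open>p\<close> is injective along the ray,
  \<open>h\<close> maps punctured neighbourhoods into punctured neighbourhoods, and the limit that
  defines \<open>D\<close> can be composed with \<open>h\<close>. At s = 0 the derivative is
  one-sided.\<close>

lemma has_xi_derivative_along_ray:
  assumes h: "horizontal_ray p S \<epsilon> x h" and \<epsilon>: "\<epsilon> \<noteq> 0" and s: "s \<ge> 0"
    and D: "has_xi_derivative p f D (h s)"
  shows "((\<lambda>s. f (h s)) has_vector_derivative (- of_real \<epsilon> * D)) (at s within {0..})"
proof -
  have hp: "p (h a) = p x - of_real (\<epsilon> * a)" if "a \<ge> 0" for a
    using h that by (auto simp: horizontal_ray_def)
  have hc: "(h \<longlongrightarrow> h s) (at s within {0..})"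
    using h s by (auto simp: horizontal_ray_def continuous_on)
  have ev: "\<forall>\<^sub>F a in at s within {0..}. a \<in> {0..} \<and> a \<noteq> s"
    by (auto simp: eventually_at_filter)
  have "filterlim h (at (h s)) (at s within {0..})"
    unfolding filterlim_at
  proof
    show "\<forall>\<^sub>F a in at s within {0..}. h a \<in> UNIV \<and> h a \<noteq> h s"
      using ev
    proof eventually_elim
      case (elim a)
      then have "p (h a) \<noteq> p (h s)" using hp[of a] hp[of s] s \<epsilon> by auto
      then show ?case by auto
    qed
  qed fact
  then have "((\<lambda>a. (f (h a) - f (h s)) / (p (h a) - p (h s))) \<longlongrightarrow> D) (at s within {0..})"
    using D unfolding has_xi_derivative_def by (rule filterlim_compose[rotated])
  then have "((\<lambda>a. - of_real \<epsilon> * ((f (h a) - f (h s)) / (p (h a) - p (h s)))) \<longlongrightarrow> - of_real \<epsilon> * D) (at s within {0..})"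
    by (intro tendsto_intros)
  then have "((\<lambda>a. norm (- of_real \<epsilon> * ((f (h a) - f (h s)) / (p (h a) - p (h s))) - (- of_real \<epsilon> * D))) \<longlongrightarrow> 0) (at s within {0..})"
    by (intro tendsto_norm_zero LIM_zero)
  moreover have "\<forall>\<^sub>F a in at s within {0..}. norm (- of_real \<epsilon> * ((f (h a) - f (h s)) / (p (h a) - p (h s))) - (- of_real \<epsilon> * D))
      = norm ((1 / norm (a - s)) *\<^sub>R (f (h a) - (f (h s) + (a - s) *\<^sub>R (- of_real \<epsilon> * D))))"
    using ev
  proof eventually_elim
    case (elim a)
    have "p (h a) - p (h s) = - of_real \<epsilon> * of_real (a - s)"
      using hp[of a] hp[of s] s elim by (simp add: algebra_simps)
    then have "- of_real \<epsilon> * ((f (h a) - f (h s)) / (p (h a) - p (h s))) = (f (h a) - f (h s)) / of_real (a - s)"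
      using \<epsilon> by simp
    then have "- of_real \<epsilon> * ((f (h a) - f (h s)) / (p (h a) - p (h s))) - (- of_real \<epsilon> * D)
       = (f (h a) - (f (h s) + (a - s) *\<^sub>R (- of_real \<epsilon> * D))) / of_real (a - s)"
      using elim \<epsilon> by (simp add: field_simps scaleR_conv_of_real eq_neg_iff_add_eq_0 del: of_real_diff)
    then show ?case by (simp add: norm_divide divide_inverse mult.commute norm_mult norm_inverse del: of_real_diff) (simp only: norm_of_real)?
  qed
  ultimately have "((\<lambda>a. norm ((1 / norm (a - s)) *\<^sub>R (f (h a) - (f (h s) + (a - s) *\<^sub>R (- of_real \<epsilon> * D))))) \<longlongrightarrow> 0) (at s within {0..})"
    by (rule Lim_transform_eventually)
  then have "((\<lambda>a. (1 / norm (a - s)) *\<^sub>R (f (h a) - (f (h s) + (a - s) *\<^sub>R (- of_real \<epsilon> * D)))) \<longlongrightarrow> 0) (at s within {0..})"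
    by (rule tendsto_norm_zero_cancel)
  then show ?thesis
    unfolding has_vector_derivative_def has_derivative_within
    by (intro conjI bounded_linear_scaleR_left)
qed

text \<open>The set where two lifts agree is closed because the space is Hausdorff, open because
  \<open>p\<close> is injective on a sheet, and contains 0; the half-line is connected.\<close>

lemma horizontal_ray_unique:
  assumes G: "spread_domain p G" and S: "open S" "S \<subseteq> G"
    and h: "horizontal_ray p S \<epsilon> x h" and k: "horizontal_ray p S \<epsilon> x k" and s: "s \<ge> 0"
  shows "h s = k s"
proof -
  let ?T = "{0..} :: real set"
  let ?A = "{s \<in> ?T. h s = k s}"
  have ch: "continuous_on ?T h" and ck: "continuous_on ?T k"
    using h k by (auto simp: horizontal_ray_def)
  have "closedin (top_of_set ?T) (?T \<inter> (\<lambda>s. (h s, k s)) -` {y. \<exists>x. y = (x, x)})"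
    by (intro continuous_closedin_preimage continuous_on_Pair ch ck closed_diagonal)
  moreover have "?T \<inter> (\<lambda>s. (h s, k s)) -` {y. \<exists>x. y = (x, x)} = ?A" by auto
  ultimately have cl: "closedin (top_of_set ?T) ?A" by simp
  have op: "openin (top_of_set ?T) ?A"
  proof (subst openin_subopen, intro ballI)
    fix a assume a: "a \<in> ?A"
    then have ha: "h a \<in> S" using h by (auto simp: horizontal_ray_def)
    obtain r g where sh: "sheet p (h a) r g" "g ` ball (p (h a)) r \<subseteq> S"
      using sheet_exists[OF G S ha] .
    note D = sheetD[OF sh(1)]
    let ?V = "g ` ball (p (h a)) r"
    let ?N = "(?T \<inter> h -` ?V) \<inter> (?T \<inter> k -` ?V)"
    have "openin (top_of_set ?T) ?N"
      by (intro openin_Int continuous_openin_preimage_gen ch ck D(2))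
    moreover have "h a \<in> ?V" using sh(1) by (simp add: sheet_def)
    then have "a \<in> ?N" using a by auto
    moreover have "?N \<subseteq> ?A"
    proof
      fix b assume b: "b \<in> ?N"
      then have "p (h b) = p (k b)" using h k by (auto simp: horizontal_ray_def)
      have V: "h b \<in> ?V" "k b \<in> ?V" "b \<in> ?T" using b by auto
      have "h b = g (p (h b))" using D(7)[OF V(1)] by (rule sym)
      also have "\<dots> = k b" unfolding \<open>p (h b) = p (k b)\<close> by (rule D(7)[OF V(2)])
      finally show "b \<in> ?A" using V(3) by simp
    qed
    ultimately show "\<exists>T. openin (top_of_set ?T) T \<and> a \<in> T \<and> T \<subseteq> ?A" by blast
  qed
  have "connected ?T" by simp
  then have "?A = {} \<or> ?A = ?T" using cl op unfolding connected_clopen by blast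
  moreover have "0 \<in> ?A" using h k by (auto simp: horizontal_ray_def)
  ultimately show ?thesis using s by auto
qed

lemma horizontal_ray_ray:
  assumes "\<exists>h. horizontal_ray p S \<epsilon> x h"
  shows "horizontal_ray p S \<epsilon> x (ray p S \<epsilon> x)"
  unfolding ray_def using assms by (rule someI_ex)

lemma horizontal_ray_shift:
  assumes h: "horizontal_ray p S \<epsilon> x h" and s: "s \<ge> 0"
  shows "horizontal_ray p S \<epsilon> (h s) (\<lambda>v. h (s + v))"
proof -
  have c: "continuous_on {0..} h" and S: "h a \<in> S" and hp: "p (h a) = p x - of_real (\<epsilon> * a)" if "a \<ge> 0" for a
    using h that by (simp_all add: horizontal_ray_def)
  have "continuous_on {0..} (\<lambda>v. h (s + v))"
    by (rule continuous_on_compose2[OF c]) (use s in \<open>auto intro!: continuous_intros\<close>)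
  moreover have "p (h (s + v)) = p (h s) - of_real (\<epsilon> * v)" if "v \<ge> 0" for v
    using hp[of "s + v"] hp[OF s] that s by (simp add: distrib_left)
  ultimately show ?thesis
    using S s by (simp add: horizontal_ray_def)
qed

text \<open>\<open>ray\<close> chooses a lift separately for each starting point. Uniqueness makes
  the choices compatible, so that moving along rays is a semigroup.\<close>

lemma ray_ray:
  assumes G: "spread_domain p G" and S: "open S" "S \<subseteq> G" and x: "\<exists>h. horizontal_ray p S \<epsilon> x h"
    and s: "s \<ge> 0" "v \<ge> 0"
  shows "ray p S \<epsilon> (ray p S \<epsilon> x s) v = ray p S \<epsilon> x (s + v)"
proof -
  note sh = horizontal_ray_shift[OF horizontal_ray_ray[OF x] s(1)]
  show ?thesis
    by (rule horizontal_ray_unique[OF G S horizontal_ray_ray sh s(2)]) (use sh in blast)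
qed

section \<open>Functions of two variables\<close>

lemma deriv_eq_circle_integral:
  assumes "f holomorphic_on A" "open A" "cball t \<delta> \<subseteq> A" "\<delta> > 0"
  shows "deriv f t = integral {0..1::real} (\<lambda>s. f (t + of_real \<delta> * circ s) * exp (- (2 * pi * \<i> * of_real s))) / of_real \<delta>"
  using integral_unique[OF deriv_circle_mean[OF assms, of 1]] assms(4) by simp

text \<open>Near each \<open>t\<close> one radius serves all circles, so the derivative is an
  integral over [0, 1] of a jointly continuous integrand. The second variable may range over any
  topological space, hence also over the surface.\<close>

lemma continuous_on_deriv_param:
  fixes F :: "complex \<Rightarrow> 'a::topological_space \<Rightarrow> complex"
  assumes cont: "continuous_on (T \<times> S) (\<lambda>(t, x). F t x)"
    and hol: "\<And>x. x \<in> S \<Longrightarrow> (\<lambda>t. F t x) holomorphic_on T"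
    and T: "open T" and S: "open S"
  shows "continuous_on (T \<times> S) (\<lambda>(t, x). deriv (\<lambda>t. F t x) t)"
proof -
  have loc: "\<exists>\<delta>>0. ball t \<delta> \<subseteq> T \<and> continuous_on (ball t \<delta> \<times> S) (\<lambda>(t, x). deriv (\<lambda>t. F t x) t)" if "t \<in> T" for t
  proof -
    obtain \<epsilon> where \<epsilon>: "\<epsilon> > 0" "ball t \<epsilon> \<subseteq> T" using T \<open>t \<in> T\<close> by (meson openE)
    define \<delta> where "\<delta> = \<epsilon> / 3"
    have \<delta>: "\<delta> > 0" using \<epsilon> by (simp add: \<delta>_def)
    have sub: "cball w \<delta> \<subseteq> T" if "w \<in> ball t \<delta>" for w
    proof
      fix z assume "z \<in> cball w \<delta>"
      then have "dist t z < \<epsilon>" using that dist_triangle[of t z w] \<epsilon> by (simp add: \<delta>_def)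
      then show "z \<in> T" using \<epsilon> by auto
    qed
    have in_T: "w + of_real \<delta> * circ s \<in> T" if "w \<in> ball t \<delta>" for w and s :: real
    proof -
      have "norm (circ s) = 1" by simp
      then have "w + of_real \<delta> * circ s \<in> cball w \<delta>"
        using \<delta> by (simp add: dist_norm norm_mult)
      then show ?thesis using sub[OF that] by blast
    qed
    have c1: "continuous_on ((ball t \<delta> \<times> S) \<times> {0..1}) (\<lambda>((w, x), s). F (w + of_real \<delta> * circ s) x)"
    proof -
      have "continuous_on ((ball t \<delta> \<times> S) \<times> {0..1::real}) (\<lambda>y. (\<lambda>(t, x). F t x) (fst (fst y) + of_real \<delta> * exp (2 * pi * \<i> * of_real (snd y)), snd (fst y)))"
        by (rule continuous_on_compose2[OF cont]) (use in_T in \<open>auto intro!: continuous_intros\<close>)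
      then show ?thesis by (simp add: split_def)
    qed
    have "continuous_on ((ball t \<delta> \<times> S) \<times> cbox 0 1) (\<lambda>(y, s). F (fst y + of_real \<delta> * circ s) (snd y) * exp (- (2 * pi * \<i> * of_real s)))"
      using c1 by (auto simp: split_def intro!: continuous_intros)
    from integral_continuous_on_param[OF this]
    have "continuous_on (ball t \<delta> \<times> S) (\<lambda>y. integral {0..1} (\<lambda>s. F (fst y + of_real \<delta> * circ s) (snd y) * exp (- (2 * pi * \<i> * of_real s))) / of_real \<delta>)"
      using \<delta> by (auto intro!: continuous_intros)
    moreover have "integral {0..1} (\<lambda>s. F (fst y + of_real \<delta> * circ s) (snd y) * exp (- (2 * pi * \<i> * of_real s))) / of_real \<delta>
        = (case y of (t, x) \<Rightarrow> deriv (\<lambda>t. F t x) t)" if y_in: "y \<in> ball t \<delta> \<times> S" for y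
    proof -
      obtain w x where y: "y = (w, x)" "w \<in> ball t \<delta>" "x \<in> S" using y_in by (auto simp del: mem_ball)
      show ?thesis unfolding y using deriv_eq_circle_integral[OF hol[OF y(3)] T sub[OF y(2)] \<delta>] by simp
    qed
    ultimately have "continuous_on (ball t \<delta> \<times> S) (\<lambda>(t, x). deriv (\<lambda>t. F t x) t)"
      by (rule continuous_on_eq)
    moreover have "ball t \<delta> \<subseteq> T" using sub \<delta> by (force simp: subset_iff)
    ultimately show ?thesis using \<delta> by blast
  qed
  then obtain \<delta> where \<delta>: "\<And>t. t \<in> T \<Longrightarrow> \<delta> t > 0 \<and> ball t (\<delta> t) \<subseteq> T \<and> continuous_on (ball t (\<delta> t) \<times> S) (\<lambda>(t, x). deriv (\<lambda>t. F t x) t)"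
    by metis
  have "continuous_on (\<Union>t\<in>T. ball t (\<delta> t) \<times> S) (\<lambda>(t, x). deriv (\<lambda>t. F t x) t)"
    using \<delta> S by (intro continuous_on_open_UN) (auto intro: open_Times)
  moreover have "(\<Union>t\<in>T. ball t (\<delta> t) \<times> S) = T \<times> S"
    using \<delta> by force
  ultimately show ?thesis by simp
qed

lemma deriv_param_leibniz:
  fixes f :: "complex \<Rightarrow> complex \<Rightarrow> complex"
  assumes A: "open A" and B: "open B"
    and cont: "continuous_on (A \<times> B) (\<lambda>(t, z). f t z)"
    and hol1: "\<And>z. z \<in> B \<Longrightarrow> (\<lambda>t. f t z) holomorphic_on A"
    and hol2: "\<And>t. t \<in> A \<Longrightarrow> f t holomorphic_on B"
    and sub: "cball t \<delta> \<subseteq> A" and \<delta>: "\<delta> > 0" and z: "z \<in> B"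
  shows "((\<lambda>z. deriv (\<lambda>t. f t z) t) has_field_derivative
    integral {0..1::real} (\<lambda>s. deriv (f (t + of_real \<delta> * circ s)) z * exp (- (2 * pi * \<i> * of_real s))) / of_real \<delta>) (at z)"
proof -
  obtain \<epsilon> where \<epsilon>: "\<epsilon> > 0" "ball z \<epsilon> \<subseteq> B" using B z by (meson openE)
  let ?w = "\<lambda>s::real. t + of_real \<delta> * circ s"
  let ?e = "\<lambda>s::real. exp (- (2 * pi * \<i> * of_real s))"
  have w: "?w s \<in> A" for s
  proof -
    have "norm (circ s) = 1" by simp
    then have "?w s \<in> cball t \<delta>" using \<delta> by (simp add: dist_norm norm_mult)
    then show ?thesis using sub by blast
  qed
  have "continuous_on (B \<times> A) ((\<lambda>(t, z). f t z) \<circ> prod.swap)"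
    by (intro continuous_on_compose continuous_on_swap) (simp add: product_swap cont)
  then have cont': "continuous_on (B \<times> A) (\<lambda>(z, t). f t z)" by (simp add: o_def split_def)
  have cz: "continuous_on (B \<times> A) (\<lambda>(z, t). deriv (f t) z)"
    by (rule continuous_on_deriv_param[where F = "\<lambda>z t. f t z", OF cont' hol2 B A])
  have "((\<lambda>z. integral (cbox 0 1) (\<lambda>s. f (?w s) z * ?e s)) has_field_derivative
      integral (cbox 0 1) (\<lambda>s. deriv (f (?w s)) z * ?e s)) (at z within ball z \<epsilon>)"
  proof (rule leibniz_rule_field_derivative)
    fix y s assume y: "y \<in> ball z \<epsilon>" "s \<in> cbox 0 (1::real)"
    then have "y \<in> B" using \<epsilon>(2) by (simp add: subset_iff)
    then have "(f (?w s) has_field_derivative deriv (f (?w s)) y) (at y)"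
      by (rule holomorphic_derivI[OF hol2[OF w] B])
    then show "((\<lambda>z. f (?w s) z * ?e s) has_field_derivative deriv (f (?w s)) y * ?e s) (at y within ball z \<epsilon>)"
      by (rule DERIV_cmult_right[OF has_field_derivative_at_within])
  next
    fix y assume y: "y \<in> ball z \<epsilon>"
    have "continuous_on {0..1} (\<lambda>s. (\<lambda>(t, z). f t z) (?w s, y))"
      by (rule continuous_on_compose2[OF cont]) (use w y \<epsilon>(2) in \<open>auto intro!: continuous_intros simp del: mem_ball\<close>)
    then show "(\<lambda>s. f (?w s) y * ?e s) integrable_on cbox 0 1"
      by (intro integrable_continuous) (auto intro!: continuous_intros)
  next
    have "continuous_on (ball z \<epsilon> \<times> cbox 0 1) (\<lambda>q. (\<lambda>(z, t). deriv (f t) z) (fst q, ?w (snd q)))"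
      by (rule continuous_on_compose2[OF cz]) (use w \<epsilon>(2) in \<open>auto intro!: continuous_intros simp del: mem_ball\<close>)
    then show "continuous_on (ball z \<epsilon> \<times> cbox 0 1) (\<lambda>(z, s). deriv (f (?w s)) z * ?e s)"
      by (auto simp: split_def intro!: continuous_intros)
  qed (use \<epsilon> in auto)
  then have "((\<lambda>z. integral {0..1} (\<lambda>s. f (?w s) z * ?e s) / of_real \<delta>) has_field_derivative
      integral {0..1} (\<lambda>s. deriv (f (?w s)) z * ?e s) / of_real \<delta>) (at z)"
    using \<epsilon> by (subst (asm) at_within_open) (auto intro: DERIV_cdivide)
  note der = this
  have ev: "\<forall>\<^sub>F y in nhds z. integral {0..1} (\<lambda>s. f (?w s) y * ?e s) / of_real \<delta> = deriv (\<lambda>t. f t y) t"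
    using eventually_nhds_in_open[OF B z]
    by eventually_elim (simp add: deriv_eq_circle_integral[OF hol1 A sub \<delta>])
  show ?thesis
    using der DERIV_cong_ev[OF refl ev refl] by simp
qed

text \<open>Differentiating Cauchy's circle formula for d/dt under the integral with respect to z
  gives Cauchy's formula for d/dt of df/dz, hence the symmetry of the mixed derivatives. That df/dz
  is holomorphic in t follows in the same way with the variables exchanged.\<close>

lemma mixed_derivative:
  fixes f :: "complex \<Rightarrow> complex \<Rightarrow> complex"
  assumes A: "open A" and B: "open B"
    and cont: "continuous_on (A \<times> B) (\<lambda>(t, z). f t z)"
    and hol1: "\<And>z. z \<in> B \<Longrightarrow> (\<lambda>t. f t z) holomorphic_on A"
    and hol2: "\<And>t. t \<in> A \<Longrightarrow> f t holomorphic_on B"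
    and t: "t \<in> A" and z: "z \<in> B"
  shows "((\<lambda>z. deriv (\<lambda>t. f t z) t) has_field_derivative deriv (\<lambda>t. deriv (f t) z) t) (at z)"
    and "((\<lambda>t. deriv (f t) z) has_field_derivative deriv (\<lambda>t. deriv (f t) z) t) (at t)"
proof -
  have "continuous_on (B \<times> A) ((\<lambda>(t, z). f t z) \<circ> prod.swap)"
    by (intro continuous_on_compose continuous_on_swap) (simp add: product_swap cont)
  then have cont': "continuous_on (B \<times> A) (\<lambda>(z, t). f t z)" by (simp add: o_def split_def)
  obtain r where r: "r > 0" "cball z r \<subseteq> B" using B z by (meson open_contains_cball)
  have hol: "(\<lambda>t. deriv (f t) z) holomorphic_on A"
    unfolding holomorphic_on_open[OF A]
    using deriv_param_leibniz[where f = "\<lambda>z t. f t z", OF B A cont' hol2 hol1 r(2,1)] by blast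
  then show "((\<lambda>t. deriv (f t) z) has_field_derivative deriv (\<lambda>t. deriv (f t) z) t) (at t)"
    using A t by (intro holomorphic_derivI)
  obtain \<delta> where \<delta>: "\<delta> > 0" "cball t \<delta> \<subseteq> A" using A t by (meson open_contains_cball)
  show "((\<lambda>z. deriv (\<lambda>t. f t z) t) has_field_derivative deriv (\<lambda>t. deriv (f t) z) t) (at z)"
    using deriv_param_leibniz[OF A B cont hol1 hol2 \<delta>(2,1) z]
    by (simp add: deriv_eq_circle_integral[OF hol A \<delta>(2,1)])
qed

lemma analytic_in_both_local:
  assumes an: "analytic_in_both p F T S" and sh: "sheet p x r g" and gS: "g ` ball (p x) r \<subseteq> S"
  shows "continuous_on (T \<times> ball (p x) r) (\<lambda>(t, z). F t (g z))"
    and "\<And>z. z \<in> ball (p x) r \<Longrightarrow> (\<lambda>t. F t (g z)) holomorphic_on T"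
    and "\<And>t. t \<in> T \<Longrightarrow> (\<lambda>z. F t (g z)) holomorphic_on ball (p x) r"
proof -
  note D = sheetD[OF sh]
  have c: "continuous_on (T \<times> S) (\<lambda>(t, x). F t x)" using an by (simp add: analytic_in_both_def)
  have "continuous_on (T \<times> ball (p x) r) (\<lambda>q. (\<lambda>(t, x). F t x) (fst q, g (snd q)))"
  proof (rule continuous_on_compose2[OF c])
    show "continuous_on (T \<times> ball (p x) r) (\<lambda>q. (fst q, g (snd q)))"
      by (intro continuous_intros continuous_on_compose2[OF D(5)]) auto
  qed (use gS in auto)
  then show "continuous_on (T \<times> ball (p x) r) (\<lambda>(t, z). F t (g z))" by (simp add: split_def)
  show "(\<lambda>t. F t (g z)) holomorphic_on T" if "z \<in> ball (p x) r" for z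
    using an gS that by (auto simp: analytic_in_both_def simp del: mem_ball)
  show "(\<lambda>z. F t (g z)) holomorphic_on ball (p x) r" if "t \<in> T" for t
  proof -
    have "xi_holomorphic_on p (F t) (g ` ball (p x) r)"
      using an that by (intro xi_holomorphic_on_subset[OF _ gS]) (simp add: analytic_in_both_def)
    then show ?thesis by (simp add: xi_holomorphic_on_sheet[OF sh])
  qed
qed

text \<open>The second claim exchanges d/dt with d/d\<xi>; it takes care of the differential term
  when L is commuted with d/dt.\<close>

lemma analytic_in_both_deriv:
  assumes G: "spread_domain p G" and S: "open S" "S \<subseteq> G" and T: "open T"
    and an: "analytic_in_both p F T S"
  shows "analytic_in_both p (\<lambda>t x. deriv (\<lambda>t. F t x) t) T S"
    and "\<And>t x. t \<in> T \<Longrightarrow> x \<in> S \<Longrightarrow>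
      ((\<lambda>t. xi_deriv p (F t) x) has_field_derivative xi_deriv p (\<lambda>y. deriv (\<lambda>t. F t y) t) x) (at t)"
proof -
  have main: "has_xi_derivative p (\<lambda>y. deriv (\<lambda>t. F t y) t) (deriv (\<lambda>t. xi_deriv p (F t) x) t) x
     \<and> ((\<lambda>t. xi_deriv p (F t) x) has_field_derivative (deriv (\<lambda>t. xi_deriv p (F t) x) t)) (at t)"
    if t: "t \<in> T" and x: "x \<in> S" for t x
  proof -
    obtain r g where sh: "sheet p x r g" and gS: "g ` ball (p x) r \<subseteq> S"
      using sheet_exists[OF G S x] .
    note D = sheetD[OF sh] and L = analytic_in_both_local[OF an sh gS]
    have px: "p x \<in> ball (p x) r" using D(1) by simp
    have eq: "xi_deriv p (F t) x = deriv (\<lambda>z. F t (g z)) (p x)" if "t \<in> T" for t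
      using xi_deriv_sheet_eq[OF sh px L(3)[OF that]] D(3) by simp
    have ev: "\<forall>\<^sub>F t in nhds t. xi_deriv p (F t) x = deriv (\<lambda>z. F t (g z)) (p x)"
      using eventually_nhds_in_open[OF T t] by eventually_elim (rule eq)
    note M = mixed_derivative[OF T open_ball L t px]
    have M2: "((\<lambda>t. xi_deriv p (F t) x) has_field_derivative deriv (\<lambda>t. deriv (\<lambda>z. F t (g z)) (p x)) t) (at t)"
      using M(2) DERIV_cong_ev[OF refl ev refl] by blast
    have "has_xi_derivative p (\<lambda>y. deriv (\<lambda>t. F t y) t) (deriv (\<lambda>t. deriv (\<lambda>z. F t (g z)) (p x)) t) (g (p x))"
      using has_xi_derivative_sheet[OF sh px] M(1) by blast
    then show ?thesis using M2 DERIV_imp_deriv[OF M2] D(3) by simp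
  qed
  show "((\<lambda>t. xi_deriv p (F t) x) has_field_derivative xi_deriv p (\<lambda>y. deriv (\<lambda>t. F t y) t) x) (at t)"
    if "t \<in> T" "x \<in> S" for t x
    using main[OF that] xi_deriv_eqI[OF G, of x] S that by auto
  show "analytic_in_both p (\<lambda>t x. deriv (\<lambda>t. F t x) t) T S"
    unfolding analytic_in_both_def
  proof (intro conjI ballI)
    show "continuous_on (T \<times> S) (\<lambda>(t, x). deriv (\<lambda>t. F t x) t)"
      using an T S by (intro continuous_on_deriv_param) (auto simp: analytic_in_both_def)
    show "(\<lambda>t. deriv (\<lambda>t. F t x) t) holomorphic_on T" if "x \<in> S" for x
      using an that T by (auto simp: analytic_in_both_def intro!: holomorphic_deriv)
    show "xi_holomorphic_on p (\<lambda>x. deriv (\<lambda>t. F t x) t) S" if "t \<in> T" for t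
      using main that unfolding xi_holomorphic_on_def by blast
  qed
qed

section \<open>Taylor coefficients in the unit disc\<close>

lemma norm_one_minus_circle:
  assumes "0 \<le> R"
  shows "(norm (1 - of_real R * circ s))\<^sup>2 = (1 - R)\<^sup>2 + 4 * R * (sin (pi * s))\<^sup>2"
proof -
  have e: "circ s = cis (2 * (pi * s))"
    by (simp add: cis_conv_exp mult_ac)
  have "(norm (1 - of_real R * cis (2 * (pi * s))))\<^sup>2 = (1 - R * cos (2 * (pi * s)))\<^sup>2 + (R * sin (2 * (pi * s)))\<^sup>2"
    by (simp add: cmod_power2)
  also have "\<dots> = 1 - 2 * R * cos (2 * (pi * s)) + R\<^sup>2 * ((sin (2 * (pi * s)))\<^sup>2 + (cos (2 * (pi * s)))\<^sup>2)"
    by algebra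
  also have "\<dots> = 1 - 2 * R * cos (2 * (pi * s)) + R\<^sup>2"
    by (simp only: sin_cos_squared_add mult_1_right)
  also have "\<dots> = 1 - 2 * R * (1 - 2 * (sin (pi * s))\<^sup>2) + R\<^sup>2"
    by (simp only: cos_double_sin)
  also have "\<dots> = (1 - R)\<^sup>2 + 4 * R * (sin (pi * s))\<^sup>2"
    by (simp add: power2_eq_square algebra_simps)
  finally show ?thesis unfolding e .
qed

text \<open>Concavity puts the graph above its chord from 0 to pi / 2.\<close>

lemma sin_pi_ge:
  fixes s :: real
  assumes "0 \<le> s" "s \<le> 1/2"
  shows "sin (pi * s) \<ge> 2 * s"
proof -
  have "concave_on {0..pi} sin" 
  proof (rule f''_le0_imp_concave)
    fix x :: real assume "x \<in> {0..pi}"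
    then show "- sin x \<le> 0" using sin_ge_zero by auto
  qed (auto intro!: derivative_eq_intros)
  then have "sin ((1 - 2 * s) *\<^sub>R 0 + (2 * s) *\<^sub>R (pi / 2)) \<ge> (1 - 2 * s) * sin 0 + (2 * s) * sin (pi / 2)"
    using assms by (intro concave_onD) auto
  then show ?thesis by (simp add: mult.commute)
qed

lemma norm_one_minus_circle_reflect:
  assumes "0 \<le> R"
  shows "norm (1 - of_real R * circ (1 - s)) = norm (1 - of_real R * circ s)"
proof -
  have "sin (pi * (1 - s)) = sin (pi * s)" by (simp add: right_diff_distrib)
  then have "(norm (1 - of_real R * circ (1 - s)))\<^sup>2 = (norm (1 - of_real R * circ s))\<^sup>2"
    unfolding norm_one_minus_circle[OF assms] by simp
  then show ?thesis by (simp add: power2_eq_iff_nonneg)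
qed

text \<open>The common part of the two coefficient estimates. Since |1 - R exp (2 pi i s)| is
  symmetric about s = 1/2, a majorant on [0, 1/2] suffices and counts twice.\<close>

lemma higher_deriv_bound_circle:
  fixes H :: "complex \<Rightarrow> complex" and m :: "real \<Rightarrow> real"
  assumes hol: "H holomorphic_on ball 0 1" and R: "0 < R" "R < 1"
    and m: "(m has_integral I) {0..1/2}" and m0: "m 0 \<ge> 0"
    and f: "\<And>z. z \<in> ball 0 1 \<Longrightarrow> norm (H z) \<le> f (norm (1 - z))"
    and b: "\<And>s. 0 < s \<Longrightarrow> s \<le> 1/2 \<Longrightarrow> f (norm (1 - of_real R * circ s)) \<le> m s"
  shows "norm ((deriv ^^ n) H 0 / fact n) * R ^ n \<le> 2 * I"
proof -
  let ?h = "\<lambda>s::real. H (0 + of_real R * circ s) * exp (- (2 * pi * \<i> * of_nat n * of_real s))"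
  have h: "(?h has_integral (deriv ^^ n) H 0 / fact n * of_real R ^ n) {0..1}"
    by (rule deriv_circle_mean[OF hol open_ball]) (use R in auto)
  \<comment> \<open>Assumption \<open>b\<close> says nothing at s = 0, where a majorant such as
    \<open>s powr (-\<tau>)\<close> has the value 0 by convention; the integrand is therefore set to
    0 at both end points.\<close>
  define f0 where "f0 s = (if s \<in> {0, 1} then 0 else ?h s)" for s
  have f0: "(f0 has_integral (deriv ^^ n) H 0 / fact n * of_real R ^ n) {0..1}"
    by (rule has_integral_spike_finite[OF _ _ h, of "{0, 1}"]) (auto simp: f0_def)
  have m': "((\<lambda>s. m (1 - s)) has_integral I) {1/2..1}"
    using has_integral_affinity[of m I 0 "1/2" "-1" 1] m by (simp add: algebra_simps)
  define M where "M s = (if s \<le> 1/2 then m s else m (1 - s))" for s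
  have "(M has_integral I) {0..1/2}"
    using m by (rule has_integral_eq[rotated]) (auto simp: M_def)
  moreover have "(M has_integral I) {1/2..1}"
    using m' by (rule has_integral_spike_finite[rotated 2, of _ _ _ "{1/2}"]) (auto simp: M_def)
  ultimately have M: "(M has_integral I + I) {0..1}"
    by (rule has_integral_combine[rotated 2]) auto
  have inb: "of_real R * circ s \<in> ball 0 1" for s
    using R by (simp add: norm_mult)
  have "norm (f0 s) \<le> M s" if s: "s \<in> {0..1}" for s
  proof (cases "s \<in> {0, 1}")
    case True
    then show ?thesis using m0 by (auto simp: f0_def M_def)
  next
    case False
    have "norm (f0 s) = norm (H (of_real R * circ s))"
      using False by (simp add: f0_def norm_mult)
    also have "\<dots> \<le> M s"
    proof (cases "s \<le> 1/2")
      case True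
      then show ?thesis using f[OF inb[of s]] b[of s] s False by (auto simp: M_def)
    next
      case s2: False
      have "norm (1 - of_real R * circ s) = norm (1 - of_real R * circ (1 - s))"
        using norm_one_minus_circle_reflect[of R s] R by simp
      then show ?thesis using f[OF inb[of s]] b[of "1 - s"] s s2 False by (simp add: M_def)
    qed
    finally show ?thesis .
  qed
  then have "norm (integral {0..1} f0) \<le> integral {0..1} M"
    using f0 M by (intro integral_norm_bound_integral) (auto simp: integrable_on_def)
  then show ?thesis
    using f0 M R by (simp add: integral_unique norm_mult norm_power norm_divide)
qed

text \<open>On the circle of radius R, |1 - z| \<ge> 4 s sqrt R for 0 \<le> s \<le> 1/2, and twice
  the integral of \<open>(4 * s) powr (-\<tau>)\<close> over [0, 1/2] is
  \<open>1 / (2 powr \<tau> * (1 - \<tau>))\<close>. As \<tau> < 1, the singularity at 1 is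
  integrable, so R may tend to 1 and the bound does not depend on \<open>n\<close>.\<close>

lemma taylor_coeff_bound:
  fixes H :: "complex \<Rightarrow> complex"
  assumes hol: "H holomorphic_on ball 0 1" and \<tau>: "0 < \<tau>" "\<tau> < 1" and K: "K \<ge> 0"
    and b: "\<And>s. s \<in> ball 0 1 \<Longrightarrow> norm (H s) \<le> K * norm (1 - s) powr (-\<tau>)"
  shows "norm ((deriv ^^ n) H 0 / fact n) \<le> K / 2 powr \<tau> / (1 - \<tau>)"
proof -
  let ?a = "norm ((deriv ^^ n) H 0 / fact n)"
  have "?a * R ^ n \<le> K / 2 powr \<tau> / (1 - \<tau>) * R powr (-\<tau>/2)" if R: "0 < R" "R < 1" for R :: real
  proof -
    define m where "m s = K * (R powr (-\<tau>/2) * 4 powr (-\<tau>)) * s powr (-\<tau>)" for s :: real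
    have "((\<lambda>s. s powr (-\<tau>)) has_integral (1/2) powr (-\<tau> + 1) / (-\<tau> + 1)) {0..1/2}"
      using \<tau> by (intro has_integral_powr_from_0) auto
    then have "(m has_integral K * (R powr (-\<tau>/2) * 4 powr (-\<tau>)) * ((1/2) powr (-\<tau> + 1) / (-\<tau> + 1))) {0..1/2}"
      unfolding m_def by (rule has_integral_mult_right)
    note mI = this
    have bd: "K * norm (1 - of_real R * circ s) powr (-\<tau>) \<le> m s" if s: "0 < s" "s \<le> 1/2" for s
    proof -
      let ?z = "norm (1 - of_real R * circ s)"
      have "(2 * s)\<^sup>2 \<le> (sin (pi * s))\<^sup>2" using sin_pi_ge[of s] s by (intro power_mono) auto
      then have "4 * R * (2 * s)\<^sup>2 \<le> 4 * R * (sin (pi * s))\<^sup>2" using R by (intro mult_left_mono) auto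
      also have "\<dots> \<le> ?z\<^sup>2"
        unfolding norm_one_minus_circle[OF order.strict_implies_order[OF R(1)]] by simp
      finally have "(sqrt R * (4 * s))\<^sup>2 \<le> ?z\<^sup>2" using R by (simp add: power_mult_distrib mult_ac)
      then have "sqrt R * (4 * s) \<le> ?z" by (rule power2_le_imp_le) auto
      then have "?z powr (-\<tau>) \<le> (sqrt R * (4 * s)) powr (-\<tau>)"
        using R s \<tau> by (intro powr_mono2') auto
      also have "\<dots> = R powr (-\<tau>/2) * 4 powr (-\<tau>) * s powr (-\<tau>)"
        using R s by (simp add: powr_mult powr_half_sqrt[symmetric] powr_powr)
      finally show ?thesis using K unfolding m_def by (simp add: mult_left_mono mult.assoc)
    qed
    have "?a * R ^ n \<le> 2 * (K * (R powr (-\<tau>/2) * 4 powr (-\<tau>)) * ((1/2) powr (-\<tau> + 1) / (-\<tau> + 1)))"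
      by (rule higher_deriv_bound_circle[OF hol R mI _ b bd]) (simp add: m_def)
    also have "\<dots> = K / 2 powr \<tau> / (1 - \<tau>) * R powr (-\<tau>/2)"
    proof -
      have "(4::real) powr (-\<tau>) = 2 powr (-\<tau>) * 2 powr (-\<tau>)"
        by (simp add: powr_mult[symmetric])
      moreover have "(1/2::real) powr (-\<tau> + 1) = 2 powr \<tau> / 2"
      proof -
        have "(1/2::real) powr (-\<tau> + 1) = (1/2) powr (-\<tau>) * (1/2) powr 1" by (rule powr_add)
        also have "(1/2::real) powr (-\<tau>) = 2 powr \<tau>" by (simp add: powr_divide powr_minus)
        finally show ?thesis by simp
      qed
      moreover have "(2::real) powr (-\<tau>) * 2 powr (-\<tau>) * (2 powr \<tau> / 2) = 1 / 2 powr \<tau> / 2"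
        by (simp add: powr_minus field_simps)
      ultimately have "(4::real) powr (-\<tau>) * (1/2) powr (-\<tau> + 1) = 1 / 2 powr \<tau> / 2"
        by (simp only:)
      moreover have "2 * (K * (A * X) * (Y / (-\<tau> + 1))) = 2 * K * A * (X * Y) / (1 - \<tau>)" for A X Y :: real
        by simp
      ultimately have "2 * (K * (R powr (-\<tau>/2) * 4 powr (-\<tau>)) * ((1/2) powr (-\<tau> + 1) / (-\<tau> + 1)))
          = 2 * K * R powr (-\<tau>/2) * (1 / 2 powr \<tau> / 2) / (1 - \<tau>)"
        by (simp only:)
      then show ?thesis by simp
    qed
    finally show ?thesis .
  qed
  then have ev: "\<forall>\<^sub>F R in at_left 1. ?a * R ^ n \<le> K / 2 powr \<tau> / (1 - \<tau>) * R powr (-\<tau>/2)"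
    by (intro eventually_at_leftI[of 0]) auto
  have t1: "((\<lambda>R. ?a * R ^ n) \<longlongrightarrow> ?a * 1 ^ n) (at_left 1)"
    by (intro tendsto_intros)
  have t2: "((\<lambda>R::real. K / 2 powr \<tau> / (1 - \<tau>) * R powr (-\<tau>/2)) \<longlongrightarrow> K / 2 powr \<tau> / (1 - \<tau>) * 1 powr (-\<tau>/2)) (at_left 1)"
    by (intro tendsto_intros) auto
  have "?a * 1 ^ n \<le> K / 2 powr \<tau> / (1 - \<tau>) * 1 powr (-\<tau>/2)"
    by (rule tendsto_le[OF trivial_limit_at_left_real t2 t1 ev])
  then show ?thesis by simp
qed

text \<open>Here the singularity at 1 is not integrable over the unit circle, so the radius has to
  stay below 1. R = 1 - 1 / (n + 2) costs only the factor R^(-n) \<le> e \<le> 3, whence 12 = 4 *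
  3.\<close>

lemma taylor_coeff_bound_2:
  fixes H :: "complex \<Rightarrow> complex"
  assumes hol: "H holomorphic_on ball 0 1" and \<tau>: "0 < \<tau>" and K: "K \<ge> 0"
    and b: "\<And>s. s \<in> ball 0 1 \<Longrightarrow> norm (H s) \<le> K * norm (1 - s) powr (- 2 - \<tau>)"
  shows "norm ((deriv ^^ n) H 0 / fact n) \<le> 12 * K * (real n + 2) powr (1 + \<tau>)"
proof -
  let ?a = "norm ((deriv ^^ n) H 0 / fact n)"
  define \<delta> where "\<delta> = 1 / (real n + 2)"
  define R where "R = 1 - \<delta>"
  have \<delta>: "0 < \<delta>" "\<delta> \<le> 1/2" by (auto simp: \<delta>_def field_simps)
  have R: "0 < R" "R < 1" "R \<ge> 1/2" using \<delta> by (auto simp: R_def)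
  \<comment> \<open>Of the exponent -2 - \<tau>, the part -\<tau> is estimated by |1 - z| \<ge>
    \<delta>, the part -2 by |1 - z|^2 \<ge> (\<delta> + s)^2 / 2, whose reciprocal has an
    elementary antiderivative.\<close>
  define m where "m s = 2 * K * \<delta> powr (-\<tau>) * (1 / (\<delta> + s)\<^sup>2)" for s :: real
  have "((\<lambda>s. 1 / (\<delta> + s)\<^sup>2) has_integral (- (1 / (\<delta> + 1/2)) - (- (1 / (\<delta> + 0))))) {0..1/2}"
    using \<delta> by (intro fundamental_theorem_of_calculus)
       (auto intro!: derivative_eq_intros simp: power2_eq_square simp flip: has_real_derivative_iff_has_vector_derivative)
  then have "(m has_integral 2 * K * \<delta> powr (-\<tau>) * (1 / \<delta> - 1 / (\<delta> + 1/2))) {0..1/2}"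
    unfolding m_def by (intro has_integral_mult_right) (simp add: algebra_simps)
  note mI = this
  have bd: "K * norm (1 - of_real R * circ s) powr (- 2 - \<tau>) \<le> m s" if s: "0 < s" "s \<le> 1/2" for s
  proof -
    let ?z = "norm (1 - of_real R * circ s)"
    have z2: "?z\<^sup>2 = \<delta>\<^sup>2 + 4 * R * (sin (pi * s))\<^sup>2"
      using norm_one_minus_circle[of R s] R by (simp add: R_def)
    have "(2 * s)\<^sup>2 \<le> (sin (pi * s))\<^sup>2" using sin_pi_ge[of s] s by (intro power_mono) auto
    then have "2 * (2 * s)\<^sup>2 \<le> (4 * R) * (sin (pi * s))\<^sup>2" using R by (intro mult_mono) auto
    moreover have "s\<^sup>2 \<le> 2 * (2 * s)\<^sup>2" by (simp add: power_mult_distrib)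
    ultimately have ge: "\<delta>\<^sup>2 + s\<^sup>2 \<le> ?z\<^sup>2" using z2 by linarith
    have "(\<delta> + s)\<^sup>2 \<le> 2 * (\<delta>\<^sup>2 + s\<^sup>2)"
      using zero_le_power2[of "\<delta> - s"] by (simp add: power2_eq_square algebra_simps)
    then have "(\<delta> + s)\<^sup>2 / 2 \<le> 2 * (\<delta>\<^sup>2 + s\<^sup>2) / 2" by (rule divide_right_mono) simp
    also have "\<dots> = \<delta>\<^sup>2 + s\<^sup>2" by simp
    finally have "(\<delta> + s)\<^sup>2 / 2 \<le> \<delta>\<^sup>2 + s\<^sup>2" .
    then have q: "(\<delta> + s)\<^sup>2 / 2 \<le> ?z\<^sup>2" using ge by (rule order_trans)
    have "\<delta>\<^sup>2 \<le> ?z\<^sup>2" using ge by (rule order_trans[rotated]) simp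
    then have zd: "\<delta> \<le> ?z" by (rule power2_le_imp_le) auto
    then have zpos: "?z > 0" using \<delta> by linarith
    have "?z powr (- 2 - \<tau>) = ?z powr (-\<tau>) * (1 / ?z\<^sup>2)"
      using zpos by (simp add: powr_diff powr_minus divide_inverse powr_numeral mult_ac)
    also have "\<dots> \<le> \<delta> powr (-\<tau>) * (1 / ((\<delta> + s)\<^sup>2 / 2))"
    proof (rule mult_mono)
      show "?z powr (-\<tau>) \<le> \<delta> powr (-\<tau>)" using \<delta> \<tau> zd by (intro powr_mono2') auto
      show "1 / ?z\<^sup>2 \<le> 1 / ((\<delta> + s)\<^sup>2 / 2)" using q zpos \<delta> s by (intro divide_left_mono mult_pos_pos) auto
    qed auto
    finally have "K * ?z powr (- 2 - \<tau>) \<le> K * (\<delta> powr (-\<tau>) * (1 / ((\<delta> + s)\<^sup>2 / 2)))"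
      using K by (rule mult_left_mono)
    then show ?thesis by (simp add: m_def mult_ac)
  qed
  have "?a * R ^ n \<le> 2 * (2 * K * \<delta> powr (-\<tau>) * (1 / \<delta> - 1 / (\<delta> + 1/2)))"
    by (rule higher_deriv_bound_circle[OF hol R(1,2) mI _ b bd]) (use K in \<open>simp add: m_def\<close>)
  also have "\<dots> \<le> 2 * (2 * K * \<delta> powr (-\<tau>) * (1 / \<delta>))"
    using K \<delta> by (intro mult_left_mono) auto
  also have "\<dots> = 4 * K * \<delta> powr (- (1 + \<tau>))"
  proof -
    have "\<delta> powr (- (1 + \<tau>)) = \<delta> powr (-\<tau> - 1)" by (rule arg_cong[of _ _ "(powr) \<delta>"]) simp
    also have "\<dots> = \<delta> powr (-\<tau>) * (1 / \<delta>)" using \<delta> by (subst powr_diff) simp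
    finally show ?thesis by simp
  qed
  also have "\<dots> = 4 * K * (real n + 2) powr (1 + \<tau>)"
  proof -
    have "\<delta> powr (- (1 + \<tau>)) = (real n + 2) powr (1 + \<tau>)"
      unfolding \<delta>_def by (subst powr_divide) (simp_all only: powr_minus powr_one_eq_one inverse_eq_divide divide_divide_eq_right mult_1_left div_by_1)
    then show ?thesis by (simp only:)
  qed
  finally have le: "?a * R ^ n \<le> 4 * K * (real n + 2) powr (1 + \<tau>)" .
  have "inverse R = 1 + 1 / (real n + 1)" by (simp add: R_def \<delta>_def field_simps)
  also have "\<dots> \<le> exp (1 / (real n + 1))" by (rule exp_ge_add_one_self)
  finally have "inverse R ^ n \<le> exp (1 / (real n + 1)) ^ n"
    using R by (intro power_mono) auto
  also have "\<dots> = exp (real n / (real n + 1))" by (simp add: exp_of_nat_mult[symmetric])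
  also have "\<dots> \<le> exp 1" by (simp add: divide_simps)
  also have "\<dots> \<le> 3" by (rule exp_le)
  finally have inv: "inverse R ^ n \<le> 3" .
  have "?a = (?a * R ^ n) * inverse R ^ n" using R by (simp add: power_inverse)
  also have "\<dots> \<le> (4 * K * (real n + 2) powr (1 + \<tau>)) * 3"
    using R K by (intro mult_mono[OF le inv]) auto
  finally show ?thesis by (simp add: mult_ac)
qed

text \<open>Up to the power of \<open>n\<close> the ratio is Euler's sequence
  \<open>Gamma_series a\<close>, which converges and is therefore bounded.\<close>

lemma factorial_ratio_bounded:
  fixes a :: real
  assumes a: "a > 0"
  obtains C where "C > 0" "\<And>n. n \<ge> 1 \<Longrightarrow> fact n / pochhammer a (n + 1) \<le> C * real n powr (-a)"
proof -
  have "convergent (Gamma_series a)" using Gamma_series_LIMSEQ[of a] by (auto simp: convergent_def)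
  then have "Bseq (Gamma_series a)" by (rule convergent_imp_Bseq)
  then obtain C where C: "C > 0" "\<And>n. norm (Gamma_series a n) \<le> C" by (auto simp: Bseq_def)
  have "fact n / pochhammer a (n + 1) \<le> C * real n powr (-a)" if n: "n \<ge> 1" for n
  proof -
    have "fact n / pochhammer a (n + 1) = Gamma_series a n * real n powr (-a)"
      using n by (simp add: Gamma_series_def powr_def exp_minus field_simps)
    also have "\<dots> \<le> C * real n powr (-a)"
      using C(2)[of n] by (intro mult_right_mono) auto
    finally show ?thesis .
  qed
  then show thesis using C that by blast
qed

text \<open>For Re t > 0 membership is the bound |\<theta>| < pi / 2 on \<theta> = arg (1 - s).
  Otherwise |1 - s| \<ge> 1, and |s| < 1 gives |1 - s| < 2 cos \<theta>, so |\<theta>| < pi / 3.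
  With 0 \<le> ln |1 - s| \<le> 1 this puts Ln (1 - s) into the disc of radius pi / 2, as 1 + pi^2 /
  9 < pi^2 / 4.\<close>

lemma Ln_unit_disc:
  fixes s :: complex
  assumes s: "s \<in> ball 0 1" and \<omega>: "\<omega> > 0"
  defines "t \<equiv> - Ln (1 - s) / of_real \<omega>"
  shows "exp (- of_real \<omega> * t) = 1 - s" "Re t = - ln (norm (1 - s)) / \<omega>" "t \<in> U_region (pi / (2 * \<omega>))"
    "0 < norm (1 - s)" "norm (1 - s) < 2" "0 < Re (1 - s)"
proof -
  have Re: "Re (1 - s) > 0" using s abs_Re_le_cmod[of s] by simp
  then show "0 < Re (1 - s)" .
  have nz: "1 - s \<noteq> 0" using Re by auto
  then show p: "0 < norm (1 - s)" by simp
  show l2: "norm (1 - s) < 2" using s norm_triangle_ineq4[of 1 s] by simp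
  show "exp (- of_real \<omega> * t) = 1 - s" using \<omega> nz by (simp add: t_def)
  show Ret: "Re t = - ln (norm (1 - s)) / \<omega>" using nz by (simp add: t_def)
  have Imt: "Im t = - Im (Ln (1 - s)) / \<omega>" by (simp add: t_def)
  have im: "\<bar>Im (Ln (1 - s))\<bar> < pi / 2" using Re_Ln_pos_lt[OF nz] Re by simp
  show "t \<in> U_region (pi / (2 * \<omega>))"
  proof (cases "Re t > 0")
    case True
    have "\<bar>Im t\<bar> = \<bar>Im (Ln (1 - s))\<bar> / \<omega>" using \<omega> by (simp add: Imt)
    also have "\<dots> < pi / 2 / \<omega>" using im \<omega> by (intro divide_strict_right_mono)
    finally show ?thesis using True by (simp add: U_region_def)
  next
    case False
    then have "ln (norm (1 - s)) \<ge> 0" using \<omega> by (simp add: Ret divide_less_0_iff not_less)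
    then have ge1: "norm (1 - s) \<ge> 1" using p by (simp only: ln_ge_zero_iff)
    define \<theta> where "\<theta> = Im (Ln (1 - s))"
    have ss: "1 - s = of_real (norm (1 - s)) * exp (\<i> * of_real \<theta>)"
      using nz by (metis \<theta>_def Arg_eq Arg_eq_Im_Ln)
    have Rc: "Re (1 - s) = norm (1 - s) * cos \<theta>"
      by (subst ss) (simp add: Re_exp)
    have "(norm s)\<^sup>2 < 1" using s by (simp add: power_less_one_iff)
    moreover have "(norm s)\<^sup>2 = 1 - 2 * Re (1 - s) + (norm (1 - s))\<^sup>2"
      unfolding cmod_power2 by (simp add: power2_eq_square algebra_simps)
    ultimately have "(norm (1 - s))\<^sup>2 < 2 * (norm (1 - s) * cos \<theta>)" using Rc by linarith
    then have "norm (1 - s) < 2 * cos \<theta>" using p by (simp add: power2_eq_square)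
    then have "cos (pi / 3) < cos \<bar>\<theta>\<bar>" using ge1 by (simp add: cos_60)
    then have th: "\<bar>\<theta>\<bar> < pi / 3"
      using cos_mono_less_eq[of "pi / 3" "\<bar>\<theta>\<bar>"] im by (simp add: \<theta>_def)
    have lnb: "0 \<le> ln (norm (1 - s))" "ln (norm (1 - s)) \<le> 1"
      using ge1 l2 p ln_le_minus_one[OF p] by auto
    have "(norm (Ln (1 - s)))\<^sup>2 = (ln (norm (1 - s)))\<^sup>2 + \<theta>\<^sup>2"
      using nz by (simp add: cmod_power2 \<theta>_def)
    also have "\<dots> \<le> 1 + (pi / 3)\<^sup>2"
      using lnb th by (intro add_mono) (auto simp: power_le_one abs_le_square_iff[symmetric])
    also have "\<dots> < (pi / 2)\<^sup>2"
    proof -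
      have "3 * 3 < pi * pi" using pi_gt3 by (intro mult_strict_mono) auto
      then show ?thesis by (simp add: power2_eq_square)
    qed
    finally have "norm (Ln (1 - s)) < pi / 2" by (rule power2_less_imp_less) auto
    then have "norm t < pi / (2 * \<omega>)"
      using \<omega> by (simp add: t_def norm_divide field_simps)
    then show ?thesis by (simp add: U_region_def)
  qed
qed

section \<open>The operator of the recurrence\<close>

lemma integrable_one_plus_powr:
  assumes "\<beta> > 0"
  shows "(\<lambda>s::real. (1 + s) powr (- (1 + \<beta>))) integrable_on {0..}"
proof -
  define F where "F = (\<lambda>s::real. - ((1 + s) powr (-\<beta>)) / \<beta>)"
  have I: "((\<lambda>s. (1 + s) powr (- (1 + \<beta>))) has_integral (F y - F 0)) {0..y}" if "y \<ge> 0" for y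
    unfolding F_def using assms
    by (intro fundamental_theorem_of_calculus that)
       (auto intro!: derivative_eq_intros simp: minus_diff_commute simp flip: has_real_derivative_iff_has_vector_derivative)
  have "((\<lambda>s. (1 + s) powr (- (1 + \<beta>))) has_integral (- F 0)) {0..}"
  proof (rule has_integral_to_inf)
    show "(\<lambda>s. (1 + s) powr (- (1 + \<beta>))) integrable_on {0..y}" for y
      using I[of y] by (cases "y \<ge> 0") (auto simp: integrable_on_def)
    have "\<forall>\<^sub>F y in at_top. integral {0..y} (\<lambda>s. (1 + s) powr (- (1 + \<beta>))) = F y - F 0"
      using I by (meson eventually_at_top_linorderI integral_unique)
    moreover have "((\<lambda>y. F y - F 0) \<longlongrightarrow> - F 0) at_top"
      using assms unfolding F_def by real_asymp
    ultimately show "((\<lambda>y. integral {0..y} (\<lambda>s. (1 + s) powr (- (1 + \<beta>)))) \<longlongrightarrow> - F 0) at_top"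
      by (simp add: filterlim_cong)
  qed auto
  then show ?thesis by blast
qed

text \<open>The hypotheses on \<phi> and \<psi> give decay in |\<xi>|, whereas the integrals run
  over the parameter s of the half-line. This converts one into the other: \<open>w\<close> plays
  the role of |\<xi>|, and \<open>a\<close> is what the starting point takes off.\<close>

lemma inverse_one_plus_powr_le:
  fixes w s a \<beta> :: real
  assumes "w \<ge> 0" "w \<ge> s - a" "a \<ge> 0" "s \<ge> 0" "\<beta> > 0"
  shows "1 / (1 + w powr (1 + \<beta>)) \<le> (2 * (1 + a)) powr (1 + \<beta>) * (1 + s) powr (- (1 + \<beta>))"
proof -
  have "1 + s \<le> (1 + a) * (1 + w)"
  proof -
    have "0 \<le> a * w" using assms by simp
    moreover have "(1 + a) * (1 + w) = 1 + a + w + a * w" by (simp add: algebra_simps)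
    ultimately show ?thesis using assms by linarith
  qed
  also have "\<dots> \<le> (1 + a) * (2 * max 1 w)"
    using assms by (intro mult_left_mono) auto
  finally have "(1 + s) powr (1 + \<beta>) \<le> ((2 * (1 + a)) * max 1 w) powr (1 + \<beta>)"
    using assms by (intro powr_mono2) (auto simp: algebra_simps)
  also have "\<dots> = (2 * (1 + a)) powr (1 + \<beta>) * max 1 w powr (1 + \<beta>)"
    by (rule powr_mult)
  also have "\<dots> \<le> (2 * (1 + a)) powr (1 + \<beta>) * (1 + w powr (1 + \<beta>))"
    by (intro mult_left_mono) (auto simp: max_def)
  finally have le: "(1 + s) powr (1 + \<beta>) \<le> (2 * (1 + a)) powr (1 + \<beta>) * (1 + w powr (1 + \<beta>))" .
  have p: "0 < 1 + w powr (1 + \<beta>)" "(1 + s) powr (1 + \<beta>) > 0"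
    using assms powr_ge_zero[of w "1 + \<beta>"] by (auto simp: add_pos_nonneg)
  have "1 / (1 + w powr (1 + \<beta>)) \<le> (2 * (1 + a)) powr (1 + \<beta>) / (1 + s) powr (1 + \<beta>)"
    using le p by (simp add: divide_simps mult.commute)
  then show ?thesis by (simp only: powr_minus divide_inverse mult_1_left)
qed

lemma higher_deriv_power_series:
  fixes f :: "complex \<Rightarrow> complex"
  assumes "r > 0" and "\<And>t. t \<in> ball 0 r \<Longrightarrow> (\<lambda>n. a n * t ^ n) sums f t"
  shows "(deriv ^^ n) f 0 = fact n * a n"
proof -
  define A where "A = Abs_fps a"
  have "conv_radius a \<ge> r"
  proof (rule conv_radius_geI_ex)
    fix s :: real assume s: "0 < s" "ereal s < ereal r"
    then have "summable (\<lambda>n. a n * of_real s ^ n)"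
      using assms(2)[of "of_real s"] by (auto simp: sums_iff)
    then show "\<exists>z. norm z = s \<and> summable (\<lambda>n. a n * z ^ n)"
      using s by (intro exI[of _ "of_real s"]) auto
  qed
  then have "fps_conv_radius A > 0"
    using assms(1) unfolding fps_conv_radius_def A_def by (simp add: less_le_trans[of 0 "ereal r"])
  moreover have "\<forall>\<^sub>F z in nhds 0. eval_fps A z = f z"
    using eventually_nhds_in_open[of "ball 0 r" 0] assms
    by (auto elim!: eventually_mono simp: eval_fps_def A_def sums_iff)
  ultimately have "f has_fps_expansion A" by (simp add: has_fps_expansion_def)
  then have "fps_nth A n = (deriv ^^ n) f 0 / fact n" by (rule fps_nth_fps_expansion)
  then show ?thesis by (simp add: A_def)
qed

lemma deriv_cong_on_open:
  assumes "open T" "t \<in> T" "\<And>t. t \<in> T \<Longrightarrow> f t = g t"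
  shows "deriv f t = deriv g t"
proof (rule deriv_cong_ev)
  show "\<forall>\<^sub>F t in nhds t. f t = g t"
    using eventually_nhds_in_open[OF assms(1,2)] by eventually_elim (rule assms(3))
qed simp

text \<open>Local in \<open>t\<close>, but uniform over the whole of \<open>S\<close>: on half-lines
  of infinite length continuity alone gives no dominating function.\<close>

definition loc_bounded :: "complex set \<Rightarrow> 'a set \<Rightarrow> (complex \<Rightarrow> 'a \<Rightarrow> complex) \<Rightarrow> bool" where
  "loc_bounded T S F \<longleftrightarrow> (\<forall>t\<in>T. \<exists>\<delta>>0. \<exists>M. ball t \<delta> \<subseteq> T \<and> (\<forall>t'\<in>ball t \<delta>. \<forall>x\<in>S. norm (F t' x) \<le> M))"

lemma loc_bounded_deriv:
  assumes F: "loc_bounded T S F" and hol: "\<And>x. x \<in> S \<Longrightarrow> (\<lambda>t. F t x) holomorphic_on T"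
  shows "loc_bounded T S (\<lambda>t x. deriv (\<lambda>t. F t x) t)"
  unfolding loc_bounded_def
proof
  fix t assume "t \<in> T"
  then obtain \<delta> M where \<delta>: "\<delta> > 0" "ball t \<delta> \<subseteq> T" and M: "\<And>t' x. t' \<in> ball t \<delta> \<Longrightarrow> x \<in> S \<Longrightarrow> norm (F t' x) \<le> M"
    using F unfolding loc_bounded_def by meson
  define r where "r = \<delta> / 3"
  have r: "r > 0" using \<delta> by (simp add: r_def)
  have "norm (deriv (\<lambda>t. F t x) t') \<le> M / r" if t': "t' \<in> ball t r" and x: "x \<in> S" for t' x
  proof -
    have sub: "cball t' r \<subseteq> ball t \<delta>"
    proof
      fix z assume "z \<in> cball t' r"
      then show "z \<in> ball t \<delta>" using t' dist_triangle[of t z t'] \<delta> by (simp add: r_def)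
    qed
    have sub': "ball t' r \<subseteq> T" "cball t' r \<subseteq> T" using sub \<delta>(2) ball_subset_cball[of t' r] by blast+
    have "norm ((deriv ^^ 1) (\<lambda>t. F t x) t') \<le> fact 1 * M / r ^ 1"
    proof (rule Cauchy_inequality)
      show "(\<lambda>t. F t x) holomorphic_on ball t' r" by (rule holomorphic_on_subset[OF hol[OF x] sub'(1)])
      show "continuous_on (cball t' r) (\<lambda>t. F t x)"
        by (intro holomorphic_on_imp_continuous_on holomorphic_on_subset[OF hol[OF x] sub'(2)])
      show "norm (F y x) \<le> M" if "norm (t' - y) = r" for y
        using that sub by (intro M x) (auto simp: dist_norm subset_iff)
    qed (rule r)
    then show ?thesis by simp
  qed
  moreover have "ball t r \<subseteq> T" using \<delta> r by (auto simp: r_def)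
  ultimately show "\<exists>\<delta>>0. \<exists>M. ball t \<delta> \<subseteq> T \<and> (\<forall>t'\<in>ball t \<delta>. \<forall>x\<in>S. norm (deriv (\<lambda>t. F t x) t') \<le> M)"
    using r by blast
qed

section \<open>Decay of the data and integrability along the rays\<close>

locale wkb_problem =
  fixes p :: "'a::t2_space \<Rightarrow> complex" and G \<Delta> \<Gamma> :: "'a set" and \<phi> \<psi> :: "'a \<Rightarrow> complex"
    and \<epsilon> c \<rho> d :: real
  assumes sign: "\<epsilon> = 1 \<or> \<epsilon> = -1"
    and G: "spread_domain p G"
    and hol: "xi_holomorphic_on p \<phi> G" "xi_holomorphic_on p \<psi> G"
    and \<Delta>: "subdomain \<Delta> G"
    and pos: "c > 0" "\<rho> > 0"
    and C1_or_C2: "cond_C1 p \<phi> \<psi> \<Delta> c \<rho> \<or> cond_C2 p \<phi> \<psi> \<Delta> c \<rho>"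
    and d: "d > 0"
    and \<Gamma>: "Gamma_domain p \<Delta> d \<epsilon> \<Gamma>"
begin

abbreviation "ker \<equiv> kern p \<phi> \<psi> \<epsilon>"

lemma \<Gamma>_subset: "open \<Gamma>" "\<Gamma> \<noteq> {}" "\<Gamma> \<subseteq> \<Delta>" "\<Gamma> \<subseteq> G" "open \<Delta>" "\<Delta> \<subseteq> G" "open G"
  using \<Gamma> \<Delta> G by (auto simp: Gamma_domain_def subdomain_def spread_domain_def)

lemma \<epsilon>_square: "of_real \<epsilon> * (of_real \<epsilon> :: complex) = 1" "\<epsilon> * \<epsilon> = 1" "\<epsilon> \<noteq> 0"
  using sign by auto

definition "R = ray p \<Gamma> \<epsilon>"

lemma horizontal_ray_R: "x \<in> \<Gamma> \<Longrightarrow> horizontal_ray p \<Gamma> \<epsilon> x (R x)"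
  unfolding R_def by (rule horizontal_ray_ray) (use \<Gamma> in \<open>simp add: Gamma_domain_def\<close>)

lemma R_props:
  assumes "x \<in> \<Gamma>"
  shows "continuous_on {0..} (R x)" "R x 0 = x" "\<And>s. s \<ge> 0 \<Longrightarrow> R x s \<in> \<Gamma>"
    "\<And>s. s \<ge> 0 \<Longrightarrow> p (R x s) = p x - of_real (\<epsilon> * s)"
  using horizontal_ray_R[OF assms] by (auto simp: horizontal_ray_def)

lemma R_R: "x \<in> \<Gamma> \<Longrightarrow> s \<ge> 0 \<Longrightarrow> v \<ge> 0 \<Longrightarrow> R (R x s) v = R x (s + v)"
  unfolding R_def using horizontal_ray_R[of x] by (intro ray_ray[OF G \<Gamma>_subset(1,4)]) auto

lemma continuous_on_R:
  assumes "continuous_on \<Gamma> f" "x \<in> \<Gamma>"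
  shows "continuous_on {0..} (\<lambda>s. f (R x s))"
  by (rule continuous_on_compose2[OF assms(1) R_props(1)[OF assms(2)]]) (use R_props(3)[OF assms(2)] in auto)

lemma continuous_\<Gamma>: "continuous_on \<Gamma> \<phi>" "continuous_on \<Gamma> \<psi>" "continuous_on \<Gamma> (xi_deriv p \<phi>)" "continuous_on \<Gamma> (ker)"
proof -
  show *: "continuous_on \<Gamma> \<phi>" "continuous_on \<Gamma> \<psi>" "continuous_on \<Gamma> (xi_deriv p \<phi>)"
    using hol xi_holomorphic_on_deriv[OF G \<Gamma>_subset(1,4)] \<Gamma>_subset
    by (auto intro!: xi_holomorphic_on_imp_continuous_on[OF G] intro: xi_holomorphic_on_subset)
  show "continuous_on \<Gamma> (ker)"
    unfolding kern_def using * by (intro continuous_intros)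
qed

lemma norm_p_R:
  assumes "x \<in> \<Gamma>" "s \<ge> 0"
  shows "norm (p (R x s)) \<ge> s - norm (p x)"
proof -
  have "norm (of_real (\<epsilon> * s) :: complex) = s" using sign assms by auto
  moreover have "norm (of_real (\<epsilon> * s) :: complex) \<le> norm (p x) + norm (p (R x s))"
    unfolding R_props(4)[OF assms] using norm_triangle_ineq4[of "p x" "p x - of_real (\<epsilon> * s)"] by simp
  ultimately show ?thesis by simp
qed

text \<open>The decay is allowed to be in some w \<ge> |\<xi>| - b instead of |\<xi>|, because a
  Cauchy estimate on a disc loses the radius of the disc.\<close>

lemma powr_decay_on_ray:
  fixes f :: "'a \<Rightarrow> 'b::real_normed_vector"
  assumes x: "x \<in> \<Gamma>" and \<beta>: "\<beta> > 0" and b: "b \<ge> 0" and C: "C \<ge> 0"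
    and f: "\<And>y. y \<in> \<Gamma> \<Longrightarrow> \<exists>w\<ge>0. w \<ge> norm (p y) - b \<and> norm (f y) \<le> C / (1 + w powr (1 + \<beta>))"
  obtains K where "\<And>s. s \<ge> 0 \<Longrightarrow> norm (f (R x s)) \<le> K * (1 + s) powr (- (1 + \<beta>))"
proof
  fix s :: real assume s: "s \<ge> 0"
  obtain w where w: "w \<ge> 0" "w \<ge> norm (p (R x s)) - b" "norm (f (R x s)) \<le> C / (1 + w powr (1 + \<beta>))"
    using f[OF R_props(3)[OF x s]] by blast
  have "norm (f (R x s)) \<le> C * (1 / (1 + w powr (1 + \<beta>)))" using w by simp
  also have "\<dots> \<le> C * ((2 * (1 + (norm (p x) + b))) powr (1 + \<beta>) * (1 + s) powr (- (1 + \<beta>)))"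
    using w s norm_p_R[OF x s] b \<beta> C
    by (intro mult_left_mono inverse_one_plus_powr_le) auto
  finally show "norm (f (R x s)) \<le> C * (2 * (1 + (norm (p x) + b))) powr (1 + \<beta>) * (1 + s) powr (- (1 + \<beta>))"
    by (simp add: mult_ac)
qed

lemma absolutely_integrable_on_ray:
  fixes f :: "'a \<Rightarrow> 'b::euclidean_space"
  assumes x: "x \<in> \<Gamma>" and \<beta>: "\<beta> > 0" and b: "b \<ge> 0" and C: "C \<ge> 0"
    and f: "\<And>y. y \<in> \<Gamma> \<Longrightarrow> \<exists>w\<ge>0. w \<ge> norm (p y) - b \<and> norm (f y) \<le> C / (1 + w powr (1 + \<beta>))"
    and cont: "continuous_on \<Gamma> f"
  shows "(\<lambda>s. f (R x s)) absolutely_integrable_on {0..}"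
proof -
  obtain K where K: "\<And>s. s \<ge> 0 \<Longrightarrow> norm (f (R x s)) \<le> K * (1 + s) powr (- (1 + \<beta>))"
    using powr_decay_on_ray[OF x \<beta> b C f] by metis
  show ?thesis
  proof (rule absolutely_integrable_continuous_bound)
    show "continuous_on {0..} (\<lambda>s. f (R x s))" by (rule continuous_on_R[OF cont x])
    show "(\<lambda>s. K * (1 + s) powr (- (1 + \<beta>))) integrable_on {0..}"
      using integrable_on_cmult_left[OF integrable_one_plus_powr[OF \<beta>]] by simp
  qed (use K in auto)
qed

text \<open>(C1) contains no bound on the derivative of \<phi>. About every point of
  \<open>\<Gamma>\<close> there is a disc of radius \<open>d\<close> inside \<open>\<Delta>\<close>,
  so Cauchy's inequality on the circle of radius d / 2 supplies one, with the decay taken at |\<xi>|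
  - d / 2.\<close>

lemma xi_deriv_\<phi>_bound:
  assumes C1: "cond_C1 p \<phi> \<psi> \<Delta> c \<rho>" and y: "y \<in> \<Gamma>"
  shows "\<exists>w\<ge>0. w \<ge> norm (p y) - d / 2 \<and> norm (xi_deriv p \<phi> y) \<le> (2 * c / d) / (1 + w powr (1 + \<rho>))"
proof -
  obtain V g where V: "open V" "y \<in> V" "V \<subseteq> \<Delta>" "homeomorphism V (ball (p y) d) p g"
    using \<Gamma> y unfolding Gamma_domain_def by metis
  have gV: "g ` ball (p y) d = V" using V(4) by (simp add: homeomorphism_def)
  have sh: "sheet p y d g" unfolding sheet_def gV using V d by simp
  note D = sheetD[OF sh]
  have py: "p y \<in> ball (p y) d" using d by simp
  have hol: "(\<lambda>z. \<phi> (g z)) holomorphic_on ball (p y) d"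
    using xi_holomorphic_on_sheet[OF sh] xi_holomorphic_on_subset[OF hol(1)] V(3) \<Gamma>_subset(6) gV by auto
  define w where "w = max 0 (norm (p y) - d / 2)"
  have w: "w \<ge> 0" "w \<ge> norm (p y) - d / 2" by (auto simp: w_def)
  have pw: "1 + w powr (1 + \<rho>) > 0" using powr_ge_zero[of w "1 + \<rho>"] by linarith
  have "norm ((deriv ^^ 1) (\<lambda>z. \<phi> (g z)) (p y)) \<le> fact 1 * (c / (1 + w powr (1 + \<rho>))) / (d / 2) ^ 1"
  proof (rule Cauchy_inequality)
    show "(\<lambda>z. \<phi> (g z)) holomorphic_on ball (p y) (d / 2)"
      using d by (intro holomorphic_on_subset[OF hol]) (auto simp: subset_iff)
    show "continuous_on (cball (p y) (d / 2)) (\<lambda>z. \<phi> (g z))"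
      using d by (intro holomorphic_on_imp_continuous_on holomorphic_on_subset[OF hol]) (auto simp: subset_iff)
    fix z assume z: "norm (p y - z) = d / 2"
    then have zb: "z \<in> ball (p y) d" using d by (simp add: dist_norm)
    have "norm (p y) \<le> norm (p y - z) + norm z" using norm_triangle_ineq[of "p y - z" z] by simp
    then have "w \<le> norm z" using z by (simp add: w_def)
    then have "w powr (1 + \<rho>) \<le> norm z powr (1 + \<rho>)" using w pos by (intro powr_mono2) auto
    then have "c / (1 + norm z powr (1 + \<rho>)) \<le> c / (1 + w powr (1 + \<rho>))"
      using pos pw by (intro divide_left_mono) auto
    moreover have "g z \<in> \<Delta>" using zb V(3) gV by blast
    then have "norm (\<phi> (g z)) \<le> c / (1 + norm (p (g z)) powr (1 + \<rho>))"
      using C1 by (simp add: cond_C1_def)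
    ultimately show "norm (\<phi> (g z)) \<le> c / (1 + w powr (1 + \<rho>))" using D(6)[OF zb] by simp
  qed (use d in simp)
  moreover have "xi_deriv p \<phi> y = deriv (\<lambda>z. \<phi> (g z)) (p y)"
    using xi_deriv_sheet_eq[OF sh py hol] D(3) by simp
  ultimately have "norm (xi_deriv p \<phi> y) \<le> (2 * c / d) / (1 + w powr (1 + \<rho>))"
    by (simp add: field_simps)
  then show ?thesis using w by blast
qed

lemma ray_integrability:
  assumes x: "x \<in> \<Gamma>"
  shows "(\<lambda>s. \<psi> (R x s)) absolutely_integrable_on {0..}"
    and "(\<lambda>s. xi_deriv p \<phi> (R x s)) absolutely_integrable_on {0..}"
    and "(\<lambda>s. (\<phi> (R x s))\<^sup>2) absolutely_integrable_on {0..}"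
proof -
  have \<psi>: "norm (\<psi> y) \<le> c / (1 + norm (p y) powr (1 + \<rho>))" if "y \<in> \<Gamma>" for y
    using C1_or_C2 that \<Gamma>_subset by (auto simp: cond_C1_def cond_C2_def)
  show "(\<lambda>s. \<psi> (R x s)) absolutely_integrable_on {0..}"
    using pos \<psi> by (intro absolutely_integrable_on_ray[OF x pos(2), of 0 c] continuous_\<Gamma>) (auto intro!: exI[of _ "norm (p _)"])
  have "\<exists>w\<ge>0. w \<ge> norm (p y) - d / 2 \<and> norm (xi_deriv p \<phi> y) \<le> max c (2 * c / d) / (1 + w powr (1 + \<rho>))" if y: "y \<in> \<Gamma>" for y
  proof -
    have mx: "C / (1 + w powr (1 + \<rho>)) \<le> max c (2 * c / d) / (1 + w powr (1 + \<rho>))" if "C \<le> max c (2 * c / d)" for w C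
      using that powr_ge_zero[of w "1 + \<rho>"] by (intro divide_right_mono) (auto simp del: powr_ge_zero)
    show ?thesis
    proof (cases "cond_C1 p \<phi> \<psi> \<Delta> c \<rho>")
      case True
      then show ?thesis using xi_deriv_\<phi>_bound[OF True y] mx[of "2 * c / d"] by (meson order_trans max.cobounded2)
    next
      case False
      then have "norm (xi_deriv p \<phi> y) \<le> c / (1 + norm (p y) powr (1 + \<rho>))"
        using C1_or_C2 y \<Gamma>_subset by (auto simp: cond_C2_def)
      then show ?thesis using mx[of c] d by (intro exI[of _ "norm (p y)"]) (auto intro: order_trans)
    qed
  qed
  then show "(\<lambda>s. xi_deriv p \<phi> (R x s)) absolutely_integrable_on {0..}"
    using d pos by (intro absolutely_integrable_on_ray[OF x pos(2), of "d / 2" "max c (2 * c / d)"] continuous_\<Gamma>) auto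
  show "(\<lambda>s. (\<phi> (R x s))\<^sup>2) absolutely_integrable_on {0..}"
  proof (cases "cond_C1 p \<phi> \<psi> \<Delta> c \<rho>")
    case True
    have "norm ((\<phi> y)\<^sup>2) \<le> c\<^sup>2 / (1 + norm (p y) powr (1 + \<rho>))" if "y \<in> \<Gamma>" for y
    proof -
      let ?q = "1 + norm (p y) powr (1 + \<rho>)"
      have q: "?q \<ge> 1" by simp
      have "norm (\<phi> y) \<le> c / ?q" using True that \<Gamma>_subset by (auto simp: cond_C1_def)
      moreover have "c / ?q \<le> c / 1" using q pos by (intro divide_left_mono) (auto intro!: add_pos_nonneg)
      with calculation have "norm (\<phi> y) \<le> c" by linarith
      ultimately have "norm (\<phi> y) * norm (\<phi> y) \<le> c * (c / ?q)" using pos by (intro mult_mono) auto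
      then show ?thesis by (simp add: norm_mult power2_eq_square)
    qed
    then show ?thesis
      using pos by (intro absolutely_integrable_on_ray[OF x pos(2), of 0 "c\<^sup>2"] continuous_intros continuous_\<Gamma>) (auto intro!: exI[of _ "norm (p _)"])
  next
    case False
    \<comment> \<open>Squaring doubles the exponent 1/2 + \<rho>, which makes the square integrable
      although \<phi> itself need not be.\<close>
    have "norm ((\<phi> y)\<^sup>2) \<le> c\<^sup>2 / (1 + norm (p y) powr (1 + 2 * \<rho>))" if "y \<in> \<Gamma>" for y
    proof -
      let ?q = "norm (p y) powr (1/2 + \<rho>)"
      have "norm (\<phi> y) \<le> c / (1 + ?q)"
        using False C1_or_C2 that \<Gamma>_subset by (auto simp: cond_C2_def)
      then have "(norm (\<phi> y))\<^sup>2 \<le> (c / (1 + ?q))\<^sup>2" by (intro power_mono) auto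
      also have "\<dots> = c\<^sup>2 / (1 + ?q)\<^sup>2" by (simp add: power_divide)
      also have "\<dots> \<le> c\<^sup>2 / (1 + ?q\<^sup>2)"
        by (intro divide_left_mono mult_pos_pos) (auto simp: power2_sum add_pos_nonneg)
      also have "?q\<^sup>2 = norm (p y) powr (1 + 2 * \<rho>)"
        by (simp add: power2_eq_square powr_add[symmetric])
      finally show ?thesis by (simp add: norm_power)
    qed
    then show ?thesis
      using pos by (intro absolutely_integrable_on_ray[OF x, of "2 * \<rho>" 0 "c\<^sup>2"] continuous_intros continuous_\<Gamma>) (auto intro!: exI[of _ "norm (p _)"])
  qed
qed

definition kern_bound :: "'a \<Rightarrow> real" where
  "kern_bound y = 1/4 * norm ((\<phi> y)^2) + norm (1/2 * xi_deriv p \<phi> y + of_real \<epsilon> * \<psi> y)"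

text \<open>The terms with \<psi> and the derivative of \<phi> in \<open>kern\<close> are
  -\<epsilon> times those in \<open>kern_bound\<close>, because \<epsilon>^2 = 1; the factor has
  modulus 1.\<close>

lemma norm_kern_le: "norm (ker y) \<le> kern_bound y"
proof -
  have "of_real \<epsilon> * (of_real \<epsilon> * \<psi> y) = \<psi> y"
    using \<epsilon>_square(1) by (simp add: mult.assoc[symmetric])
  then have "ker y = 1/4 * (\<phi> y)^2 - of_real \<epsilon> * (1/2 * xi_deriv p \<phi> y + of_real \<epsilon> * \<psi> y)"
    by (simp add: kern_def distrib_left)
  also have "norm \<dots> \<le> norm (1/4 * (\<phi> y)^2) + norm (of_real \<epsilon> * (1/2 * xi_deriv p \<phi> y + of_real \<epsilon> * \<psi> y))"
    by (rule norm_triangle_ineq4)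
  also have "\<dots> = kern_bound y" using sign by (auto simp: kern_bound_def norm_mult)
  finally show ?thesis .
qed

lemma kern_bound_nonneg: "kern_bound y \<ge> 0" by (simp add: kern_bound_def)

lemma continuous_kern_bound: "continuous_on \<Gamma> kern_bound"
  unfolding kern_bound_def by (intro continuous_intros continuous_\<Gamma>)

lemma kern_bound_integrable:
  assumes x: "x \<in> \<Gamma>"
  shows "(\<lambda>s. kern_bound (R x s)) absolutely_integrable_on {0..}"
proof (rule absolutely_integrable_continuous_bound)
  show "continuous_on {0..} (\<lambda>s. kern_bound (R x s))" by (rule continuous_on_R[OF continuous_kern_bound x])
  show "(\<lambda>s. 1/4 * norm ((\<phi> (R x s))^2) + (1/2 * norm (xi_deriv p \<phi> (R x s)) + norm (\<psi> (R x s)))) integrable_on {0..}"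
    using ray_integrability[OF x] by (intro integrable_add integrable_on_cmult_left[where 'a = real, simplified])
      (auto simp: absolutely_integrable_on_def)
  fix s :: real assume "s \<ge> 0"
  have "norm (1/2 * xi_deriv p \<phi> (R x s) + of_real \<epsilon> * \<psi> (R x s))
     \<le> norm (1/2 * xi_deriv p \<phi> (R x s)) + norm (of_real \<epsilon> * \<psi> (R x s))" by (rule norm_triangle_ineq)
  also have "\<dots> = 1/2 * norm (xi_deriv p \<phi> (R x s)) + norm (\<psi> (R x s))"
    using sign by (auto simp: norm_mult)
  finally show "norm (kern_bound (R x s)) \<le> 1/4 * norm ((\<phi> (R x s))^2) + (1/2 * norm (xi_deriv p \<phi> (R x s)) + norm (\<psi> (R x s)))"
    using kern_bound_nonneg[of "R x s"] by (simp add: kern_bound_def)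
qed

lemma kern_mult_integrable:
  assumes x: "x \<in> \<Gamma>" and f: "continuous_on \<Gamma> f" "\<And>y. y \<in> \<Gamma> \<Longrightarrow> norm (f y) \<le> M"
  shows "(\<lambda>s. ker (R x s) * f (R x s)) absolutely_integrable_on {0..}"
proof (rule absolutely_integrable_continuous_bound)
  show "continuous_on {0..} (\<lambda>s. ker (R x s) * f (R x s))"
    by (intro continuous_on_R[OF _ x] continuous_intros continuous_\<Gamma> f)
  show "(\<lambda>s. kern_bound (R x s) * M) integrable_on {0..}"
    using kern_bound_integrable[OF x] by (intro integrable_on_mult_left) (rule set_lebesgue_integral_eq_integral(1))
  fix s :: real assume "s \<ge> 0"
  then show "norm (ker (R x s) * f (R x s)) \<le> kern_bound (R x s) * M"
    unfolding norm_mult using R_props(3)[OF x] by (intro mult_mono norm_kern_le f kern_bound_nonneg) auto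
qed

section \<open>The operator L and its commutation with d/dt\<close>

definition Lop :: "('a \<Rightarrow> complex) \<Rightarrow> 'a \<Rightarrow> complex" where
  "Lop f x = - (1/2) * \<phi> x * f x - of_real \<epsilon> * (1/2) * xi_deriv p f x
     - of_real \<epsilon> * (1/2) * path_integral p \<Gamma> \<epsilon> (\<lambda>y. ker y * f y) x"

text \<open>The \<epsilon> in front of the integral cancels the one inside
  \<open>path_integral\<close>, so the integral term has the coefficient -1/2 for both
  signs.\<close>

lemma Lop_altdef:
  "Lop f x = - (1/2) * \<phi> x * f x - of_real \<epsilon> * (1/2) * xi_deriv p f x
     - (1/2) * integral {0..} (\<lambda>s. ker (R x s) * f (R x s))"
proof -
  have "of_real \<epsilon> * (1/2) * (of_real \<epsilon> * I) = (1/2) * I" for I :: complex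
    using \<epsilon>_square(1) by (simp add: mult.assoc[symmetric])
  then show ?thesis by (simp only: Lop_def path_integral_def R_def)
qed

text \<open>Identities between coefficients are known only on \<open>\<Gamma>\<close>. L sees no
  more than that, since \<open>\<Gamma>\<close> is open and contains the rays from its
  points.\<close>

lemma Lop_cong:
  assumes x: "x \<in> \<Gamma>" and eq: "\<And>y. y \<in> \<Gamma> \<Longrightarrow> f y = g y"
  shows "Lop f x = Lop g x"
proof -
  have "xi_deriv p f x = xi_deriv p g x"
    unfolding xi_deriv_def
  proof (rule Lim_cong[OF _ refl])
    show "\<forall>\<^sub>F y in at x. (f y - f x) / (p y - p x) = (g y - g x) / (p y - p x)"
      using eventually_at_in_open'[OF \<Gamma>_subset(1) x] by eventually_elim (simp add: eq x)
  qed
  moreover have "integral {0..} (\<lambda>s. ker (R x s) * f (R x s)) = integral {0..} (\<lambda>s. ker (R x s) * g (R x s))"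
    by (rule integral_cong) (simp add: eq R_props(3)[OF x])
  ultimately show ?thesis by (simp add: Lop_altdef eq x)
qed

text \<open>\<open>xi_deriv\<close> and \<open>integral\<close> are total functions, and additivity
  is available where the derivative exists and the integral converges; on these functions L is
  linear.\<close>

definition in_Lop_domain :: "('a \<Rightarrow> complex) \<Rightarrow> bool" where
  "in_Lop_domain f \<longleftrightarrow> (\<forall>x\<in>\<Gamma>. (\<exists>D. has_xi_derivative p f D x) \<and>
     (\<lambda>s. ker (R x s) * f (R x s)) integrable_on {0..})"

lemma Lop_linear:
  assumes "in_Lop_domain f" "in_Lop_domain g"
  shows "in_Lop_domain (\<lambda>y. f y + a * g y)" and "x \<in> \<Gamma> \<Longrightarrow> Lop (\<lambda>y. f y + a * g y) x = Lop f x + a * Lop g x"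
proof -
  have eq: "ker z * (f z + a * g z) = ker z * f z + a * (ker z * g z)" for z
    by (simp add: algebra_simps)
  have main: "(\<exists>D. has_xi_derivative p (\<lambda>y. f y + a * g y) D x) \<and>
     (\<lambda>s. ker (R x s) * (f (R x s) + a * g (R x s))) integrable_on {0..} \<and>
     Lop (\<lambda>y. f y + a * g y) x = Lop f x + a * Lop g x" if x: "x \<in> \<Gamma>" for x
  proof -
    obtain D E where D: "has_xi_derivative p f D x" and E: "has_xi_derivative p g E x"
      using assms x unfolding in_Lop_domain_def by blast
    have I: "(\<lambda>s. ker (R x s) * f (R x s)) integrable_on {0..}"
       "(\<lambda>s. ker (R x s) * g (R x s)) integrable_on {0..}"
      using assms x by (auto simp: in_Lop_domain_def)
    have xG: "x \<in> G" using x \<Gamma>_subset by blast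
    note DE = has_xi_derivative_add[OF D has_xi_derivative_cmult[OF E, of a]]
    have "xi_deriv p f x = D" "xi_deriv p g x = E" "xi_deriv p (\<lambda>y. f y + a * g y) x = D + a * E"
      using D E DE by (auto intro!: xi_deriv_eqI[OF G xG])
    moreover have "integral {0..} (\<lambda>s. ker (R x s) * (f (R x s) + a * g (R x s)))
      = integral {0..} (\<lambda>s. ker (R x s) * f (R x s)) + a * integral {0..} (\<lambda>s. ker (R x s) * g (R x s))"
      unfolding eq using I by (subst integral_add) (auto intro: integrable_on_mult_right)
    moreover have "(\<lambda>s. ker (R x s) * (f (R x s) + a * g (R x s))) integrable_on {0..}"
      unfolding eq using I by (intro integrable_add integrable_on_mult_right)
    ultimately show ?thesis using DE by (auto simp: Lop_altdef algebra_simps)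
  qed
  show "in_Lop_domain (\<lambda>y. f y + a * g y)" using main by (simp add: in_Lop_domain_def)
  show "Lop (\<lambda>y. f y + a * g y) x = Lop f x + a * Lop g x" if "x \<in> \<Gamma>" using main[OF that] by simp
qed

definition admissible :: "complex set \<Rightarrow> (complex \<Rightarrow> 'a \<Rightarrow> complex) \<Rightarrow> bool" where
  "admissible T F \<longleftrightarrow> analytic_in_both p F T \<Gamma> \<and> loc_bounded T \<Gamma> F"

lemma admissible_deriv:
  assumes "admissible T F" "open T"
  shows "admissible T (\<lambda>t x. deriv (\<lambda>t. F t x) t)"
  using assms analytic_in_both_deriv(1)[OF G \<Gamma>_subset(1,4)] loc_bounded_deriv[of T \<Gamma> F]
  by (auto simp: admissible_def analytic_in_both_def)

lemma admissibleD:
  assumes "admissible T F"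
  shows "\<And>t. t \<in> T \<Longrightarrow> continuous_on \<Gamma> (F t)" "\<And>x. x \<in> \<Gamma> \<Longrightarrow> (\<lambda>t. F t x) holomorphic_on T"
    "\<And>t. t \<in> T \<Longrightarrow> \<exists>M. \<forall>x\<in>\<Gamma>. norm (F t x) \<le> M"
    "continuous_on (T \<times> \<Gamma>) (\<lambda>(t, x). F t x)"
    "\<And>t. t \<in> T \<Longrightarrow> xi_holomorphic_on p (F t) \<Gamma>"
proof -
  show c: "continuous_on (T \<times> \<Gamma>) (\<lambda>(t, x). F t x)" and "\<And>x. x \<in> \<Gamma> \<Longrightarrow> (\<lambda>t. F t x) holomorphic_on T"
    and h: "\<And>t. t \<in> T \<Longrightarrow> xi_holomorphic_on p (F t) \<Gamma>"
    using assms by (auto simp: admissible_def analytic_in_both_def)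
  show "continuous_on \<Gamma> (F t)" if "t \<in> T" for t
    by (rule xi_holomorphic_on_imp_continuous_on[OF G \<Gamma>_subset(1,4) h[OF that]])
  show "\<exists>M. \<forall>x\<in>\<Gamma>. norm (F t x) \<le> M" if "t \<in> T" for t
    using assms that unfolding admissible_def loc_bounded_def by (meson centre_in_ball)
qed

lemma admissible_imp_in_Lop_domain:
  assumes "admissible T F" "t \<in> T"
  shows "in_Lop_domain (F t)"
proof -
  obtain M where M: "\<And>x. x \<in> \<Gamma> \<Longrightarrow> norm (F t x) \<le> M" using admissibleD(3)[OF assms] by blast
  show ?thesis unfolding in_Lop_domain_def
    using admissibleD(5)[OF assms] set_lebesgue_integral_eq_integral(1)[OF kern_mult_integrable[OF _ admissibleD(1)[OF assms] M]]
    by (auto simp: xi_holomorphic_on_def)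
qed

text \<open>The integrals over [0, n] are differentiated by the Leibniz rule on a compact interval.
  The remainders are at most M times the tail of the integral of \<open>kern_bound\<close>,
  uniformly in \<open>t\<close> near the given point, so Weierstrass' theorem on uniform limits of
  holomorphic functions applies.\<close>

lemma ray_integral_has_field_derivative:
  assumes F: "admissible T F" and T: "open T" and t: "t \<in> T" and x: "x \<in> \<Gamma>"
  shows "((\<lambda>t. integral {0..} (\<lambda>s. ker (R x s) * F t (R x s))) has_field_derivative
     integral {0..} (\<lambda>s. ker (R x s) * deriv (\<lambda>t. F t (R x s)) t)) (at t)"
proof -
  let ?k = "\<lambda>s. ker (R x s)"
  note F' = admissible_deriv[OF F T]
  obtain \<delta> M where \<delta>: "\<delta> > 0" "ball t \<delta> \<subseteq> T" and M: "\<And>t' x. t' \<in> ball t \<delta> \<Longrightarrow> x \<in> \<Gamma> \<Longrightarrow> norm (F t' x) \<le> M"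
    using F t unfolding admissible_def loc_bounded_def by meson
  define r where "r = \<delta> / 2"
  have r: "r > 0" "cball t r \<subseteq> ball t \<delta>" "cball t r \<subseteq> T" using \<delta> by (auto simp: r_def subset_iff)
  define f where "f n w = integral {0..real n} (\<lambda>s. ?k s * F w (R x s))" for n :: nat and w
  define f' where "f' n w = integral {0..real n} (\<lambda>s. ?k s * deriv (\<lambda>t. F t (R x s)) w)" for n :: nat and w
  have ck: "continuous_on {0..} ?k" by (rule continuous_on_R[OF continuous_\<Gamma>(4) x])
  have ck': "continuous_on {0..real n} ?k" for n by (rule continuous_on_subset[OF ck]) auto
  have cR: "continuous_on {0..real n} (R x)" for n by (rule continuous_on_subset[OF R_props(1)[OF x]]) auto
  have der: "(f n has_field_derivative f' n w) (at w)" if w: "w \<in> ball t \<delta>" for n w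
  proof -
    have "((\<lambda>w. integral (cbox 0 (real n)) (\<lambda>s. ?k s * F w (R x s))) has_field_derivative
        integral (cbox 0 (real n)) (\<lambda>s. ?k s * deriv (\<lambda>t. F t (R x s)) w)) (at w within ball t \<delta>)"
    proof (rule leibniz_rule_field_derivative)
      fix y s assume y: "y \<in> ball t \<delta>" "s \<in> cbox 0 (real n)"
      have "((\<lambda>t. F t (R x s)) has_field_derivative deriv (\<lambda>t. F t (R x s)) y) (at y)"
        by (rule holomorphic_derivI[OF admissibleD(2)[OF F] T]) (use y \<delta>(2) R_props(3)[OF x] in auto)
      then show "((\<lambda>w. ?k s * F w (R x s)) has_field_derivative ?k s * deriv (\<lambda>t. F t (R x s)) y) (at y within ball t \<delta>)"
        by (rule DERIV_cmult[OF has_field_derivative_at_within])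
    next
      fix y assume "y \<in> ball t \<delta>"
      then have yT: "y \<in> T" using \<delta> by blast
      have "continuous_on {0..} (\<lambda>s. F y (R x s))" by (rule continuous_on_R[OF admissibleD(1)[OF F yT] x])
      then have "continuous_on {0..real n} (\<lambda>s. F y (R x s))" by (rule continuous_on_subset) auto
      then show "(\<lambda>s. ?k s * F y (R x s)) integrable_on cbox 0 (real n)"
        using ck' by (intro integrable_continuous continuous_on_mult) simp_all
    next
      have "continuous_on (ball t \<delta> \<times> cbox 0 (real n)) (\<lambda>q. (\<lambda>(t, y). deriv (\<lambda>t. F t y) t) (fst q, R x (snd q)))"
      proof (rule continuous_on_compose2[OF admissibleD(4)[OF F']])
        show "continuous_on (ball t \<delta> \<times> cbox 0 (real n)) (\<lambda>q. (fst q, R x (snd q)))"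
          by (intro continuous_intros continuous_on_compose2[OF cR]) auto
      qed (use \<delta>(2) R_props(3)[OF x] in auto)
      moreover have "continuous_on (ball t \<delta> \<times> cbox 0 (real n)) (\<lambda>q. ?k (snd q))"
        by (intro continuous_on_compose2[OF ck'] continuous_intros) auto
      ultimately show "continuous_on (ball t \<delta> \<times> cbox 0 (real n)) (\<lambda>(w, s). ?k s * deriv (\<lambda>t. F t (R x s)) w)"
        by (auto simp: split_def intro!: continuous_on_mult)
    qed (use w in auto)
    then show ?thesis unfolding f_def f'_def cbox_interval at_within_open[OF w open_ball] .
  qed
  let ?I = "\<lambda>w. integral {0..} (\<lambda>s. ?k s * F w (R x s))"
  have ai: "(\<lambda>s. ?k s * F w (R x s)) absolutely_integrable_on {0..}" if "w \<in> ball t \<delta>" for w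
    using that \<delta>(2) by (intro kern_mult_integrable[OF x admissibleD(1)[OF F] M]) auto
  have tail: "norm (?I w - f n w) \<le> M * integral {real n..} (\<lambda>s. kern_bound (R x s))" if w: "w \<in> ball t \<delta>" for w n
  proof -
    have "?I w - f n w = integral {real n..} (\<lambda>s. ?k s * F w (R x s))"
      using integral_split_atLeast[OF ai[OF w], of "real n"] by (simp add: f_def)
    also have "norm \<dots> \<le> integral {real n..} (\<lambda>s. M * kern_bound (R x s))"
    proof (rule integral_norm_bound_integral)
      show "(\<lambda>s. ?k s * F w (R x s)) integrable_on {real n..}"
        by (intro set_lebesgue_integral_eq_integral(1) set_integrable_subset[OF ai[OF w]]) auto
      have "(\<lambda>s. kern_bound (R x s)) integrable_on {real n..}"
        by (intro set_lebesgue_integral_eq_integral(1) set_integrable_subset[OF kern_bound_integrable[OF x]]) auto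
      then show "(\<lambda>s. M * kern_bound (R x s)) integrable_on {real n..}" by (rule integrable_on_mult_right)
      fix s assume "s \<in> {real n..}"
      then have "R x s \<in> \<Gamma>" using R_props(3)[OF x] by (simp add: order_trans[OF of_nat_0_le_iff])
      then show "norm (?k s * F w (R x s)) \<le> M * kern_bound (R x s)"
        unfolding norm_mult mult.commute[of M] by (intro mult_mono norm_kern_le M[OF w] kern_bound_nonneg) auto
    qed
    finally show ?thesis by simp
  qed
  have ul: "uniform_limit (cball t r) f ?I sequentially"
    unfolding uniform_limit_iff
  proof (intro allI impI)
    fix e :: real assume e: "e > 0"
    have "(\<lambda>n. M * integral {real n..} (\<lambda>s. kern_bound (R x s))) \<longlonglongrightarrow> M * 0"
      by (intro tendsto_intros integral_atLeast_tendsto_0 kern_bound_integrable x)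
    then have "\<forall>\<^sub>F n in sequentially. M * integral {real n..} (\<lambda>s. kern_bound (R x s)) < e"
      using e by (intro order_tendstoD(2)) auto
    then show "\<forall>\<^sub>F n in sequentially. \<forall>w\<in>cball t r. dist (f n w) (?I w) < e"
    proof eventually_elim
      case (elim n)
      show ?case
      proof
        fix w assume "w \<in> cball t r"
        then have "w \<in> ball t \<delta>" using r by blast
        from tail[OF this, of n] elim show "dist (f n w) (?I w) < e"
          by (simp add: dist_norm norm_minus_commute)
      qed
    qed
  qed
  have ev: "\<forall>\<^sub>F n in sequentially. continuous_on (cball t r) (f n) \<and> (\<forall>w\<in>ball t r. (f n has_field_derivative f' n w) (at w))"
  proof (intro always_eventually allI conjI ballI)
    fix n
    show "continuous_on (cball t r) (f n)"
      using der r(2) by (intro continuous_at_imp_continuous_on ballI DERIV_isCont) blast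
    show "(f n has_field_derivative f' n w) (at w)" if "w \<in> ball t r" for w
      using der r(2) that ball_subset_cball by blast
  qed
  obtain g' where g': "\<And>w. w \<in> ball t r \<Longrightarrow> (?I has_field_derivative (g' w)) (at w) \<and> (\<lambda>n. f' n w) \<longlonglongrightarrow> g' w"
    by (rule has_complex_derivative_uniform_limit[OF ev ul trivial_limit_sequentially r(1)]) fast
  have tr: "t \<in> ball t r" using r by simp
  obtain M' where M': "\<And>y. y \<in> \<Gamma> \<Longrightarrow> norm (deriv (\<lambda>t. F t y) t) \<le> M'" using admissibleD(3)[OF F' t] by blast
  have "(\<lambda>n. f' n t) \<longlonglongrightarrow> integral {0..} (\<lambda>s. ?k s * deriv (\<lambda>t. F t (R x s)) t)"
    unfolding f'_def by (intro integral_atLeastAtMost_tendsto kern_mult_integrable[OF x admissibleD(1)[OF F' t] M'])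
  then have "g' t = integral {0..} (\<lambda>s. ?k s * deriv (\<lambda>t. F t (R x s)) t)"
    using g'[OF tr] LIMSEQ_unique by blast
  then show ?thesis using g'[OF tr] by simp
qed

text \<open>The multiplication by \<phi> commutes with d/dt trivially, the \<xi>-derivative by the
  symmetry of mixed derivatives, and the integral by differentiation under the integral
  sign.\<close>

lemma Lop_has_field_derivative:
  assumes F: "admissible T F" and T: "open T" and t: "t \<in> T" and x: "x \<in> \<Gamma>"
  shows "((\<lambda>t. Lop (F t) x) has_field_derivative Lop (\<lambda>y. deriv (\<lambda>t. F t y) t) x) (at t)"
  unfolding Lop_altdef
  using F analytic_in_both_deriv(2)[OF G \<Gamma>_subset(1,4) T _ t x, of F] holomorphic_derivI[OF admissibleD(2)[OF F x] T t]
  by (intro DERIV_diff DERIV_cmult ray_integral_has_field_derivative[OF F T t x]) (auto simp: admissible_def)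

lemma admissible_higher_deriv:
  assumes F: "admissible T F" and T: "open T"
  shows "admissible T (\<lambda>t x. (deriv ^^ n) (\<lambda>t. F t x) t)"
    and "t \<in> T \<Longrightarrow> x \<in> \<Gamma> \<Longrightarrow> (deriv ^^ n) (\<lambda>t. Lop (F t) x) t = Lop (\<lambda>y. (deriv ^^ n) (\<lambda>t. F t y) t) x"
proof -
  show admissible: "admissible T (\<lambda>t x. (deriv ^^ n) (\<lambda>t. F t x) t)" for n
  proof (induction n)
    case (Suc n)
    then show ?case using admissible_deriv[OF Suc T] by simp
  qed (use F in simp)
  show "(deriv ^^ n) (\<lambda>t. Lop (F t) x) t = Lop (\<lambda>y. (deriv ^^ n) (\<lambda>t. F t y) t) x" if t: "t \<in> T" and x: "x \<in> \<Gamma>" 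
    using t
  proof (induction n arbitrary: t)
    case (Suc n)
    have "(deriv ^^ Suc n) (\<lambda>t. Lop (F t) x) t = deriv (\<lambda>t. Lop (\<lambda>y. (deriv ^^ n) (\<lambda>t. F t y) t) x) t"
      using deriv_cong_on_open[OF T Suc.prems Suc.IH] by simp
    also have "\<dots> = Lop (\<lambda>y. (deriv ^^ Suc n) (\<lambda>t. F t y) t) x"
      using DERIV_imp_deriv[OF Lop_has_field_derivative[OF admissible T Suc.prems x]] by simp
    finally show ?case .
  qed simp
qed

end

section \<open>The equation for the Borel transform\<close>

lemma weight_ge_1: "weight p \<epsilon> \<rho> x \<ge> 1"
  by (simp add: weight_def)

lemma U_region_mono: "r \<le> s \<Longrightarrow> U_region r \<subseteq> U_region s"
  by (auto simp: U_region_def)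

text \<open>The a priori bounds on \<open>F\<close> are available on U(2 r) for r < d only; these
  regions exhaust U(2 d).\<close>

lemma U_region_shrink:
  assumes t: "t \<in> U_region (2 * d)" and d: "d > 0"
  obtains r where "0 < r" "r < d" "t \<in> U_region (2 * r)"
proof (cases "norm t < 2 * d")
  case True
  show thesis
    by (rule that[of "(norm t / 2 + d) / 2"]) (use True d in \<open>auto simp: U_region_def add_nonneg_pos\<close>)
next
  case False
  then have "Re t > 0" "\<bar>Im t\<bar> < 2 * d" using t by (auto simp: U_region_def)
  then show thesis
    by (intro that[of "(\<bar>Im t\<bar> / 2 + d) / 2"]) (use d in \<open>auto simp: U_region_def add_nonneg_pos\<close>)
qed

locale wkb_borel = wkb_problem p G \<Delta> \<Gamma> \<phi> \<psi> \<epsilon> c \<rho> d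
  for p :: "'a::t2_space \<Rightarrow> complex" and G \<Delta> \<Gamma> :: "'a set" and \<phi> \<psi> :: "'a \<Rightarrow> complex"
    and \<epsilon> c \<rho> d :: real +
  fixes \<eta> F :: "complex \<Rightarrow> 'a \<Rightarrow> complex" and \<omega> :: real
  assumes F: "borel_transform p \<phi> \<psi> \<Gamma> \<epsilon> d \<rho> \<eta> F"
    and \<omega>: "\<omega> > pi / (4 * d)"
begin

abbreviation "coeA \<equiv> coeffA p \<phi> \<psi> \<Gamma> \<epsilon>"
abbreviation "coeB \<equiv> coeffB p \<phi> \<psi> \<Gamma> \<epsilon> \<omega>"
abbreviation "fterm \<equiv> factorial_term p \<phi> \<psi> \<Gamma> \<epsilon> \<omega>"
abbreviation "T \<equiv> U_region (2 * d)"
abbreviation "W \<equiv> weight p \<epsilon> \<rho>"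

lemma open_T: "open T" "connected T" "0 \<in> T"
  using open_connected_U_region[of "2 * d"] d by auto

lemma \<omega>_pos: "\<omega> > 0"
  using \<omega> d by (meson less_trans divide_pos_pos mult_pos_pos pi_gt_zero zero_less_numeral)

lemma F_bound:
  assumes "\<sigma> > 0" "0 < r" "r < d"
  obtains K where "K > 0" "\<And>t x. t \<in> U_region (2 * r) \<Longrightarrow> x \<in> \<Gamma> \<Longrightarrow> norm (F t x) \<le> K * exp (\<sigma> * Re t) / W x"
  using F assms unfolding borel_transform_def by meson

lemma F_bound_no_weight:
  assumes "\<sigma> > 0" "0 < r" "r < d"
  obtains K where "K > 0" "\<And>t x. t \<in> U_region (2 * r) \<Longrightarrow> x \<in> \<Gamma> \<Longrightarrow> norm (F t x) \<le> K * exp (\<sigma> * Re t)"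
proof -
  obtain K where K: "K > 0" "\<And>t x. t \<in> U_region (2 * r) \<Longrightarrow> x \<in> \<Gamma> \<Longrightarrow> norm (F t x) \<le> K * exp (\<sigma> * Re t) / W x"
    using F_bound[OF assms] by blast
  have "norm (F t x) \<le> K * exp (\<sigma> * Re t)" if "t \<in> U_region (2 * r)" "x \<in> \<Gamma>" for t x
  proof -
    have "K * exp (\<sigma> * Re t) / W x \<le> K * exp (\<sigma> * Re t) / 1"
      using K(1) weight_ge_1[of p \<epsilon> \<rho> x] by (intro divide_left_mono) auto
    then show ?thesis using K(2)[OF that] by simp
  qed
  then show thesis using K(1) that by blast
qed

text \<open>The radius d - r fits because 2 r + (d - r) = r + d is twice the midpoint of r and d,
  and this midpoint is still less than d.\<close>

lemma ball_radius:
  assumes "0 < r" "r < d" "t \<in> U_region (2 * r)"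
  shows "ball t (d - r) \<subseteq> U_region (2 * ((r + d) / 2))" "0 < (r + d) / 2" "(r + d) / 2 < d"
  using assms by (auto intro!: ball_subset_U_region[OF assms(3)])

lemma F_admissible: "admissible T F"
  unfolding admissible_def
proof
  show "analytic_in_both p F T \<Gamma>" using F by (simp add: borel_transform_def)
  show "loc_bounded T \<Gamma> F"
    unfolding loc_bounded_def
  proof
    fix t assume "t \<in> T"
    then obtain r where r: "0 < r" "r < d" "t \<in> U_region (2 * r)" using U_region_shrink d by blast
    note br = ball_radius[OF r]
    obtain K where K: "K > 0" "\<And>t x. t \<in> U_region (2 * ((r + d) / 2)) \<Longrightarrow> x \<in> \<Gamma> \<Longrightarrow> norm (F t x) \<le> K * exp (1 * Re t)"
      using F_bound_no_weight[OF zero_less_one br(2,3)] by blast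
    have "norm (F t' x) \<le> K * exp (Re t + (d - r))" if "t' \<in> ball t (d - r)" "x \<in> \<Gamma>" for t' x
    proof -
      have "\<bar>Re t' - Re t\<bar> \<le> norm (t' - t)" using abs_Re_le_cmod[of "t' - t"] by simp
      then have "Re t' \<le> Re t + (d - r)" using that(1) by (simp add: dist_norm norm_minus_commute)
      then have "K * exp (1 * Re t') \<le> K * exp (Re t + (d - r))" using K(1) by simp
      then show ?thesis using K(2)[of t' x] that br(1) by (meson order_trans subsetD)
    qed
    moreover have "ball t (d - r) \<subseteq> T" using br(1) U_region_mono[of "2 * ((r + d) / 2)" "2 * d"] br(3) by force
    ultimately show "\<exists>\<delta>>0. \<exists>M. ball t \<delta> \<subseteq> T \<and> (\<forall>t'\<in>ball t \<delta>. \<forall>x\<in>\<Gamma>. norm (F t' x) \<le> M)"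
      using r(2) by (intro exI[of _ "d - r"] conjI exI[of _ "K * exp (Re t + (d - r))"]) auto
  qed
qed

lemma coeffA_Suc: "coeA (Suc n) = Lop (coeA n)"
  by (rule ext) (simp add: Lop_def)

lemma higher_deriv_F_0:
  assumes x: "x \<in> \<Gamma>"
  shows "(deriv ^^ n) (\<lambda>t. F t x) 0 = coeA (Suc n) x"
proof -
  have "(deriv ^^ n) (\<lambda>t. F t x) 0 = fact n * (coeA (n + 1) x / fact n)"
    by (rule higher_deriv_power_series[of "2 * d"]) (use F d x in \<open>auto simp: borel_transform_def\<close>)
  then show ?thesis by simp
qed

lemma borel_pde:
  assumes t: "t \<in> T" and x: "x \<in> \<Gamma>"
  shows "deriv (\<lambda>t. F t x) t = Lop (F t) x"
proof -
  note admissible = F_admissible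
  let ?H = "\<lambda>t. deriv (\<lambda>t. F t x) t - Lop (F t) x"
  have h1: "deriv (\<lambda>t. F t x) holomorphic_on T"
    by (intro holomorphic_deriv admissibleD(2)[OF admissible x] open_T)
  have h2: "(\<lambda>t. Lop (F t) x) holomorphic_on T"
    unfolding holomorphic_on_open[OF open_T(1)]
    using Lop_has_field_derivative[OF admissible open_T(1) _ x] by blast
  have "?H t = 0"
  proof (rule holomorphic_fun_eq_0_on_connected[OF _ open_T(1,2) _ open_T(3) t])
    show "?H holomorphic_on T" by (intro holomorphic_on_diff h1 h2)
    fix n
    have "(deriv ^^ n) ?H 0 = (deriv ^^ n) (deriv (\<lambda>t. F t x)) 0 - (deriv ^^ n) (\<lambda>t. Lop (F t) x) 0"
      by (rule higher_deriv_diff[OF h1 h2 open_T(1,3)])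
    also have "(deriv ^^ n) (deriv (\<lambda>t. F t x)) 0 = (deriv ^^ Suc n) (\<lambda>t. F t x) 0"
      by (simp only: funpow_Suc_right o_apply)
    also have "\<dots> = Lop (coeA (Suc n)) x"
      unfolding higher_deriv_F_0[OF x] by (simp only: coeffA_Suc)
    also have "(deriv ^^ n) (\<lambda>t. Lop (F t) x) 0 = Lop (\<lambda>y. (deriv ^^ n) (\<lambda>t. F t y) 0) x"
      by (rule admissible_higher_deriv(2)[OF admissible open_T(1,3) x])
    \<comment> \<open>The Taylor coefficients are known at every point of \<open>\<Gamma>\<close>,
      so they may be inserted under L.\<close>
    also have "\<dots> = Lop (coeA (Suc n)) x"
      by (rule Lop_cong[OF x higher_deriv_F_0])
    finally show "(deriv ^^ n) ?H 0 = 0" by simp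
  qed
  then show ?thesis by simp
qed

text \<open>As \<open>\<partial>/\<partial>s = (exp (\<omega> t) / \<omega>) \<partial>/\<partial>t\<close> for \<open>s = 1 - exp (- \<omega> t)\<close>, the \<open>n\<close>-th derivative of \<open>F\<close> in \<open>s\<close> is
  \<open>(exp (\<omega> t) / \<omega>)\<^sup>n\<close> times \<open>\<partial>/\<partial>t (\<partial>/\<partial>t + \<omega>) \<cdots> (\<partial>/\<partial>t + (n - 1) \<omega>) F\<close>.\<close>

primrec tF :: "nat \<Rightarrow> complex \<Rightarrow> 'a \<Rightarrow> complex" where
  "tF 0 = F"
| "tF (Suc n) = (\<lambda>t x. deriv (\<lambda>t. tF n t x) t + of_nat n * of_real \<omega> * tF n t x)"

text \<open>L is linear and commutes with d/dt, hence with d/dt + n \<omega>; so every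
  \<open>tF n\<close> satisfies the equation of \<open>F\<close>. Both claims go through one
  induction because the second relies on the admissibility of the preceding function.\<close>

lemma tF_props:
  shows "admissible T (tF n)"
    and "t \<in> T \<Longrightarrow> x \<in> \<Gamma> \<Longrightarrow> deriv (\<lambda>t. tF n t x) t = Lop (tF n t) x"
proof (induction n arbitrary: t x)
  case 0
  show "admissible T (tF 0)" using F_admissible by simp
  show "deriv (\<lambda>t. tF 0 t x) t = Lop (tF 0 t) x" if "t \<in> T" "x \<in> \<Gamma>" for t x using borel_pde[OF that] by simp
next
  case (Suc n)
  let ?a = "of_nat n * of_real \<omega> :: complex"
  note gd = admissible_deriv[OF Suc.IH(1) open_T(1)]
  show "admissible T (tF (Suc n))"
    unfolding admissible_def
  proof
    show "analytic_in_both p (tF (Suc n)) T \<Gamma>"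
      unfolding analytic_in_both_def
    proof (intro conjI ballI)
      have "continuous_on (T \<times> \<Gamma>) (\<lambda>q. (\<lambda>(t, x). deriv (\<lambda>t. tF n t x) t) q + ?a * (\<lambda>(t, x). tF n t x) q)"
        by (intro continuous_intros admissibleD(4)[OF gd] admissibleD(4)[OF Suc.IH(1)])
      then show "continuous_on (T \<times> \<Gamma>) (\<lambda>(t, x). tF (Suc n) t x)" by (simp add: split_def)
      show "(\<lambda>t. tF (Suc n) t x) holomorphic_on T" if "x \<in> \<Gamma>" for x
        using admissibleD(2)[OF gd that] admissibleD(2)[OF Suc.IH(1) that] by (auto intro!: holomorphic_intros)
      show "xi_holomorphic_on p (tF (Suc n) t) \<Gamma>" if t: "t \<in> T" for t
        unfolding xi_holomorphic_on_def
      proof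
        fix x assume "x \<in> \<Gamma>"
        then obtain D E where "has_xi_derivative p (\<lambda>x. deriv (\<lambda>t. tF n t x) t) D x" "has_xi_derivative p (tF n t) E x"
          using admissibleD(5)[OF gd t] admissibleD(5)[OF Suc.IH(1) t] unfolding xi_holomorphic_on_def by blast
        from has_xi_derivative_add[OF this(1) has_xi_derivative_cmult[OF this(2), of ?a]]
        show "\<exists>D. has_xi_derivative p (tF (Suc n) t) D x" by auto
      qed
    qed
    show "loc_bounded T \<Gamma> (tF (Suc n))"
      unfolding loc_bounded_def
    proof
      fix t assume t: "t \<in> T"
      obtain \<delta>1 M1 where 1: "\<delta>1 > 0" "ball t \<delta>1 \<subseteq> T" "\<And>t' x. t' \<in> ball t \<delta>1 \<Longrightarrow> x \<in> \<Gamma> \<Longrightarrow> norm (deriv (\<lambda>t. tF n t x) t') \<le> M1"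
        using gd t unfolding admissible_def loc_bounded_def by meson
      obtain \<delta>2 M2 where 2: "\<delta>2 > 0" "\<And>t' x. t' \<in> ball t \<delta>2 \<Longrightarrow> x \<in> \<Gamma> \<Longrightarrow> norm (tF n t' x) \<le> M2"
        using Suc.IH(1) t unfolding admissible_def loc_bounded_def by meson
      have "norm (tF (Suc n) t' x) \<le> M1 + norm ?a * M2" if "t' \<in> ball t (min \<delta>1 \<delta>2)" "x \<in> \<Gamma>" for t' x
      proof -
        have "norm (tF (Suc n) t' x) \<le> norm (deriv (\<lambda>t. tF n t x) t') + norm (?a * tF n t' x)"
          unfolding tF.simps by (rule norm_triangle_ineq)
        also have "\<dots> \<le> M1 + norm ?a * M2"
          unfolding norm_mult[of ?a] using that by (intro add_mono mult_left_mono 1(3) 2(2)) auto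
        finally show ?thesis .
      qed
      moreover have "ball t (min \<delta>1 \<delta>2) \<subseteq> T" using 1(2) by auto
      ultimately show "\<exists>\<delta>>0. \<exists>M. ball t \<delta> \<subseteq> T \<and> (\<forall>t'\<in>ball t \<delta>. \<forall>x\<in>\<Gamma>. norm (tF (Suc n) t' x) \<le> M)"
        using 1(1) 2(1) by (intro exI[of _ "min \<delta>1 \<delta>2"] conjI exI[of _ "M1 + norm ?a * M2"]) auto
    qed
  qed
  show "deriv (\<lambda>t. tF (Suc n) t x) t = Lop (tF (Suc n) t) x" if t: "t \<in> T" and x: "x \<in> \<Gamma>" for t x
  proof -
    have hn: "(\<lambda>t. tF n t x) holomorphic_on T" by (rule admissibleD(2)[OF Suc.IH(1) x])
    have d1: "((\<lambda>t. deriv (\<lambda>t. tF n t x) t) has_field_derivative deriv (\<lambda>t. deriv (\<lambda>t. tF n t x) t) t) (at t)"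
      by (rule holomorphic_derivI[OF admissibleD(2)[OF gd x] open_T(1) t])
    have d2: "((\<lambda>t. tF n t x) has_field_derivative deriv (\<lambda>t. tF n t x) t) (at t)"
      by (rule holomorphic_derivI[OF hn open_T(1) t])
    have "((\<lambda>t. tF (Suc n) t x) has_field_derivative deriv (\<lambda>t. deriv (\<lambda>t. tF n t x) t) t + ?a * deriv (\<lambda>t. tF n t x) t) (at t)"
      unfolding tF.simps by (intro DERIV_add DERIV_cmult d1 d2)
    then have "deriv (\<lambda>t. tF (Suc n) t x) t = deriv (\<lambda>t. deriv (\<lambda>t. tF n t x) t) t + ?a * deriv (\<lambda>t. tF n t x) t"
      by (rule DERIV_imp_deriv)
    also have "deriv (\<lambda>t. deriv (\<lambda>t. tF n t x) t) t = deriv (\<lambda>t. Lop (tF n t) x) t"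
      using Suc.IH(2)[OF _ x] by (rule deriv_cong_on_open[OF open_T(1) t])
    also have "\<dots> = Lop (\<lambda>y. deriv (\<lambda>t. tF n t y) t) x"
      by (rule DERIV_imp_deriv[OF Lop_has_field_derivative[OF Suc.IH(1) open_T(1) t x]])
    also have "deriv (\<lambda>t. tF n t x) t = Lop (tF n t) x" by (rule Suc.IH(2)[OF t x])
    also have "Lop (\<lambda>y. deriv (\<lambda>t. tF n t y) t) x + ?a * Lop (tF n t) x = Lop (tF (Suc n) t) x"
      using Lop_linear(2)[OF admissible_imp_in_Lop_domain[OF gd t] admissible_imp_in_Lop_domain[OF Suc.IH(1) t] x] by simp
    finally show ?thesis .
  qed
qed

text \<open>By the equation for \<open>tF n\<close>, d/dt may be replaced by L, and then d/dt + n
  \<omega> at t = 0 is the recurrence of the B coefficients. The indices match: the step from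
  \<open>Suc n\<close> to \<open>Suc (Suc n)\<close> carries the factor n \<omega> on both
  sides.\<close>

lemma coeffB_eq_tF:
  assumes "x \<in> \<Gamma>"
  shows "coeB (Suc n) x = tF n 0 x"
  using assms
proof (induction n arbitrary: x)
  case 0
  have "coeB (Suc 0) = coeA (Suc 0)"
    by (simp only: coeffB.simps One_nat_def)
  then show ?case using higher_deriv_F_0[OF 0, of 0] by simp
next
  case (Suc n)
  have "coeB (Suc (Suc n)) x = of_nat n * of_real \<omega> * coeB (Suc n) x
     + Lop (coeB (Suc n)) x"
    unfolding coeffB.simps(3) Lop_def by (simp add: left_diff_distrib)
  also have "Lop (coeB (Suc n)) x = Lop (tF n 0) x"
    by (rule Lop_cong[OF Suc.prems Suc.IH])
  also have "\<dots> = deriv (\<lambda>t. tF n t x) 0"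
    by (rule tF_props(2)[OF open_T(3) Suc.prems, symmetric])
  finally show ?case using Suc.IH[OF Suc.prems] by simp
qed

text \<open>Cauchy's inequality uses up a margin for each derivative. The induction passes from r to
  (r + d) / 2, which stays below \<open>d\<close>, and is therefore stated for all r; the shift of
  Re t by at most \<open>\<delta>\<close> only changes the constant.\<close>

lemma tF_bound:
  assumes "\<sigma> > 0" "0 < r" "r < d"
  shows "\<exists>K>0. \<forall>t\<in>U_region (2 * r). \<forall>x\<in>\<Gamma>. norm (tF n t x) \<le> K * exp (\<sigma> * Re t)"
  using assms
proof (induction n arbitrary: r)
  case 0
  then show ?case using F_bound_no_weight by (metis tF.simps(1))
next
  case (Suc n)
  define r' where "r' = (r + d) / 2"
  have r': "0 < r'" "r' < d" "r \<le> r'" using Suc.prems by (auto simp: r'_def)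
  obtain K where K: "K > 0" "\<And>t x. t \<in> U_region (2 * r') \<Longrightarrow> x \<in> \<Gamma> \<Longrightarrow> norm (tF n t x) \<le> K * exp (\<sigma> * Re t)"
    using Suc.IH[OF Suc.prems(1) r'(1,2)] by blast
  define \<delta> where "\<delta> = (d - r) / 2"
  have \<delta>: "\<delta> > 0" "\<delta> < d - r" using Suc.prems by (auto simp: \<delta>_def)
  let ?a = "of_nat n * of_real \<omega> :: complex"
  define K' where "K' = K * exp (\<sigma> * \<delta>) / \<delta> + norm ?a * K"
  have K': "K' > 0" using K(1) \<delta> by (auto simp: K'_def intro!: add_pos_nonneg)
  have "norm (tF (Suc n) t x) \<le> K' * exp (\<sigma> * Re t)" if t: "t \<in> U_region (2 * r)" and x: "x \<in> \<Gamma>" for t x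
  proof -
    have sub: "cball t \<delta> \<subseteq> U_region (2 * r')"
      using ball_radius(1)[OF Suc.prems(2,3) t] \<delta> by (auto simp: r'_def subset_iff)
    have subT: "U_region (2 * r') \<subseteq> T" using r' by (intro U_region_mono) auto
    have "norm ((deriv ^^ 1) (\<lambda>t. tF n t x) t) \<le> fact 1 * (K * exp (\<sigma> * (Re t + \<delta>))) / \<delta> ^ 1"
    proof (rule Cauchy_inequality)
      have cb: "cball t \<delta> \<subseteq> T" using sub subT by blast
      show "(\<lambda>t. tF n t x) holomorphic_on ball t \<delta>"
        using cb ball_subset_cball[of t \<delta>] by (intro holomorphic_on_subset[OF admissibleD(2)[OF tF_props(1) x]]) auto
      show "continuous_on (cball t \<delta>) (\<lambda>t. tF n t x)"
        using cb by (intro holomorphic_on_imp_continuous_on holomorphic_on_subset[OF admissibleD(2)[OF tF_props(1) x]])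
      fix t' assume t': "norm (t - t') = \<delta>"
      then have "t' \<in> U_region (2 * r')" using sub by (auto simp: dist_norm subset_iff)
      then have "norm (tF n t' x) \<le> K * exp (\<sigma> * Re t')" using x by (rule K(2))
      also have "Re t' \<le> Re t + \<delta>" using abs_Re_le_cmod[of "t - t'"] t' by simp
      then have "K * exp (\<sigma> * Re t') \<le> K * exp (\<sigma> * (Re t + \<delta>))" using K(1) Suc.prems(1) by simp
      finally show "norm (tF n t' x) \<le> K * exp (\<sigma> * (Re t + \<delta>))" .
    qed (rule \<delta>)
    then have 1: "norm (deriv (\<lambda>t. tF n t x) t) \<le> K * exp (\<sigma> * \<delta>) / \<delta> * exp (\<sigma> * Re t)"
      by (simp add: distrib_left exp_add mult_ac)
    have "t \<in> U_region (2 * r')" using sub \<delta> by auto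
    then have 2: "norm (tF n t x) \<le> K * exp (\<sigma> * Re t)" using x by (rule K(2))
    have "norm (tF (Suc n) t x) \<le> norm (deriv (\<lambda>t. tF n t x) t) + norm (?a * tF n t x)"
      unfolding tF.simps by (rule norm_triangle_ineq)
    also have "\<dots> \<le> K * exp (\<sigma> * \<delta>) / \<delta> * exp (\<sigma> * Re t) + norm ?a * (K * exp (\<sigma> * Re t))"
      unfolding norm_mult[of ?a] by (intro add_mono mult_left_mono 1 2) auto
    also have "\<dots> = K' * exp (\<sigma> * Re t)" by (simp add: K'_def algebra_simps)
    finally show ?thesis .
  qed
  then show ?case using K' by blast
qed

section \<open>The Borel transform on the unit disc\<close>

definition \<tau> :: "complex \<Rightarrow> complex" where
  "\<tau> s = - Ln (1 - s) / of_real \<omega>"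

text \<open>This is what the lower bound on \<omega> is for: r = pi / (4 \<omega>) is less than
  \<open>d\<close>, so U(2 r), which contains the image of the unit disc, lies where the bounds on
  \<open>F\<close> hold.\<close>

lemma half_strip: "pi / (2 * \<omega>) < 2 * d" "0 < pi / (4 * \<omega>)" "pi / (4 * \<omega>) < d"
proof -
  show "0 < pi / (4 * \<omega>)" using \<omega>_pos by simp
  show *: "pi / (4 * \<omega>) < d" using \<omega> \<omega>_pos d by (simp add: field_simps)
  show "pi / (2 * \<omega>) < 2 * d" using * by simp
qed

lemma \<tau>_facts:
  assumes s: "s \<in> ball 0 1"
  shows "\<tau> s \<in> U_region (2 * (pi / (4 * \<omega>)))" "\<tau> s \<in> T" "exp (of_real \<omega> * \<tau> s) = inverse (1 - s)"
    "exp (\<sigma> * Re (\<tau> s)) = norm (1 - s) powr (- (\<sigma> / \<omega>))" "Re (\<tau> s) > - ln 2 / \<omega>"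
    "(\<tau> has_field_derivative exp (of_real \<omega> * \<tau> s) / of_real \<omega>) (at s)"
proof -
  note L = Ln_unit_disc[OF s \<omega>_pos, folded \<tau>_def]
  show "\<tau> s \<in> U_region (2 * (pi / (4 * \<omega>)))" using L(3) by simp
  then show "\<tau> s \<in> T" using half_strip U_region_mono[of "2 * (pi / (4 * \<omega>))" "2 * d"] by auto
  show e: "exp (of_real \<omega> * \<tau> s) = inverse (1 - s)"
    using L(1) by (metis exp_minus inverse_inverse_eq minus_mult_left)
  show "exp (\<sigma> * Re (\<tau> s)) = norm (1 - s) powr (- (\<sigma> / \<omega>))"
    using L(2,4) by (simp add: powr_def)
  have "ln (norm (1 - s)) < ln 2" using L(4,5) by simp
  then show "Re (\<tau> s) > - ln 2 / \<omega>" unfolding L(2) using \<omega>_pos by (intro divide_strict_right_mono) auto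
  have nz: "1 - s \<notin> \<real>\<^sub>\<le>\<^sub>0" using L(6) by (auto simp: complex_nonpos_Reals_iff)
  have "((\<lambda>s. - Ln (1 - s)) has_field_derivative inverse (1 - s)) (at s)"
    using nz by (auto intro!: derivative_eq_intros simp: divide_inverse)
  then have "((\<lambda>s. - Ln (1 - s) / of_real \<omega>) has_field_derivative (inverse (1 - s) / of_real \<omega>)) (at s)"
    by (rule DERIV_cdivide)
  then show "(\<tau> has_field_derivative exp (of_real \<omega> * \<tau> s) / of_real \<omega>) (at s)"
    unfolding e unfolding \<tau>_def[abs_def] .
qed

text \<open>This is the n-th derivative of \<open>\<lambda>s. F (\<tau> s) x\<close>, written
  through \<open>tF\<close>.\<close>

definition sF :: "nat \<Rightarrow> 'a \<Rightarrow> complex \<Rightarrow> complex" where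
  "sF n x s = exp (of_real \<omega> * \<tau> s) ^ n / of_real \<omega> ^ n * tF n (\<tau> s) x"

text \<open>Differentiating the n-th power of exp (\<omega> t) with respect to s produces a term
  with the factor n; it is the summand n \<omega> \<open>tF n\<close> in the recursion of
  \<open>tF\<close>.\<close>

lemma sF_has_field_derivative:
  assumes x: "x \<in> \<Gamma>" and s: "s \<in> ball 0 1"
  shows "(sF n x has_field_derivative sF (Suc n) x s) (at s)"
proof -
  note tf = \<tau>_facts[OF s]
  let ?D = "deriv (\<lambda>t. tF n t x) (\<tau> s)" and ?e = "exp (of_real \<omega> * \<tau> s)"
  have dF: "((\<lambda>t. tF n t x) has_field_derivative ?D) (at (\<tau> s))"
    by (rule holomorphic_derivI[OF admissibleD(2)[OF tF_props(1) x] open_T(1) tf(2)])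
  have dc: "((\<lambda>s. tF n (\<tau> s) x) has_field_derivative ?D * (?e / of_real \<omega>)) (at s)"
    using DERIV_chain2[OF dF tf(6)] .
  have de: "((\<lambda>s. exp (of_real \<omega> * \<tau> s)) has_field_derivative ?e * ?e) (at s)"
    using DERIV_fun_exp[OF DERIV_cmult[OF tf(6), of "of_real \<omega>"]] \<omega>_pos by simp
  have "((\<lambda>s. exp (of_real \<omega> * \<tau> s) ^ n) has_field_derivative of_nat n * ?e ^ (n - 1) * (?e * ?e)) (at s)"
    using DERIV_power[OF de, of n] by (simp add: mult_ac)
  also have "of_nat n * ?e ^ (n - 1) * (?e * ?e) = of_nat n * ?e ^ Suc n"
    by (cases n) simp_all
  finally have "((\<lambda>s. exp (of_real \<omega> * \<tau> s) ^ n / of_real \<omega> ^ n * tF n (\<tau> s) x) has_field_derivative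
     (of_nat n * ?e ^ Suc n / of_real \<omega> ^ n) * tF n (\<tau> s) x + ?D * (?e / of_real \<omega>) * (?e ^ n / of_real \<omega> ^ n)) (at s)"
    using \<omega>_pos by (intro DERIV_mult dc DERIV_cdivide) auto
  also have "(of_nat n * ?e ^ Suc n / of_real \<omega> ^ n) * tF n (\<tau> s) x + ?D * (?e / of_real \<omega>) * (?e ^ n / of_real \<omega> ^ n) = sF (Suc n) x s"
    using \<omega>_pos by (simp add: sF_def field_simps)
  finally show ?thesis by (simp add: sF_def[abs_def])
qed

lemma sF_holomorphic: "x \<in> \<Gamma> \<Longrightarrow> sF n x holomorphic_on ball 0 1"
  unfolding holomorphic_on_open[OF open_ball] using sF_has_field_derivative by blast

lemma higher_deriv_sF:
  assumes x: "x \<in> \<Gamma>" and s: "s \<in> ball 0 1"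
  shows "(deriv ^^ n) (sF m x) s = sF (n + m) x s"
  using s
proof (induction n arbitrary: s)
  case (Suc n)
  have "(deriv ^^ Suc n) (sF m x) s = deriv (sF (n + m) x) s"
    using deriv_cong_on_open[OF open_ball Suc.prems Suc.IH] by simp
  then show ?case using DERIV_imp_deriv[OF sF_has_field_derivative[OF x Suc.prems]] by simp
qed simp

definition disc_coeff :: "nat \<Rightarrow> 'a \<Rightarrow> complex" where
  "disc_coeff n x = coeB (Suc n) x / (fact n * of_real \<omega> ^ n)"

text \<open>The second form reads the coefficient off the second derivative in s; the division by (n
  + 1)(n + 2) gains two powers of n over a bound for the coefficients of that derivative.\<close>

lemma disc_coeff_eq:
  assumes x: "x \<in> \<Gamma>"
  shows "disc_coeff n x = (deriv ^^ n) (sF 0 x) 0 / fact n" "disc_coeff (n + 2) x = (deriv ^^ n) (sF 2 x) 0 / (fact n * ((real n + 1) * (real n + 2)))"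
proof -
  have "(deriv ^^ n) (sF m x) 0 = coeB (Suc (n + m)) x / of_real \<omega> ^ (n + m)" for n m
    unfolding coeffB_eq_tF[OF x] using higher_deriv_sF[OF x, of 0] by (simp add: sF_def \<tau>_def del: coeffB.simps)
  then show "disc_coeff n x = (deriv ^^ n) (sF 0 x) 0 / fact n" "disc_coeff (n + 2) x = (deriv ^^ n) (sF 2 x) 0 / (fact n * ((real n + 1) * (real n + 2)))"
    by (auto simp: disc_coeff_def mult_ac add_ac simp del: coeffB.simps)
qed

lemma F_sums:
  assumes x: "x \<in> \<Gamma>" and s: "s \<in> ball 0 1"
  shows "(\<lambda>n. disc_coeff n x * s ^ n) sums F (\<tau> s) x"
  using holomorphic_power_series[OF sF_holomorphic[OF x, of 0] s] by (simp add: disc_coeff_eq(1)[OF x] sF_def)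

text \<open>A uniform bound on the coefficients would give convergence only for \<open>Re u > \<omega>\<close>. The decay needed for
  all \<open>Re u > 0\<close> comes from the bound \<open>|1 - s|\<^bsup>-2-\<sigma>/\<omega>\<^esup>\<close> on the second derivative in \<open>s\<close>.\<close>

lemma disc_coeff_decay:
  assumes \<sigma>: "\<sigma> > 0"
  obtains C where "C > 0" "\<And>n x. x \<in> \<Gamma> \<Longrightarrow> n \<ge> 2 \<Longrightarrow> norm (disc_coeff n x) \<le> C * real n powr (\<sigma> / \<omega> - 1)"
proof -
  define r where "r = pi / (4 * \<omega>)"
  obtain K where K: "K > 0" "\<And>t x. t \<in> U_region (2 * r) \<Longrightarrow> x \<in> \<Gamma> \<Longrightarrow> norm (tF 2 t x) \<le> K * exp (\<sigma> * Re t)"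
    using tF_bound[OF \<sigma> half_strip(2,3)] unfolding r_def by blast
  have b: "norm (sF 2 x s) \<le> K / \<omega>\<^sup>2 * norm (1 - s) powr (- 2 - \<sigma> / \<omega>)" if x: "x \<in> \<Gamma>" and s: "s \<in> ball 0 1" for x s
  proof -
    note tf = \<tau>_facts[OF s]
    have nz: "norm (1 - s) > 0" using s by auto
    have "norm (sF 2 x s) = (inverse (norm (1 - s)))\<^sup>2 / \<omega>\<^sup>2 * norm (tF 2 (\<tau> s) x)"
      using \<omega>_pos by (simp add: sF_def tf(3) norm_mult norm_divide norm_power norm_inverse)
    also have "\<dots> \<le> (inverse (norm (1 - s)))\<^sup>2 / \<omega>\<^sup>2 * (K * norm (1 - s) powr (- (\<sigma> / \<omega>)))"
      using K(2)[OF tf(1)[folded r_def] x] by (intro mult_left_mono) (auto simp: tf(4))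
    also have "(inverse (norm (1 - s)))\<^sup>2 = norm (1 - s) powr (- 2)"
      using nz by (simp add: powr_minus powr_numeral power_inverse)
    also have "norm (1 - s) powr (- 2) / \<omega>\<^sup>2 * (K * norm (1 - s) powr (- (\<sigma> / \<omega>))) = K / \<omega>\<^sup>2 * (norm (1 - s) powr (- 2) * norm (1 - s) powr (- (\<sigma> / \<omega>)))"
      by (simp add: mult_ac)
    also have "norm (1 - s) powr (- 2) * norm (1 - s) powr (- (\<sigma> / \<omega>)) = norm (1 - s) powr (- 2 - \<sigma> / \<omega>)"
      by (simp add: powr_add[symmetric])
    finally show ?thesis .
  qed
  have "norm (disc_coeff n x) \<le> 24 * (K / \<omega>\<^sup>2) * real n powr (\<sigma> / \<omega> - 1)" if x: "x \<in> \<Gamma>" and n2: "n \<ge> 2" for n x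
  proof -
    obtain m where n: "n = m + 2" using n2 by (metis add.commute le_Suc_ex)
    have le: "norm ((deriv ^^ m) (sF 2 x) 0 / fact m) \<le> 12 * (K / \<omega>\<^sup>2) * (real m + 2) powr (1 + \<sigma> / \<omega>)"
      using K(1) \<sigma> \<omega>_pos by (intro taylor_coeff_bound_2[OF sF_holomorphic[OF x]] b[OF x]) auto
    have "norm (disc_coeff n x) = norm ((deriv ^^ m) (sF 2 x) 0 / fact m) / ((real m + 1) * (real m + 2))"
      unfolding n disc_coeff_eq(2)[OF x] by (simp add: norm_mult norm_divide del: of_real_add of_real_mult)
    also have "\<dots> \<le> 12 * (K / \<omega>\<^sup>2) * (real m + 2) powr (1 + \<sigma> / \<omega>) / ((real m + 1) * (real m + 2))"
      using le by (intro divide_right_mono) auto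
    \<comment> \<open>m + 1 \<ge> (m + 2) / 2 turns the denominator into a power of n = m + 2, at
      the cost of the factor 2 in 24 = 2 * 12.\<close>
    also have "\<dots> \<le> 12 * (K / \<omega>\<^sup>2) * (real m + 2) powr (1 + \<sigma> / \<omega>) / ((real m + 2) * (real m + 2) / 2)"
    proof (rule divide_left_mono)
      have "(real m + 2) * (real m + 2) \<le> (2 * (real m + 1)) * (real m + 2)" by (rule mult_right_mono) auto
      then show "(real m + 2) * (real m + 2) / 2 \<le> (real m + 1) * (real m + 2)" by simp
      show "0 < (real m + 1) * (real m + 2) * ((real m + 2) * (real m + 2) / 2)"
        by (intro mult_pos_pos divide_pos_pos) auto
    qed (use K(1) in simp)
    also have "\<dots> = 24 * (K / \<omega>\<^sup>2) * ((real m + 2) powr (1 + \<sigma> / \<omega>) / ((real m + 2) powr 2))"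
      by (simp add: powr_numeral power2_eq_square)
    also have "(real m + 2) powr (1 + \<sigma> / \<omega>) / ((real m + 2) powr 2) = real n powr (\<sigma> / \<omega> - 1)"
      unfolding powr_diff[symmetric] by (simp add: n add.commute)
    finally show ?thesis .
  qed
  moreover have "24 * (K / \<omega>\<^sup>2) > 0" using K(1) \<omega>_pos by simp
  ultimately show thesis using that by blast
qed

lemma disc_coeff_bound_of_F_bound:
  assumes x: "x \<in> \<Gamma>" and \<sigma>: "0 < \<sigma>" "\<sigma> < \<omega>" and K: "K \<ge> 0"
    and b: "\<And>s. s \<in> ball 0 1 \<Longrightarrow> norm (F (\<tau> s) x) \<le> K * exp (\<sigma> * Re (\<tau> s))"
  shows "norm (disc_coeff n x) \<le> K / 2 powr (\<sigma> / \<omega>) / (1 - \<sigma> / \<omega>)"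
  unfolding disc_coeff_eq(1)[OF x]
proof (rule taylor_coeff_bound[OF sF_holomorphic[OF x]])
  show "norm (sF 0 x s) \<le> K * norm (1 - s) powr (- (\<sigma> / \<omega>))" if "s \<in> ball 0 1" for s
    using b[OF that] by (simp add: sF_def \<tau>_facts(4)[OF that])
qed (use \<sigma> K \<omega>_pos in auto)

end

section \<open>The bound along the characteristics\<close>

text \<open>The upper limits s + n are in general not integers. The limit along them is obtained by
  sandwiching, between the integrals over [0, n] and over the whole half-line, for which
  \<open>f\<close> is nonnegative.\<close>

lemma integral_atLeast_shift:
  fixes f :: "real \<Rightarrow> real"
  assumes f: "f absolutely_integrable_on {0..}" and g: "(\<lambda>v. f (s + v)) absolutely_integrable_on {0..}"
    and s: "s \<ge> 0" and nonneg: "\<And>v. v \<ge> 0 \<Longrightarrow> f v \<ge> 0"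
  shows "integral {0..} (\<lambda>v. f (s + v)) = integral {0..} f - integral {0..s} f"
proof -
  have fi: "f integrable_on {0..}" using f by (rule set_lebesgue_integral_eq_integral(1))
  have fi': "f integrable_on {0..y}" for y
    by (intro set_lebesgue_integral_eq_integral(1) set_integrable_subset[OF f]) auto
  have eq: "integral {0..real n} (\<lambda>v. f (s + v)) = integral {0..s + real n} f - integral {0..s} f" for n
  proof -
    have "integral {0..real n} (\<lambda>v. f (s + v)) = integral {s..s + real n} f"
      using integral_shift_Icc_real[of 0 "real n" f s] by (simp add: o_def add.commute)
    moreover have "integral {0..s} f + integral {s..s + real n} f = integral {0..s + real n} f"
      using s fi' by (intro Henstock_Kurzweil_Integration.integral_combine) auto
    ultimately show ?thesis by simp
  qed
  have "(\<lambda>n. integral {0..s + real n} f) \<longlonglongrightarrow> integral {0..} f"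
  proof (rule tendsto_sandwich[OF _ _ integral_atLeastAtMost_tendsto[OF f] tendsto_const])
    show "\<forall>\<^sub>F n in sequentially. integral {0..real n} f \<le> integral {0..s + real n} f"
      using s fi' nonneg by (intro always_eventually allI integral_subset_le) auto
    show "\<forall>\<^sub>F n in sequentially. integral {0..s + real n} f \<le> integral {0..} f"
      using fi fi' nonneg by (intro always_eventually allI integral_subset_le) auto
  qed
  then have "(\<lambda>n. integral {0..s + real n} f - integral {0..s} f) \<longlonglongrightarrow> integral {0..} f - integral {0..s} f"
    by (intro tendsto_intros)
  then show ?thesis
    using integral_atLeastAtMost_tendsto[OF g] unfolding eq by (rule LIMSEQ_unique[rotated])
qed

lemma sgn_powr_mono:
  fixes u v \<rho> :: real
  assumes "u \<le> v" "\<rho> > 0"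
  shows "sgn u * \<bar>u\<bar> powr \<rho> \<le> sgn v * \<bar>v\<bar> powr \<rho>"
proof (cases "u \<ge> 0")
  case True
  then show ?thesis using assms powr_mono2[of \<rho> u v] by (auto simp: sgn_if)
next
  case False
  show ?thesis
  proof (cases "v \<ge> 0")
    case True
    then show ?thesis using False by (auto simp: sgn_if intro: order_trans[of _ 0])
  next
    case v: False
    then show ?thesis using False assms powr_mono2[of \<rho> "-v" "-u"] by (auto simp: sgn_if)
  qed
qed

context wkb_borel begin

text \<open>Along a ray -\<epsilon> Re \<xi> increases, and the weight with it. Hence values of
  \<open>F\<close> further along the ray may be estimated with the weight at its starting
  point.\<close>

lemma W_R_mono:
  assumes x: "x \<in> \<Gamma>" and s: "s \<ge> 0"
  shows "W x \<le> W (R x s)"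
proof -
  have W: "W y = max 1 (sgn (- \<epsilon> * Re (p y)) * \<bar>- \<epsilon> * Re (p y)\<bar> powr \<rho>)" for y
    using sign by (auto simp: weight_def sgn_minus)
  have "- \<epsilon> * Re (p x) \<le> - \<epsilon> * Re (p (R x s))"
  proof -
    have "- \<epsilon> * Re (p (R x s)) = - \<epsilon> * Re (p x) + (\<epsilon> * \<epsilon>) * s"
      unfolding R_props(4)[OF x s] by (simp add: algebra_simps)
    then show ?thesis using s \<epsilon>_square(2) by simp
  qed
  from sgn_powr_mono[OF this pos(2)] show ?thesis unfolding W by (intro max.mono order.refl)
qed

lemma W_pos: "W x > 0" using weight_ge_1[of p \<epsilon> \<rho> x] by linarith

text \<open>If \<open>\<phi>\<close> vanishes on \<open>G\<close>, then \<open>kern_bound\<close> is \<open>|\<psi>|\<close> on \<open>\<Gamma>\<close>, so that both cases of \<open>V_bound\<close> have the same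
  integrand and differ only in the factor \<open>\<kappa>\<close>.\<close>

definition \<kappa> :: real where "\<kappa> = (if \<forall>y\<in>G. \<phi> y = 0 then 1 else 6)"

lemma \<kappa>_pos: "\<kappa> > 0" by (simp add: \<kappa>_def)

definition V :: "real \<Rightarrow> 'a \<Rightarrow> real" where
  "V \<sigma> x = \<kappa> / \<sigma> * integral {0..} (\<lambda>s. kern_bound (R x s))"

lemma V_bound_eq_V:
  assumes x: "x \<in> \<Gamma>"
  shows "V_bound p G \<phi> \<psi> \<Gamma> \<epsilon> \<sigma> x = V \<sigma> x"
proof (cases "\<forall>y\<in>G. \<phi> y = 0")
  case True
  have "kern_bound y = norm (\<psi> y)" if y: "y \<in> \<Gamma>" for y
  proof -
    have yG: "y \<in> G" using y \<Gamma>_subset by blast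
    have "has_xi_derivative p \<phi> 0 y"
      unfolding has_xi_derivative_def
    proof (rule tendsto_eventually)
      show "\<forall>\<^sub>F z in at y. (\<phi> z - \<phi> y) / (p z - p y) = 0"
        using eventually_at_in_open'[OF \<Gamma>_subset(7) yG] by eventually_elim (use True yG in auto)
    qed
    then have "xi_deriv p \<phi> y = 0" by (rule xi_deriv_eqI[OF G yG])
    then show ?thesis using True yG sign by (auto simp: kern_bound_def norm_mult)
  qed
  then have "integral {0..} (\<lambda>s. kern_bound (R x s)) = integral {0..} (\<lambda>s. norm (\<psi> (R x s)))"
    using R_props(3)[OF x] by (intro integral_cong) auto
  then show ?thesis using True by (simp add: V_bound_def V_def \<kappa>_def path_integral_abs_def R_def)
next
  case False
  then show ?thesis unfolding V_bound_def V_def \<kappa>_def path_integral_abs_def R_def kern_bound_def by auto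
qed

text \<open>Relative to the majorant, the left side bounds the rate of change of \<open>F\<close>
  along a characteristic, with \<sigma> / \<kappa> coming from the integral term; the right side is
  half the rate of change of the majorant itself. The factor 1/2 makes the iteration contract. With
  \<kappa> = 6 there is room for |\<phi>| \<le> \<sigma> / 2 + 2 \<open>kern_bound\<close> /
  \<sigma>; if \<phi> vanishes, \<kappa> = 1 is enough.\<close>

lemma \<phi>_absorb:
  assumes \<sigma>: "\<sigma> > 0" and y: "y \<in> \<Gamma>"
  shows "norm (\<phi> y) + \<sigma> / \<kappa> \<le> 1/2 * (2 * \<sigma> + \<kappa> / \<sigma> * kern_bound y)"
proof (cases "\<forall>y\<in>G. \<phi> y = 0")
  case True
  then have "\<phi> y = 0" using y \<Gamma>_subset by blast
  then show ?thesis using True kern_bound_nonneg[of y] \<sigma> by (simp add: \<kappa>_def)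
next
  case False
  have "0 \<le> (norm (\<phi> y) - \<sigma>)\<^sup>2" by simp
  then have "2 * \<sigma> * norm (\<phi> y) \<le> \<sigma>\<^sup>2 + (norm (\<phi> y))\<^sup>2" by (simp add: power2_diff algebra_simps)
  moreover have "(norm (\<phi> y))\<^sup>2 \<le> 4 * kern_bound y"
    by (simp add: kern_bound_def norm_power)
  ultimately have "2 * \<sigma> * norm (\<phi> y) \<le> \<sigma>\<^sup>2 + 4 * kern_bound y" by linarith
  then have "norm (\<phi> y) \<le> \<sigma> / 2 + 2 * kern_bound y / \<sigma>"
    using \<sigma> by (simp add: field_simps power2_eq_square)
  moreover have "2 * kern_bound y / \<sigma> \<le> 3 * kern_bound y / \<sigma>" using kern_bound_nonneg[of y] \<sigma> by (intro divide_right_mono) auto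
  ultimately have "norm (\<phi> y) + \<sigma> / 6 \<le> \<sigma> + 3 * kern_bound y / \<sigma>" using \<sigma> by linarith
  moreover have "\<kappa> = 6" unfolding \<kappa>_def by (simp only: if_not_P[OF False])
  ultimately show ?thesis by simp
qed

lemma V_nonneg:
  assumes "\<sigma> > 0" "x \<in> \<Gamma>"
  shows "V \<sigma> x \<ge> 0"
proof -
  have "0 \<le> integral {0..} (\<lambda>s. kern_bound (R x s))"
    by (intro Henstock_Kurzweil_Integration.integral_nonneg kern_bound_nonneg
        set_lebesgue_integral_eq_integral(1)[OF kern_bound_integrable[OF assms(2)]])
  then show ?thesis using assms(1) \<kappa>_pos by (simp add: V_def)
qed

lemma V_R:
  assumes x: "x \<in> \<Gamma>" and s: "s \<ge> 0"
  shows "V \<sigma> (R x s) = V \<sigma> x - \<kappa> / \<sigma> * integral {0..s} (\<lambda>v. kern_bound (R x v))"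
proof -
  have "integral {0..} (\<lambda>v. kern_bound (R (R x s) v)) = integral {0..} (\<lambda>v. kern_bound (R x (s + v)))"
    using R_R[OF x s] by (intro integral_cong) auto
  also have "\<dots> = integral {0..} (\<lambda>v. kern_bound (R x v)) - integral {0..s} (\<lambda>v. kern_bound (R x v))"
  proof (rule integral_atLeast_shift[OF kern_bound_integrable[OF x] _ s])
    show "(\<lambda>v. kern_bound (R x (s + v))) absolutely_integrable_on {0..}"
      using kern_bound_integrable[OF R_props(3)[OF x s]] R_R[OF x s]
      by (elim absolutely_integrable_spike[OF _ negligible_empty]) auto
  qed (rule kern_bound_nonneg)
  finally show ?thesis by (simp add: V_def right_diff_distrib)
qed

lemma V_R_deriv:
  assumes x: "x \<in> \<Gamma>" and s: "s > 0"
  shows "((\<lambda>s. V \<sigma> (R x s)) has_real_derivative (- (\<kappa> / \<sigma> * kern_bound (R x s)))) (at s)"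
proof -
  have c: "continuous_on {0..s + 1} (\<lambda>v. kern_bound (R x v))"
    by (rule continuous_on_subset[OF continuous_on_R[OF continuous_kern_bound x]]) auto
  have "((\<lambda>s. integral {0..s} (\<lambda>v. kern_bound (R x v))) has_real_derivative kern_bound (R x s)) (at s within {0..s + 1})"
    by (rule integral_has_real_derivative[OF c]) (use s in auto)
  then have d: "((\<lambda>s. integral {0..s} (\<lambda>v. kern_bound (R x v))) has_real_derivative kern_bound (R x s)) (at s)"
    using s by (subst (asm) at_within_interior) auto
  have "((\<lambda>s. V \<sigma> x - \<kappa> / \<sigma> * integral {0..s} (\<lambda>v. kern_bound (R x v))) has_real_derivative (0 - \<kappa> / \<sigma> * kern_bound (R x s))) (at s)"
    by (intro DERIV_diff DERIV_const DERIV_cmult d)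
  moreover have ev: "\<forall>\<^sub>F s in nhds s. V \<sigma> (R x s) = V \<sigma> x - \<kappa> / \<sigma> * integral {0..s} (\<lambda>v. kern_bound (R x v))"
    using eventually_nhds_in_open[of "{0<..}" s] s
    by (auto elim!: eventually_mono simp: V_R[OF x])
  ultimately show ?thesis using DERIV_cong_ev[OF refl ev refl] by simp
qed

lemma continuous_V_R:
  assumes x: "x \<in> \<Gamma>"
  shows "continuous_on {0..} (\<lambda>s. V \<sigma> (R x s))"
proof -
  have "continuous_on {0..b} (\<lambda>s. V \<sigma> (R x s))" for b
  proof -
    have "continuous_on {0..b} (\<lambda>v. kern_bound (R x v))"
      by (rule continuous_on_subset[OF continuous_on_R[OF continuous_kern_bound x]]) auto
    then have "continuous_on {0..b} (\<lambda>s. V \<sigma> x - \<kappa> / \<sigma> * integral {0..s} (\<lambda>v. kern_bound (R x v)))"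
      by (intro continuous_intros indefinite_integral_continuous_1 integrable_continuous_real)
    then show ?thesis by (rule continuous_on_eq) (simp add: V_R[OF x])
  qed
  then show ?thesis
    unfolding continuous_on_eq_continuous_within
  proof (intro ballI)
    fix s :: real assume c: "\<And>b. \<forall>s\<in>{0..b}. continuous (at s within {0..b}) (\<lambda>s. V \<sigma> (R x s))" and s: "s \<in> {0..}"
    have "at s within {0..s + 1} = at s within {0..}"
      by (rule at_within_nhd[of _ "{..<s + 1}"]) (use s in auto)
    then show "continuous (at s within {0..}) (\<lambda>s. V \<sigma> (R x s))"
      using bspec[OF c, of s "s + 1"] s by simp
  qed
qed

text \<open>The integrand is the derivative of -(\<sigma> / \<kappa>) exp V along the ray. Dropping
  the contribution of the far end leaves exp V at the starting point.\<close>

lemma kern_bound_exp_V_integral: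
  assumes \<sigma>: "\<sigma> > 0" and y: "y \<in> \<Gamma>"
  shows "(\<lambda>v. kern_bound (R y v) * exp (V \<sigma> (R y v))) absolutely_integrable_on {0..}"
    and "integral {0..} (\<lambda>v. kern_bound (R y v) * exp (V \<sigma> (R y v))) \<le> \<sigma> / \<kappa> * exp (V \<sigma> y)"
proof -
  have km: "(\<lambda>v. kern_bound (R y v)) integrable_on {0..}"
    using kern_bound_integrable[OF y] by (rule set_lebesgue_integral_eq_integral(1))
  have cont: "continuous_on {0..} (\<lambda>v. kern_bound (R y v) * exp (V \<sigma> (R y v)))"
    by (intro continuous_intros continuous_on_R[OF continuous_kern_bound y] continuous_V_R y)
  show ai: "(\<lambda>v. kern_bound (R y v) * exp (V \<sigma> (R y v))) absolutely_integrable_on {0..}"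
  proof (rule absolutely_integrable_continuous_bound[OF cont])
    show "(\<lambda>v. kern_bound (R y v) * exp (V \<sigma> y)) integrable_on {0..}"
      using km by (rule integrable_on_mult_left)
    fix v :: real assume v: "v \<ge> 0"
    have "0 \<le> integral {0..v} (\<lambda>v. kern_bound (R y v))"
      by (rule Henstock_Kurzweil_Integration.integral_nonneg)
        (auto simp: kern_bound_nonneg intro!: integrable_continuous_real continuous_on_subset[OF continuous_on_R[OF continuous_kern_bound y]])
    then have "V \<sigma> (R y v) \<le> V \<sigma> y" using \<sigma> \<kappa>_pos by (simp add: V_R[OF y v])
    then show "norm (kern_bound (R y v) * exp (V \<sigma> (R y v))) \<le> kern_bound (R y v) * exp (V \<sigma> y)"
      using kern_bound_nonneg by (auto simp: abs_mult intro!: mult_left_mono)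
  qed
  have "integral {0..real n} (\<lambda>v. kern_bound (R y v) * exp (V \<sigma> (R y v))) \<le> \<sigma> / \<kappa> * exp (V \<sigma> y)" for n
  proof -
    define g where "g v = - (\<sigma> / \<kappa>) * exp (V \<sigma> (R y v))" for v
    have "((\<lambda>v. kern_bound (R y v) * exp (V \<sigma> (R y v))) has_integral (g (real n) - g 0)) {0..real n}"
    proof (rule fundamental_theorem_of_calculus_interior)
      show "continuous_on {0..real n} g"
        unfolding g_def by (intro continuous_intros continuous_on_subset[OF continuous_V_R[OF y]]) auto
      fix v assume v: "v \<in> {0<..<real n}"
      have "((\<lambda>v. exp (V \<sigma> (R y v))) has_real_derivative exp (V \<sigma> (R y v)) * (- (\<kappa> / \<sigma> * kern_bound (R y v)))) (at v)"
        by (rule DERIV_fun_exp[OF V_R_deriv[OF y]]) (use v in auto)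
      then have "(g has_real_derivative - (\<sigma> / \<kappa>) * (exp (V \<sigma> (R y v)) * (- (\<kappa> / \<sigma> * kern_bound (R y v))))) (at v)"
        unfolding g_def by (rule DERIV_cmult)
      also have "- (\<sigma> / \<kappa>) * (exp (V \<sigma> (R y v)) * (- (\<kappa> / \<sigma> * kern_bound (R y v)))) = kern_bound (R y v) * exp (V \<sigma> (R y v))"
        using \<sigma> \<kappa>_pos by simp
      finally show "(g has_vector_derivative kern_bound (R y v) * exp (V \<sigma> (R y v))) (at v)"
        by (simp add: has_real_derivative_iff_has_vector_derivative)
    qed simp
    then have "integral {0..real n} (\<lambda>v. kern_bound (R y v) * exp (V \<sigma> (R y v))) = g (real n) - g 0"
      by (rule integral_unique)
    also have "\<dots> \<le> \<sigma> / \<kappa> * exp (V \<sigma> y)"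
      using \<sigma> \<kappa>_pos R_props(2)[OF y] by (simp add: g_def)
    finally show ?thesis .
  qed
  then show "integral {0..} (\<lambda>v. kern_bound (R y v) * exp (V \<sigma> (R y v))) \<le> \<sigma> / \<kappa> * exp (V \<sigma> y)"
    by (intro LIMSEQ_le_const2[OF integral_atLeastAtMost_tendsto[OF ai]]) auto
qed

text \<open>Differentiation along (t - 2 s, \<xi> - \<epsilon> s) gives -2 dF/dt - \<epsilon>
  dF/d\<xi>, and inserting the equation for dF/dt cancels the \<xi>-derivative.\<close>

lemma F_along_characteristic:
  assumes x: "x \<in> \<Gamma>" and s: "s > 0" and t: "t - 2 * of_real s \<in> T"
  shows "((\<lambda>s. F (t - 2 * of_real s) (R x s)) has_vector_derivative
     (\<phi> (R x s) * F (t - 2 * of_real s) (R x s)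
      + integral {0..} (\<lambda>v. ker (R (R x s) v) * F (t - 2 * of_real s) (R (R x s) v)))) (at s)"
proof -
  define t0 where "t0 = t - 2 * of_real s"
  have t0: "t0 \<in> T" using t by (simp add: t0_def)
  have y: "R x s \<in> \<Gamma>" using R_props(3)[OF x] s by simp
  have yG: "R x s \<in> G" using y \<Gamma>_subset by blast
  obtain \<delta> where \<delta>: "\<delta> > 0" "ball t0 \<delta> \<subseteq> T" using open_T(1) t0 by (meson openE)
  let ?D = "xi_deriv p (F t0) (R x s)"
  let ?Ft = "deriv (\<lambda>t. F t (R x s)) t0"
  obtain D where D: "has_xi_derivative p (F t0) D (R x s)"
    using admissibleD(5)[OF F_admissible t0] y by (auto simp: xi_holomorphic_on_def)
  then have "has_xi_derivative p (F t0) ?D (R x s)" using xi_deriv_eqI[OF G yG D] by simp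
  then have fx: "((\<lambda>s. F t0 (R x s)) has_derivative (\<lambda>h. h *\<^sub>R (- of_real \<epsilon> * ?D))) (at s within {0..})"
    using has_xi_derivative_along_ray[OF horizontal_ray_R[OF x] \<epsilon>_square(3), of s] s
    by (simp add: has_vector_derivative_def)
  have cF: "continuous_on (T \<times> \<Gamma>) (\<lambda>(t, x). deriv (\<lambda>t. F t x) t)"
    by (rule admissibleD(4)[OF admissible_deriv[OF F_admissible open_T(1)]])
  \<comment> \<open>Joint differentiability follows from the two partial derivatives because the one
    in \<open>t\<close> is continuous. The parameter is confined to the half-line at first; s > 0
    makes the point interior.\<close>
  have "((\<lambda>(s, t). F t (R x s)) has_derivative
      (\<lambda>(h, k). h *\<^sub>R (- of_real \<epsilon> * ?D) + blinfun_mult_right ?Ft k)) (at (s, t0) within {0..} \<times> ball t0 \<delta>)"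
  proof (rule has_derivative_partialsI[where fy = "\<lambda>s t. blinfun_mult_right (deriv (\<lambda>t. F t (R x s)) t)"])
    show "((\<lambda>s. F t0 (R x s)) has_derivative (\<lambda>h. h *\<^sub>R (- of_real \<epsilon> * ?D))) (at s within {0..})" by (rule fx)
    fix s' :: real and t' assume "s' \<in> {0..}" "t' \<in> ball t0 \<delta>"
    then have "((\<lambda>t. F t (R x s')) has_field_derivative deriv (\<lambda>t. F t (R x s')) t') (at t')"
      using \<delta>(2) R_props(3)[OF x] by (intro holomorphic_derivI[OF admissibleD(2)[OF F_admissible] open_T(1)]) auto
    then show "((\<lambda>t. F t (R x s')) has_derivative blinfun_apply (blinfun_mult_right (deriv (\<lambda>t. F t (R x s')) t'))) (at t' within ball t0 \<delta>)"
      by (simp add: has_field_derivative_def has_derivative_at_withinI)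
  next
    have "continuous_on ({0..} \<times> ball t0 \<delta>) (\<lambda>q. (\<lambda>(t, x). deriv (\<lambda>t. F t x) t) (snd q, R x (fst q)))"
    proof (rule continuous_on_compose2[OF cF])
      show "continuous_on ({0..} \<times> ball t0 \<delta>) (\<lambda>q. (snd q, R x (fst q)))"
        by (intro continuous_intros continuous_on_compose2[OF R_props(1)[OF x]]) auto
    qed (use \<delta>(2) R_props(3)[OF x] in auto)
    then have "continuous_on ({0..} \<times> ball t0 \<delta>) (\<lambda>q. blinfun_mult_right (deriv (\<lambda>t. F t (R x (fst q))) (snd q)))"
      by (intro bounded_linear.continuous_on[OF bounded_linear_blinfun_mult_right]) simp
    then show "continuous (at (s, t0) within {0..} \<times> ball t0 \<delta>) (\<lambda>(s, t). blinfun_mult_right (deriv (\<lambda>t. F t (R x s)) t))"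
      using s \<delta>(1) unfolding continuous_on_eq_continuous_within by (auto simp: split_def)
  qed (use \<delta> in auto)
  moreover have "at (s, t0) within {0..} \<times> ball t0 \<delta> = at (s, t0)"
    using s \<delta>(1) by (intro at_within_interior) (auto simp: interior_Times interior_real_atLeast)
  ultimately have joint: "((\<lambda>(s, t). F t (R x s)) has_derivative
      (\<lambda>(h, k). h *\<^sub>R (- of_real \<epsilon> * ?D) + blinfun_mult_right ?Ft k)) (at (s, t0))" by simp
  have line: "((\<lambda>s. (s, t - 2 * of_real s)) has_derivative (\<lambda>h. (h, - 2 * of_real h))) (at s)"
    by (auto intro!: derivative_eq_intros)
  have "((\<lambda>s. F (t - 2 * of_real s) (R x s)) has_derivative (\<lambda>h. h *\<^sub>R (- of_real \<epsilon> * ?D) + ?Ft * (- 2 * of_real h))) (at s)"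
    using has_derivative_compose[OF line joint[unfolded t0_def]]
    unfolding t0_def[symmetric] prod.case blinfun_mult_right.rep_eq .
  then have hv: "((\<lambda>s. F (t - 2 * of_real s) (R x s)) has_vector_derivative (- of_real \<epsilon> * ?D - 2 * ?Ft)) (at s)"
    unfolding has_vector_derivative_def
    by (rule has_derivative_eq_rhs) (auto simp: fun_eq_iff scaleR_conv_of_real algebra_simps)
  have "- of_real \<epsilon> * ?D - 2 * ?Ft = \<phi> (R x s) * F t0 (R x s)
      + integral {0..} (\<lambda>v. ker (R (R x s) v) * F t0 (R (R x s) v))"
    unfolding borel_pde[OF t0 y] Lop_altdef by (simp add: algebra_simps)
  then show ?thesis using hv by (simp add: t0_def)
qed

section \<open>From the circle to the strip\<close>

abbreviation "r0 \<equiv> pi / (4 * \<omega>)"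

text \<open>The supremum in \<open>C_bound\<close> without its factor 2; the estimates of
  \<open>F\<close> itself involve just this supremum.\<close>

definition half_C :: real where "half_C = C_bound p \<Gamma> \<epsilon> \<rho> F r0 / 2"

text \<open>A supremum bounds its members only for a set that is bounded above. The circle |t| = 2
  \<open>r0\<close> is not contained in U(2 \<open>r0\<close>), so boundedness is taken from the a
  priori bound on U(2 \<open>r1\<close>), with \<open>r1\<close> between \<open>r0\<close> and
  \<open>d\<close>.\<close>

lemma F_circle_bound:
  assumes t: "norm t = 2 * r0" and x: "x \<in> \<Gamma>"
  shows "W x * norm (F t x) \<le> half_C"
proof -
  let ?S = "{t::complex. norm t = 2 * r0} \<times> \<Gamma>"
  define r1 where "r1 = (r0 + d) / 2"
  have r1: "0 < r1" "r1 < d" "r0 < r1" using half_strip(2,3) unfolding r1_def by auto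
  obtain K where K: "K > 0" "\<And>t x. t \<in> U_region (2 * r1) \<Longrightarrow> x \<in> \<Gamma> \<Longrightarrow> norm (F t x) \<le> K * exp (1 * Re t) / W x"
    using F_bound[OF zero_less_one r1(1,2)] by blast
  have b: "W x * norm (F t x) \<le> K * exp (2 * r0)" if "norm t = 2 * r0" "x \<in> \<Gamma>" for t x
  proof -
    have "t \<in> U_region (2 * r1)" using that(1) r1(3) by (simp add: U_region_def)
    then have "norm (F t x) \<le> K * exp (1 * Re t) / W x" using that(2) by (rule K(2))
    then have "W x * norm (F t x) \<le> K * exp (Re t)" using W_pos[of x] by (simp add: field_simps)
    also have "Re t \<le> 2 * r0" using complex_Re_le_cmod[of t] that(1) by linarith
    then have "K * exp (Re t) \<le> K * exp (2 * r0)" using K(1) by simp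
    finally show ?thesis .
  qed
  have "half_C = (SUP q\<in>?S. case q of (t, x) \<Rightarrow> W x * norm (F t x))"
    by (simp add: half_C_def C_bound_def)
  moreover have "bdd_above ((\<lambda>q. case q of (t, x) \<Rightarrow> W x * norm (F t x)) ` ?S)"
    using b by (intro bdd_aboveI2[where M = "K * exp (2 * r0)"]) auto
  ultimately show ?thesis
    using cSUP_upper[of "(t, x)" ?S "\<lambda>q. case q of (t, x) \<Rightarrow> W x * norm (F t x)"] t x by auto
qed

lemma F_disc_bound:
  assumes t: "norm t \<le> 2 * r0" and x: "x \<in> \<Gamma>"
  shows "norm (F t x) \<le> half_C / W x"
proof (rule maximum_modulus_frontier[of "\<lambda>t. F t x" "cball 0 (2 * r0)"])
  have "cball 0 (2 * r0) \<subseteq> T" using half_strip(3) by (auto simp: U_region_def)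
  then have h: "(\<lambda>t. F t x) holomorphic_on cball 0 (2 * r0)"
    by (rule holomorphic_on_subset[OF admissibleD(2)[OF F_admissible x]])
  then show "(\<lambda>t. F t x) holomorphic_on interior (cball 0 (2 * r0))"
    using interior_subset holomorphic_on_subset by blast
  show "continuous_on (closure (cball 0 (2 * r0))) (\<lambda>t. F t x)"
    using holomorphic_on_imp_continuous_on[OF h] by simp
  show "norm (F z x) \<le> half_C / W x" if "z \<in> frontier (cball 0 (2 * r0))" for z
  proof -
    have "norm z = 2 * r0" using that half_strip(2) by (simp add: frontier_cball)
    from F_circle_bound[OF this x] show ?thesis using W_pos[of x] by (simp add: field_simps)
  qed
qed (use t in auto)

lemma half_C_nonneg: "half_C \<ge> 0"
proof -
  obtain x where x: "x \<in> \<Gamma>" using \<Gamma>_subset(2) by blast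
  have "0 \<le> norm (F 0 x)" by simp
  also have "\<dots> \<le> half_C / W x" by (rule F_disc_bound[OF _ x]) (use half_strip(2) in simp)
  finally show ?thesis using W_pos[of x] by (auto simp: zero_le_divide_iff)
qed

text \<open>Restricted to Re t \<ge> 0, where the product of the two exponentials is at least 1; the
  rest of the region lies in the disc |t| \<le> 2 \<open>r0\<close>, where the maximum principle
  applies.\<close>

definition strip_bound :: "real \<Rightarrow> real \<Rightarrow> bool" where
  "strip_bound \<sigma> q \<longleftrightarrow> (\<forall>t x. Re t \<ge> 0 \<longrightarrow> t \<in> U_region (2 * r0) \<longrightarrow> x \<in> \<Gamma> \<longrightarrow>
     norm (F t x) \<le> q * (exp (\<sigma> * Re t) * exp (V \<sigma> x)) / W x)"

text \<open>By the a priori bound of the Borel transform, \<open>strip_bound \<sigma> q\<close> holds for some \<open>q\<close>; each step halves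
  \<open>q\<close> until \<open>half_C\<close> takes over.\<close>

lemma strip_bound_step:
  assumes \<sigma>: "\<sigma> > 0" and q: "strip_bound \<sigma> q" "q \<ge> 0"
  shows "strip_bound \<sigma> (max half_C (q / 2))"
  unfolding strip_bound_def
proof (intro allI impI)
  fix t x assume t: "Re t \<ge> 0" "t \<in> U_region (2 * r0)" and x: "x \<in> \<Gamma>"
  let ?E = "exp (\<sigma> * Re t) * exp (V \<sigma> x)"
  have E1: "?E \<ge> 1"
  proof -
    have "0 \<le> \<sigma> * Re t + V \<sigma> x" using \<sigma> t(1) V_nonneg[OF \<sigma> x] by simp
    then show ?thesis by (simp add: exp_add[symmetric])
  qed
  \<comment> \<open>As E \<ge> 1, the sum of \<open>half_C\<close> and q / 2 times E - 1 is at most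
    the larger of the two constants times 1 + (E - 1).\<close>
  have suff: "norm (F t x) \<le> (half_C + q / 2 * (?E - 1)) / W x \<Longrightarrow> norm (F t x) \<le> max half_C (q / 2) * ?E / W x"
  proof (erule order_trans, rule divide_right_mono)
    have "half_C + q / 2 * (?E - 1) \<le> max half_C (q / 2) + max half_C (q / 2) * (?E - 1)"
      using E1 by (intro add_mono mult_right_mono) auto
    then show "half_C + q / 2 * (?E - 1) \<le> max half_C (q / 2) * ?E" by (simp add: algebra_simps)
  qed (use W_pos[of x] in simp)
  show "norm (F t x) \<le> max half_C (q / 2) * ?E / W x"
  proof (cases "norm t \<le> 2 * r0")
    case True
    have "half_C / W x \<le> (half_C + q / 2 * (?E - 1)) / W x"
      using E1 q(2) W_pos[of x] by (intro divide_right_mono) auto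
    then show ?thesis using F_disc_bound[OF True x] by (intro suff) linarith
  next
    case False
    then have im: "\<bar>Im t\<bar> < 2 * r0" using t(2) by (auto simp: U_region_def)
    \<comment> \<open>The characteristic through \<open>t\<close> keeps Im t; \<open>a\<close> is
      the real part at which it meets the circle |t| = 2 \<open>r0\<close>, and \<open>s1\<close> is
      the parameter of that point.\<close>
    define a where "a = sqrt ((2 * r0)\<^sup>2 - (Im t)\<^sup>2)"
    have pos: "(2 * r0)\<^sup>2 - (Im t)\<^sup>2 > 0"
      using im power_strict_mono[OF im, of 2] by simp
    have a: "a > 0" "a\<^sup>2 = (2 * r0)\<^sup>2 - (Im t)\<^sup>2" using pos by (auto simp: a_def)
    have "(2 * r0)\<^sup>2 < (norm t)\<^sup>2" using False half_strip(2) by (intro power_strict_mono) auto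
    then have "a\<^sup>2 < (Re t)\<^sup>2" using a(2) by (simp add: cmod_power2)
    then have aRe: "a < Re t" using t(1) by (rule power2_less_imp_less)
    define s1 where "s1 = (Re t - a) / 2"
    have s1: "s1 > 0" using aRe by (simp add: s1_def)
    have norm_t0: "norm (t - 2 * of_real s1) = 2 * r0"
    proof -
      have "Re (t - 2 * of_real s1) = a" by (simp add: s1_def diff_divide_distrib)
      then have "(norm (t - 2 * of_real s1))\<^sup>2 = a\<^sup>2 + (Im t)\<^sup>2" unfolding cmod_power2 by simp
      also have "\<dots> = (2 * r0)\<^sup>2" using a(2) by simp
      finally show ?thesis using half_strip(2) by (simp add: power2_eq_iff_nonneg)
    qed
    have ts: "t - 2 * of_real s \<in> U_region (2 * r0)" "Re (t - 2 * of_real s) \<ge> a" if "s \<le> s1" for s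
      using that a(1) im by (auto simp: U_region_def s1_def)
    have tsT: "t - 2 * of_real s \<in> T" if "s \<le> s1" for s
      using ts(1)[OF that] U_region_mono[of "2 * r0" "2 * d"] half_strip(3) by auto
    define e where "e s = exp (\<sigma> * (Re t - 2 * s)) * exp (V \<sigma> (R x s))" for s
    define y where "y s = F (t - 2 * of_real s) (R x s)" for s
    define y' where "y' s = \<phi> (R x s) * F (t - 2 * of_real s) (R x s)
      + integral {0..} (\<lambda>v. ker (R (R x s) v) * F (t - 2 * of_real s) (R (R x s) v))" for s
    \<comment> \<open>A primitive of the bound for |y'|: half the rate at which \<open>e\<close>
      decreases dominates the right side of the equation.\<close>
    define h where "h s = - (q / W x) * (1/2) * e s" for s
    have de: "(e has_real_derivative e s * (- (2 * \<sigma> + \<kappa> / \<sigma> * kern_bound (R x s)))) (at s)" if s: "s > 0" for s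
    proof -
      have d1: "((\<lambda>s. exp (\<sigma> * (Re t - 2 * s))) has_real_derivative exp (\<sigma> * (Re t - 2 * s)) * (- (2 * \<sigma>))) (at s)"
        by (auto intro!: derivative_eq_intros)
      have "(e has_real_derivative exp (\<sigma> * (Re t - 2 * s)) * (- (2 * \<sigma>)) * exp (V \<sigma> (R x s))
         + exp (V \<sigma> (R x s)) * (- (\<kappa> / \<sigma> * kern_bound (R x s))) * exp (\<sigma> * (Re t - 2 * s))) (at s)"
        unfolding e_def by (intro DERIV_mult d1 DERIV_fun_exp V_R_deriv x s)
      then show ?thesis by (simp add: e_def algebra_simps)
    qed
    have ce: "continuous_on {0..s1} e"
      unfolding e_def by (intro continuous_intros continuous_on_subset[OF continuous_V_R[OF x]]) auto
    have cy: "continuous_on {0..s1} y"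
    proof -
      have "continuous_on {0..s1} (\<lambda>s. (\<lambda>(t, x). F t x) (t - 2 * of_real s, R x s))"
        by (rule continuous_on_compose2[OF admissibleD(4)[OF F_admissible]])
          (use tsT R_props(3)[OF x] in \<open>auto intro!: continuous_intros continuous_on_subset[OF R_props(1)[OF x]]\<close>)
      then show ?thesis by (simp add: y_def[abs_def])
    qed
    have "norm (y s1 - y 0) \<le> h s1 - h 0"
    proof (rule differentiable_bound_general[OF s1 cy])
      show "continuous_on {0..s1} h" unfolding h_def by (intro continuous_intros ce)
      show "(y has_vector_derivative y' s) (at s)" if "0 < s" "s < s1" for s
        unfolding y_def[abs_def] y'_def using that by (intro F_along_characteristic[OF x] tsT) auto
      show "(h has_vector_derivative (- (q / W x) * (1/2) * (e s * (- (2 * \<sigma> + \<kappa> / \<sigma> * kern_bound (R x s)))))) (at s)"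
        if "0 < s" "s < s1" for s
        unfolding h_def[abs_def] has_real_derivative_iff_has_vector_derivative[symmetric]
        using that by (intro DERIV_cmult de)
      show "norm (y' s) \<le> - (q / W x) * (1/2) * (e s * (- (2 * \<sigma> + \<kappa> / \<sigma> * kern_bound (R x s))))"
        if s: "0 < s" "s < s1" for s
      proof -
        let ?t = "t - 2 * of_real s" and ?z = "R x s"
        have z: "?z \<in> \<Gamma>" using R_props(3)[OF x] s by simp
        have t': "?t \<in> U_region (2 * r0)" "Re ?t \<ge> 0" "?t \<in> T" using ts[of s] tsT[of s] a(1) s by auto
        \<comment> \<open>The assumed bound with constant \<open>q\<close>, its weight frozen at
          \<open>x\<close>, so that \<open>W x\<close> can be taken out of the integral.\<close>
        have Fb: "norm (F ?t w) \<le> q * (exp (\<sigma> * Re ?t) * exp (V \<sigma> w)) / W x" if w: "w \<in> \<Gamma>" "W x \<le> W w" for w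
        proof -
          have "norm (F ?t w) \<le> q * (exp (\<sigma> * Re ?t) * exp (V \<sigma> w)) / W w"
            by (rule q(1)[unfolded strip_bound_def, rule_format, OF t'(2,1) w(1)])
          also have "\<dots> \<le> q * (exp (\<sigma> * Re ?t) * exp (V \<sigma> w)) / W x"
            using w(2) q(2) W_pos by (intro divide_left_mono mult_pos_pos) auto
          finally show ?thesis .
        qed
        have Ret: "exp (\<sigma> * Re ?t) * exp (V \<sigma> ?z) = e s" by (simp add: e_def)
        have n1: "norm (\<phi> ?z * F ?t ?z) \<le> q / W x * e s * norm (\<phi> ?z)"
          using mult_left_mono[OF Fb[OF z W_R_mono[OF x]], of "norm (\<phi> ?z)"] s unfolding Ret
          by (simp add: norm_mult mult_ac)
        obtain M where M: "\<And>w. w \<in> \<Gamma> \<Longrightarrow> norm (F ?t w) \<le> M" using admissibleD(3)[OF F_admissible t'(3)] by blast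
        let ?I = "\<lambda>v. kern_bound (R ?z v) * exp (V \<sigma> (R ?z v))"
        have "norm (integral {0..} (\<lambda>v. ker (R ?z v) * F ?t (R ?z v)))
           \<le> integral {0..} (\<lambda>v. q / W x * exp (\<sigma> * Re ?t) * ?I v)"
        proof (rule integral_norm_bound_integral)
          show "(\<lambda>v. ker (R ?z v) * F ?t (R ?z v)) integrable_on {0..}"
            by (rule set_lebesgue_integral_eq_integral(1)[OF kern_mult_integrable[OF z admissibleD(1)[OF F_admissible t'(3)] M]])
          show "(\<lambda>v. q / W x * exp (\<sigma> * Re ?t) * ?I v) integrable_on {0..}"
            by (intro integrable_on_mult_right set_lebesgue_integral_eq_integral(1)[OF kern_bound_exp_V_integral(1)[OF \<sigma> z]])
          fix v :: real assume "v \<in> {0..}"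
          then have v: "v \<ge> 0" by simp
          have "norm (F ?t (R ?z v)) \<le> q * (exp (\<sigma> * Re ?t) * exp (V \<sigma> (R ?z v))) / W x"
            using W_R_mono[OF x, of s] W_R_mono[OF z v] s by (intro Fb R_props(3)[OF z v]) auto
          then have "norm (ker (R ?z v)) * norm (F ?t (R ?z v)) \<le> kern_bound (R ?z v) * (q * (exp (\<sigma> * Re ?t) * exp (V \<sigma> (R ?z v))) / W x)"
            by (intro mult_mono norm_kern_le kern_bound_nonneg) auto
          then show "norm (ker (R ?z v) * F ?t (R ?z v)) \<le> q / W x * exp (\<sigma> * Re ?t) * ?I v"
            by (simp add: norm_mult mult_ac)
        qed
        also have "\<dots> = q / W x * exp (\<sigma> * Re ?t) * integral {0..} ?I" by simp
        also have "\<dots> \<le> q / W x * exp (\<sigma> * Re ?t) * (\<sigma> / \<kappa> * exp (V \<sigma> ?z))"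
          using q(2) W_pos[of x] by (intro mult_left_mono kern_bound_exp_V_integral(2)[OF \<sigma> z]) auto
        also have "\<dots> = q / W x * e s * (\<sigma> / \<kappa>)" unfolding Ret[symmetric] by (simp add: mult_ac)
        finally have n2: "norm (integral {0..} (\<lambda>v. ker (R ?z v) * F ?t (R ?z v))) \<le> q / W x * e s * (\<sigma> / \<kappa>)" .
        have "norm (y' s) \<le> q / W x * e s * norm (\<phi> ?z) + q / W x * e s * (\<sigma> / \<kappa>)"
          unfolding y'_def by (rule order_trans[OF norm_triangle_ineq add_mono[OF n1 n2]])
        also have "\<dots> = q / W x * e s * (norm (\<phi> ?z) + \<sigma> / \<kappa>)" by (simp only: distrib_left)
        also have "\<dots> \<le> q / W x * e s * (1/2 * (2 * \<sigma> + \<kappa> / \<sigma> * kern_bound ?z))"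
          using q(2) W_pos[of x] by (intro mult_left_mono \<phi>_absorb[OF \<sigma> z]) (auto simp: e_def)
        finally show ?thesis by (simp only: mult_minus_left mult_minus_right minus_minus mult_ac)
      qed
    qed
    moreover have y0: "y 0 = F t x" by (simp add: y_def R_props(2)[OF x])
    moreover have "norm (y s1) \<le> half_C / W x"
    proof -
      have z: "R x s1 \<in> \<Gamma>" using R_props(3)[OF x] s1 by simp
      have "norm (y s1) \<le> half_C / W (R x s1)" unfolding y_def using norm_t0 by (intro F_disc_bound z) auto
      also have "\<dots> \<le> half_C / W x" using half_C_nonneg W_pos W_R_mono[OF x, of s1] s1 by (intro divide_left_mono mult_pos_pos) auto
      finally show ?thesis .
    qed
    moreover have "h s1 - h 0 \<le> q / 2 * (?E - 1) / W x"
    proof -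
      have e0: "e 0 = ?E" by (simp add: e_def R_props(2)[OF x])
      have "0 \<le> \<sigma> * (Re t - 2 * s1) + V \<sigma> (R x s1)"
        using \<sigma> a(1) V_nonneg[OF \<sigma> R_props(3)[OF x, of s1]] s1 by (simp add: s1_def)
      then have e1: "e s1 \<ge> 1" by (simp add: e_def exp_add[symmetric])
      have "h s1 - h 0 = q / 2 / W x * (?E - e s1)" by (simp add: h_def e0 algebra_simps)
      also have "\<dots> \<le> q / 2 / W x * (?E - 1)" using e1 q(2) W_pos[of x] by (intro mult_left_mono) auto
      finally show ?thesis by simp
    qed
    moreover have "norm (F t x) \<le> norm (y s1) + norm (y s1 - y 0)"
      using norm_triangle_ineq4[of "y s1" "y s1 - y 0"] y0 by simp
    ultimately have "norm (F t x) \<le> half_C / W x + q / 2 * (?E - 1) / W x" by linarith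
    then show ?thesis by (intro suff) (simp add: add_divide_distrib)
  qed
qed

lemma strip_bound_half_C:
  assumes \<sigma>: "\<sigma> > 0"
  shows "strip_bound \<sigma> half_C"
proof -
  obtain K where K: "K > 0" "\<And>t x. t \<in> U_region (2 * r0) \<Longrightarrow> x \<in> \<Gamma> \<Longrightarrow> norm (F t x) \<le> K * exp (\<sigma> * Re t) / W x"
    using F_bound[OF \<sigma> half_strip(2,3)] by blast
  have "strip_bound \<sigma> (max half_C (K / 2 ^ n))" for n
  proof (induction n)
    case 0
    show ?case unfolding strip_bound_def
    proof (intro allI impI)
      fix t x assume t: "Re t \<ge> 0" "t \<in> U_region (2 * r0)" and x: "x \<in> \<Gamma>"
      have "K * exp (\<sigma> * Re t) \<le> max half_C (K / 2 ^ 0) * (exp (\<sigma> * Re t) * exp (V \<sigma> x))"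
        using K(1) V_nonneg[OF \<sigma> x] by (intro mult_mono) auto
      then have "K * exp (\<sigma> * Re t) / W x \<le> max half_C (K / 2 ^ 0) * (exp (\<sigma> * Re t) * exp (V \<sigma> x)) / W x"
        using W_pos[of x] by (intro divide_right_mono) auto
      then show "norm (F t x) \<le> max half_C (K / 2 ^ 0) * (exp (\<sigma> * Re t) * exp (V \<sigma> x)) / W x"
        using K(2)[OF t(2) x] by linarith
    qed
  next
    case (Suc n)
    have "strip_bound \<sigma> (max half_C (max half_C (K / 2 ^ n) / 2))"
      using half_C_nonneg by (intro strip_bound_step[OF \<sigma> Suc]) auto
    also have "max half_C (max half_C (K / 2 ^ n) / 2) = max half_C (K / 2 ^ Suc n)"
      using half_C_nonneg by (auto simp: max_def)
    finally show ?case .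
  qed
  note sb = this
  have lim: "(\<lambda>n. max half_C (K / 2 ^ n)) \<longlonglongrightarrow> max half_C 0"
    by (intro tendsto_max tendsto_const LIMSEQ_divide_realpow_zero) auto
  show ?thesis
    unfolding strip_bound_def
  proof (intro allI impI)
    fix t x assume t: "Re t \<ge> 0" "t \<in> U_region (2 * r0)" and x: "x \<in> \<Gamma>"
    have "(\<lambda>n. max half_C (K / 2 ^ n) * (exp (\<sigma> * Re t) * exp (V \<sigma> x)) / W x) \<longlonglongrightarrow> max half_C 0 * (exp (\<sigma> * Re t) * exp (V \<sigma> x)) / W x"
      using W_pos[of x] by (intro tendsto_intros lim) auto
    then have "norm (F t x) \<le> max half_C 0 * (exp (\<sigma> * Re t) * exp (V \<sigma> x)) / W x"
      using sb t x by (intro LIMSEQ_le_const) (auto simp: strip_bound_def)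
    then show "norm (F t x) \<le> half_C * (exp (\<sigma> * Re t) * exp (V \<sigma> x)) / W x"
      using half_C_nonneg by (simp add: max_absorb1)
  qed
qed

text \<open>\<open>C_bound\<close> is twice \<open>half_C\<close>. Where Re (\<tau> s) \<ge> 0, the
  strip bound applies with this factor 2 to spare; elsewhere \<open>\<tau> s\<close> lies in the
  disc, and \<sigma> < \<omega> keeps exp (\<sigma> Re (\<tau> s)) above 1/2.\<close>

lemma disc_coeff_bound:
  assumes \<sigma>: "0 < \<sigma>" "\<sigma> < \<omega>" and x: "x \<in> \<Gamma>"
  shows "norm (disc_coeff n x) \<le> C_bound p \<Gamma> \<epsilon> \<rho> F r0 * exp (V \<sigma> x) / W x / 2 powr (\<sigma> / \<omega>) / (1 - \<sigma> / \<omega>)"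
proof -
  have "norm (disc_coeff n x) \<le> (2 * half_C * exp (V \<sigma> x) / W x) / 2 powr (\<sigma> / \<omega>) / (1 - \<sigma> / \<omega>)"
  proof (rule disc_coeff_bound_of_F_bound[OF x \<sigma>])
    show "0 \<le> 2 * half_C * exp (V \<sigma> x) / W x" using half_C_nonneg W_pos[of x] by simp
    fix s :: complex assume s: "s \<in> ball 0 1"
    note tf = \<tau>_facts[OF s]
    show "norm (F (\<tau> s) x) \<le> 2 * half_C * exp (V \<sigma> x) / W x * exp (\<sigma> * Re (\<tau> s))"
    proof (cases "Re (\<tau> s) \<ge> 0")
      case True
      have "norm (F (\<tau> s) x) \<le> half_C * (exp (\<sigma> * Re (\<tau> s)) * exp (V \<sigma> x)) / W x"
        using strip_bound_half_C[OF \<sigma>(1)] True tf(1) x by (simp add: strip_bound_def)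
      also have "\<dots> = 1 * (half_C * exp (V \<sigma> x) / W x * exp (\<sigma> * Re (\<tau> s)))" by simp
      also have "\<dots> \<le> 2 * (half_C * exp (V \<sigma> x) / W x * exp (\<sigma> * Re (\<tau> s)))"
        using half_C_nonneg W_pos[of x] by (intro mult_right_mono) auto
      finally show ?thesis by simp
    next
      case False
      then have "norm (\<tau> s) \<le> 2 * r0" using tf(1) by (simp add: U_region_def)
      then have "norm (F (\<tau> s) x) \<le> half_C / W x" using x by (rule F_disc_bound)
      moreover \<comment> \<open>the factor 2 in \<open>C_bound\<close> compensates for this lower bound\<close>
      have "1 / 2 \<le> exp (\<sigma> * Re (\<tau> s))"
      proof -
        have "- ln 2 \<le> \<sigma> * (- ln 2 / \<omega>)"
          using \<sigma> by (simp add: divide_simps)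
        also have "\<dots> \<le> \<sigma> * Re (\<tau> s)" using tf(5) \<sigma> by (intro mult_left_mono) auto
        finally have "exp (- ln 2) \<le> exp (\<sigma> * Re (\<tau> s))" by simp
        then show ?thesis by (simp add: exp_minus)
      qed
      then have "1 * 1 \<le> (2 * exp (\<sigma> * Re (\<tau> s))) * exp (V \<sigma> x)"
        using V_nonneg[OF \<sigma>(1) x] by (intro mult_mono) auto
      then have "half_C / W x * 1 \<le> half_C / W x * ((2 * exp (\<sigma> * Re (\<tau> s))) * exp (V \<sigma> x))"
        using half_C_nonneg W_pos[of x] by (intro mult_left_mono) auto
      ultimately show ?thesis by (simp add: mult_ac)
    qed
  qed
  then show ?thesis by (simp add: half_C_def)
qed

end

section \<open>The factorial series\<close>

context wkb_borel begin

text \<open>For a > 0 this is the Laplace transform of (1 - exp (-\<omega> t))^n at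
  \<open>a\<close>, written with a Pochhammer symbol to match the limit formulas for the gamma
  function.\<close>

definition fact_ratio :: "real \<Rightarrow> nat \<Rightarrow> real" where
  "fact_ratio a n = fact n / (\<omega> * pochhammer (a / \<omega>) (n + 1))"

lemma prod_eq_pochhammer: "(\<Prod>k\<le>n. a + real k * \<omega>) = \<omega> ^ (n + 1) * pochhammer (a / \<omega>) (n + 1)"
proof -
  have "(\<Prod>k\<le>n. a + real k * \<omega>) = (\<Prod>k\<le>n. \<omega> * (a / \<omega> + real k))"
    using \<omega>_pos by (intro prod.cong refl) (simp add: field_simps)
  also have "\<dots> = \<omega> ^ (n + 1) * pochhammer (a / \<omega>) (n + 1)"
    by (simp add: prod.distrib pochhammer_prod atLeast0AtMost flip: lessThan_Suc_atMost atLeast0LessThan)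
  finally show ?thesis .
qed

lemma fact_ratio_eq: "fact_ratio a n = fact n * \<omega> ^ n / (\<Prod>k\<le>n. a + real k * \<omega>)"
  unfolding prod_eq_pochhammer fact_ratio_def using \<omega>_pos by simp

lemma fact_ratio_nonneg: "a > 0 \<Longrightarrow> fact_ratio a n \<ge> 0"
  unfolding fact_ratio_eq using \<omega>_pos by (intro divide_nonneg_nonneg prod_nonneg) auto

lemma factorial_term_eq:
  "fterm u n x = disc_coeff n x * (fact n * of_real \<omega> ^ n / (\<Prod>k\<le>n. u + of_nat k * of_real \<omega>))"
  using \<omega>_pos by (simp add: factorial_term_def disc_coeff_def del: coeffB.simps)

text \<open>Each factor satisfies |u + k \<omega>| \<ge> Re u + k \<omega>, which reduces the
  estimates to real arguments.\<close>

lemma norm_factorial_term_le: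
  assumes u: "Re u > 0"
  shows "norm (fterm u n x) \<le> norm (disc_coeff n x) * fact_ratio (Re u) n"
proof -
  have le: "(\<Prod>k\<le>n. Re u + real k * \<omega>) \<le> norm (\<Prod>k\<le>n. u + of_nat k * of_real \<omega>)"
    unfolding prod_norm[symmetric]
  proof (rule prod_mono)
    fix k
    have "Re (u + of_nat k * of_real \<omega>) = Re u + real k * \<omega>" by simp
    then show "0 \<le> Re u + real k * \<omega> \<and> Re u + real k * \<omega> \<le> norm (u + of_nat k * of_real \<omega>)"
      using u \<omega>_pos complex_Re_le_cmod[of "u + of_nat k * of_real \<omega>"] by (auto intro!: add_nonneg_nonneg)
  qed
  have pos: "(\<Prod>k\<le>n. Re u + real k * \<omega>) > 0" using u \<omega>_pos by (intro prod_pos) (auto intro!: add_pos_nonneg)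
  have "norm (fterm u n x) = norm (disc_coeff n x) * (fact n * \<omega> ^ n / norm (\<Prod>k\<le>n. u + of_nat k * of_real \<omega>))"
    using \<omega>_pos by (simp add: factorial_term_eq norm_mult norm_divide norm_power)
  also have "\<dots> \<le> norm (disc_coeff n x) * fact_ratio (Re u) n"
    unfolding fact_ratio_eq using \<omega>_pos
    by (intro mult_left_mono divide_left_mono le mult_pos_pos pos less_le_trans[OF pos le]) auto
  finally show ?thesis .
qed

text \<open>The coefficient bound is used with \<sigma> = a / 2. Its power a / (2 \<omega>) - 1
  meets -a / \<omega> from the factorial ratio, and the exponent -1 - a / (2 \<omega>) makes the
  series converge.\<close>

lemma uniform_majorant:
  assumes a: "a > 0"
  obtains M where "summable M" "\<forall>\<^sub>F n in sequentially. \<forall>x\<in>\<Gamma>. norm (disc_coeff n x) * fact_ratio a n \<le> M n"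
proof -
  obtain C where C: "C > 0" "\<And>n x. x \<in> \<Gamma> \<Longrightarrow> n \<ge> 2 \<Longrightarrow> norm (disc_coeff n x) \<le> C * real n powr (a / 2 / \<omega> - 1)"
    using disc_coeff_decay[of "a / 2"] a by auto
  have "a / \<omega> > 0" using a \<omega>_pos by simp
  then obtain C' where C': "C' > 0" "\<And>n. n \<ge> 1 \<Longrightarrow> fact n / pochhammer (a / \<omega>) (n + 1) \<le> C' * real n powr (- (a / \<omega>))"
    using factorial_ratio_bounded by blast
  define M where "M n = C * C' / \<omega> * real n powr (- 1 - a / 2 / \<omega>)" for n :: nat
  have "summable M"
    unfolding M_def using a \<omega>_pos by (intro summable_mult) (simp add: summable_real_powr_iff)
  moreover have "norm (disc_coeff n x) * fact_ratio a n \<le> M n" if n: "n \<ge> 2" and x: "x \<in> \<Gamma>" for n x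
  proof -
    have "fact_ratio a n \<le> C' * real n powr (- (a / \<omega>)) / \<omega>"
      using C'(2)[of n] n \<omega>_pos by (simp add: fact_ratio_def field_simps)
    then have "norm (disc_coeff n x) * fact_ratio a n \<le> (C * real n powr (a / 2 / \<omega> - 1)) * (C' * real n powr (- (a / \<omega>)) / \<omega>)"
      using C(2)[OF x n] C(1) fact_ratio_nonneg[OF a, of n] by (intro mult_mono) auto
    also have "\<dots> = C * C' / \<omega> * (real n powr (a / 2 / \<omega> - 1) * real n powr (- (a / \<omega>)))"
      by simp
    also have "real n powr (a / 2 / \<omega> - 1) * real n powr (- (a / \<omega>)) = real n powr (- 1 - a / 2 / \<omega>)"
    proof -
      have "a / 2 / \<omega> - 1 + - (a / \<omega>) = - 1 - a / 2 / \<omega>" using \<omega>_pos by (simp add: field_simps)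
      then show ?thesis by (simp only: powr_add[symmetric])
    qed
    finally show ?thesis by (simp add: M_def)
  qed
  then have "\<forall>\<^sub>F n in sequentially. \<forall>x\<in>\<Gamma>. norm (disc_coeff n x) * fact_ratio a n \<le> M n"
    by (intro eventually_sequentiallyI[of 2]) auto
  ultimately show thesis using that by blast
qed

lemma summable_disc_coeff_fact_ratio:
  assumes a: "a > 0" and x: "x \<in> \<Gamma>"
  shows "summable (\<lambda>n. norm (disc_coeff n x) * fact_ratio a n)"
proof -
  obtain M where M: "summable M" "\<forall>\<^sub>F n in sequentially. \<forall>x\<in>\<Gamma>. norm (disc_coeff n x) * fact_ratio a n \<le> M n"
    using uniform_majorant[OF a] by blast
  show ?thesis
    by (rule summable_comparison_test_ev[OF _ M(1)])
      (use M(2) x fact_ratio_nonneg[OF a] in \<open>auto elim!: eventually_mono simp: abs_mult\<close>)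
qed

lemma F_real_sums:
  assumes x: "x \<in> \<Gamma>" and t: "t \<ge> 0"
  shows "(\<lambda>n. disc_coeff n x * of_real (1 - exp (- \<omega> * t)) ^ n) sums F (of_real t) x"
proof -
  have "\<tau> (of_real (1 - exp (- \<omega> * t))) = - Ln (of_real (exp (- \<omega> * t))) / of_real \<omega>"
    by (simp add: \<tau>_def)
  also have "\<dots> = of_real t" using \<omega>_pos by (subst Ln_of_real) auto
  finally have e: "\<tau> (of_real (1 - exp (- \<omega> * t))) = of_real t" .
  have "norm (of_real (1 - exp (- \<omega> * t)) :: complex) = \<bar>1 - exp (- \<omega> * t)\<bar>" by (rule norm_of_real)
  also have "\<dots> < 1" using t \<omega>_pos by auto
  finally have "of_real (1 - exp (- \<omega> * t)) \<in> ball (0::complex) 1" by simp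
  from F_sums[OF x this] show ?thesis unfolding e .
qed

text \<open>Sum and integral may be exchanged because the integrals of the absolute values of the
  terms are known exactly: they are \<open>fact_ratio (Re u) n\<close> times the moduli of the
  coefficients, and their sum converges.\<close>

lemma \<eta>_sums:
  assumes u: "Re u > 0" and x: "x \<in> \<Gamma>"
  shows "(\<lambda>n. fterm u n x) sums \<eta> u x"
proof -
  let ?M = "lebesgue_on {0::real..}"
  define f where "f n t = disc_coeff n x * (exp (- u * of_real t) * of_real (1 - exp (- \<omega> * t)) ^ n)" for n and t :: real
  have s01: "\<bar>1 - exp (- \<omega> * t)\<bar> \<le> 1" if "t \<ge> 0" for t using that \<omega>_pos by auto
  have norm_f': "norm (f n t) = norm (disc_coeff n x) * (exp (- Re u * t) * \<bar>1 - exp (- \<omega> * t)\<bar> ^ n)" for n t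
  proof -
    have "Re (- u * of_real t) = - Re u * t" by simp
    then show ?thesis unfolding f_def norm_mult norm_power norm_of_real norm_exp_eq_Re by (simp only:)
  qed
  have ai: "f n absolutely_integrable_on {0..}" for n
  proof (rule absolutely_integrable_continuous_bound)
    show "continuous_on {0..} (f n)" unfolding f_def by (intro continuous_intros)
    show "(\<lambda>t. norm (disc_coeff n x) * exp (- Re u * t)) integrable_on {0..}"
      by (intro integrable_on_mult_right integrable_on_exp_minus_to_infinity u)
    fix t :: real assume t: "t \<ge> 0"
    have "norm (f n t) = norm (disc_coeff n x) * exp (- Re u * t) * \<bar>1 - exp (- \<omega> * t)\<bar> ^ n"
      unfolding norm_f' by (simp only: mult.assoc)
    also have "\<dots> \<le> norm (disc_coeff n x) * exp (- Re u * t) * 1"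
      using s01[OF t] by (intro mult_left_mono power_le_one) auto
    finally show "norm (f n t) \<le> norm (disc_coeff n x) * exp (- Re u * t)" by simp
  qed
  have int_f: "integrable ?M (f n)" for n
    using ai[of n] by (simp add: absolutely_integrable_on_def integrable_restrict_space set_integrable_def)
  have norm_f: "norm (f n t) = norm (disc_coeff n x) * (exp (- Re u * t) * (1 - exp (- \<omega> * t)) ^ n)" if "t \<ge> 0" for n t
  proof -
    have "1 - exp (- \<omega> * t) \<ge> 0" using that \<omega>_pos by simp
    then show ?thesis unfolding norm_f' by (simp only: abs_of_nonneg)
  qed
  have int_norm: "integral\<^sup>L ?M (\<lambda>t. norm (f n t)) = norm (disc_coeff n x) * fact_ratio (Re u) n" for n
  proof -
    have "((\<lambda>t. Re (exp (- of_real (Re u) * of_real t) * of_real (1 - exp (- \<omega> * t)) ^ n)) has_integral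
        Re (fact n * of_real \<omega> ^ n / (\<Prod>k\<le>n. of_real (Re u) + of_nat k * of_real \<omega>))) {0..}"
      by (rule has_integral_Re[OF laplace_exp_power[OF _ \<omega>_pos]]) (use u in simp)
    also have "fact n * of_real \<omega> ^ n / (\<Prod>k\<le>n. of_real (Re u) + of_nat k * of_real \<omega>) = (of_real (fact_ratio (Re u) n) :: complex)"
      by (simp add: fact_ratio_eq)
    also have "(\<lambda>t::real. Re (exp (- of_real (Re u) * of_real t) * of_real (1 - exp (- \<omega> * t)) ^ n)) = (\<lambda>t. exp (- Re u * t) * (1 - exp (- \<omega> * t)) ^ n)"
    proof
      fix t :: real
      have "exp (- of_real (Re u) * of_real t) * of_real (1 - exp (- \<omega> * t)) ^ n = (of_real (exp (- Re u * t) * (1 - exp (- \<omega> * t)) ^ n) :: complex)"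
        by (simp flip: exp_of_real)
      then show "Re (exp (- of_real (Re u) * of_real t) * of_real (1 - exp (- \<omega> * t)) ^ n) = exp (- Re u * t) * (1 - exp (- \<omega> * t)) ^ n"
        by (simp only: Re_complex_of_real)
    qed
    finally have "((\<lambda>t. norm (disc_coeff n x) * (exp (- Re u * t) * (1 - exp (- \<omega> * t)) ^ n)) has_integral norm (disc_coeff n x) * fact_ratio (Re u) n) {0..}"
      by (intro has_integral_mult_right) simp
    then have h: "((\<lambda>t. norm (f n t)) has_integral norm (disc_coeff n x) * fact_ratio (Re u) n) {0..}"
      by (rule has_integral_eq[rotated]) (simp add: norm_f)
    have "integral\<^sup>L ?M (\<lambda>t. norm (f n t)) = integral {0..} (\<lambda>t. norm (f n t))"
      by (rule lebesgue_integral_eq_integral) (use int_f[of n] in auto)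
    then show ?thesis using h by (simp add: integral_unique)
  qed
  have "(\<lambda>n. integral\<^sup>L ?M (f n)) sums (integral\<^sup>L ?M (\<lambda>t. \<Sum>n. f n t))"
  proof (rule sums_integral[OF int_f])
    show "summable (\<lambda>n. integral\<^sup>L ?M (\<lambda>t. norm (f n t)))"
      unfolding int_norm by (rule summable_disc_coeff_fact_ratio[OF u x])
    show "AE t in ?M. summable (\<lambda>n. norm (f n t))"
    proof (rule AE_I2)
      fix t assume "t \<in> space ?M"
      then have t: "t \<ge> 0" by simp
      define s where "s = 1 - exp (- \<omega> * t)"
      have s: "0 \<le> s" "s < 1" using t \<omega>_pos by (auto simp: s_def)
      \<comment> \<open>Absolute convergence at \<open>s\<close> comes from convergence at a point
        strictly between \<open>s\<close> and 1.\<close>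
      define s' where "s' = (1 + s) / 2"
      have "summable (\<lambda>n. disc_coeff n x * of_real s' ^ n)"
        using F_sums[OF x, of "of_real s'"] s by (auto simp: s'_def sums_iff simp del: of_real_divide of_real_add)
      then have "summable (\<lambda>n. norm (disc_coeff n x * of_real s ^ n))"
        by (rule powser_insidea) (use s in \<open>auto simp: s'_def simp del: of_real_divide of_real_add\<close>)
      then have "summable (\<lambda>n. norm (exp (- u * of_real t)) * norm (disc_coeff n x * of_real s ^ n))" by (rule summable_mult)
      then show "summable (\<lambda>n. norm (f n t))"
        by (simp add: f_def s_def norm_mult mult_ac del: of_real_diff)
    qed
  qed
  also have "integral\<^sup>L ?M (\<lambda>t. \<Sum>n. f n t) = integral\<^sup>L ?M (\<lambda>t. exp (- u * of_real t) * F (of_real t) x)"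
  proof (rule Bochner_Integration.integral_cong[OF refl])
    fix t assume "t \<in> space ?M"
    then have t: "t \<ge> 0" by simp
    show "(\<Sum>n. f n t) = exp (- u * of_real t) * F (of_real t) x"
      using sums_mult[OF F_real_sums[OF x t], of "exp (- u * of_real t)"]
      by (simp add: f_def sums_iff mult_ac del: of_real_diff)
  qed
  also have "\<dots> = \<eta> u x"
  proof -
    have h: "((\<lambda>t. exp (- u * of_real t) * F (of_real t) x) has_integral \<eta> u x) {0..}"
      using F u x by (simp add: borel_transform_def)
    \<comment> \<open>The representation of \<open>\<eta>\<close> is given as a gauge integral. The
      a priori bound with exponent Re u / 2 makes the integrand absolutely integrable, so that it is
      the Lebesgue integral as well.\<close>
    obtain K where K: "K > 0" "\<And>t x. t \<in> U_region (2 * r0) \<Longrightarrow> x \<in> \<Gamma> \<Longrightarrow> norm (F t x) \<le> K * exp (Re u / 2 * Re t)"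
      using F_bound_no_weight[OF _ half_strip(2,3), of "Re u / 2"] u by auto
    have real_U: "of_real t \<in> U_region (2 * r0)" if "t \<ge> 0" for t
      using that half_strip(2) by (cases "t = 0") (auto simp: U_region_def)
    have real_T: "of_real t \<in> T" if "t \<ge> 0" for t
      using real_U[OF that] U_region_mono[of "2 * r0" "2 * d"] half_strip(3) by auto
    have "(\<lambda>t. exp (- u * of_real t) * F (of_real t) x) absolutely_integrable_on {0..}"
    proof (rule absolutely_integrable_continuous_bound)
      have "continuous_on {0..} (\<lambda>t. F (of_real t) x)"
        by (rule continuous_on_compose2[OF holomorphic_on_imp_continuous_on[OF admissibleD(2)[OF F_admissible x]]])
          (use real_T in \<open>auto intro!: continuous_intros\<close>)
      then show "continuous_on {0..} (\<lambda>t. exp (- u * of_real t) * F (of_real t) x)"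
        by (intro continuous_intros)
      show "(\<lambda>t. K * exp (- (Re u / 2) * t)) integrable_on {0..}"
        by (intro integrable_on_mult_right integrable_on_exp_minus_to_infinity) (use u in simp)
      fix t :: real assume t: "t \<ge> 0"
      have "norm (exp (- u * of_real t) * F (of_real t) x) \<le> exp (- Re u * t) * (K * exp (Re u / 2 * t))"
        using K(2)[OF real_U[OF t] x] by (simp add: norm_mult)
      also have "\<dots> = K * exp (- (Re u / 2) * t)"
        by (simp add: exp_add[symmetric] field_simps)
      finally show "norm (exp (- u * of_real t) * F (of_real t) x) \<le> K * exp (- (Re u / 2) * t)" .
    qed
    then have "integrable ?M (\<lambda>t. exp (- u * of_real t) * F (of_real t) x)"
      by (simp add: integrable_restrict_space set_integrable_def)
    then have "integral\<^sup>L ?M (\<lambda>t. exp (- u * of_real t) * F (of_real t) x) = integral {0..} (\<lambda>t. exp (- u * of_real t) * F (of_real t) x)"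
      by (rule lebesgue_integral_eq_integral) auto
    then show ?thesis using h by (simp add: integral_unique)
  qed
  finally have "(\<lambda>n. integral\<^sup>L ?M (f n)) sums \<eta> u x" .
  moreover have "integral\<^sup>L ?M (f n) = fterm u n x" for n
  proof -
    have "integral\<^sup>L ?M (f n) = integral {0..} (f n)"
      by (rule lebesgue_integral_eq_integral[OF int_f]) auto
    also have "\<dots> = fterm u n x"
      unfolding f_def factorial_term_eq
      by (intro integral_unique has_integral_mult_right laplace_exp_power u \<omega>_pos)
    finally show ?thesis .
  qed
  ultimately show ?thesis by simp
qed

lemma uniform_convergence:
  assumes u: "Re u > 0"
  shows "uniformly_convergent_on \<Gamma> (\<lambda>N x. \<Sum>n<N. norm (fterm u n x))"
    and "uniform_limit \<Gamma> (\<lambda>N x. \<Sum>n<N. fterm u n x) (\<eta> u) sequentially"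
proof -
  obtain M where M: "summable M" "\<forall>\<^sub>F n in sequentially. \<forall>x\<in>\<Gamma>. norm (disc_coeff n x) * fact_ratio (Re u) n \<le> M n"
    using uniform_majorant[OF u] by blast
  have ev: "\<forall>\<^sub>F n in sequentially. \<forall>x\<in>\<Gamma>. norm (fterm u n x) \<le> M n"
    using M(2) by eventually_elim (meson norm_factorial_term_le[OF u] order_trans)
  have "uniform_limit \<Gamma> (\<lambda>N x. \<Sum>n<N. norm (fterm u n x))
      (\<lambda>x. \<Sum>n. norm (fterm u n x)) sequentially"
    using ev by (intro Weierstrass_m_test_ev[OF _ M(1)]) simp
  then show "uniformly_convergent_on \<Gamma> (\<lambda>N x. \<Sum>n<N. norm (fterm u n x))"
    by (rule uniformly_convergentI)
  have "uniform_limit \<Gamma> (\<lambda>N x. \<Sum>n<N. fterm u n x)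
      (\<lambda>x. \<Sum>n. fterm u n x) sequentially"
    by (rule Weierstrass_m_test_ev[OF ev M(1)])
  then show "uniform_limit \<Gamma> (\<lambda>N x. \<Sum>n<N. fterm u n x) (\<eta> u) sequentially"
    by (rule uniform_limit_cong'[THEN iffD1, rotated 2]) (use \<eta>_sums[OF u] in \<open>auto simp: sums_iff\<close>)
qed

text \<open>With v = Re u / \<omega> > 1, the uniform coefficient bound summed against the factorial
  ratios telescopes to \<open>fact N / ((v - 1) * pochhammer v N)\<close>, which equals Gamma (v -
  1) N! / Gamma (N + v); this is the origin of Gamma (Re u / \<omega> - 1). The factor 1 / \<omega>
  in \<open>fact_ratio\<close> turns 1 - \<sigma> / \<omega> in the denominator into \<omega> -
  \<sigma>.\<close>

lemma remainder_bound:
  assumes \<sigma>: "0 < \<sigma>" "\<sigma> < \<omega>" and u: "Re u > \<omega>" and x: "x \<in> \<Gamma>"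
  shows "norm (\<eta> u x - (\<Sum>n<N. fterm u n x))
     \<le> C_bound p \<Gamma> \<epsilon> \<rho> F r0 / 2 powr (\<sigma> / \<omega>) * (Gamma (Re u / \<omega> - 1) / (\<omega> - \<sigma>))
        * (exp (V_bound p G \<phi> \<psi> \<Gamma> \<epsilon> \<sigma> x) / W x) * (real N + 1/2) powr (1 - Re u / \<omega>)"
proof -
  let ?ft = "\<lambda>n. fterm u n x"
  define v where "v = Re u / \<omega>"
  have v: "v > 1" using u \<omega>_pos by (simp add: v_def)
  have u0: "Re u > 0" using u \<omega>_pos by linarith
  define A where "A = C_bound p \<Gamma> \<epsilon> \<rho> F r0 * exp (V \<sigma> x) / W x / 2 powr (\<sigma> / \<omega>) / (1 - \<sigma> / \<omega>)"
  have gA: "norm (disc_coeff n x) \<le> A" for n unfolding A_def by (rule disc_coeff_bound[OF \<sigma> x])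
  have A0: "A \<ge> 0" using gA[of 0] norm_ge_zero order_trans by blast
  have part: "norm (\<Sum>n<m. ?ft (n + N)) \<le> A / \<omega> * (fact N / ((v - 1) * pochhammer v N))" for m
  proof -
    have "norm (\<Sum>n<m. ?ft (n + N)) \<le> (\<Sum>n<m. A / \<omega> * (fact (n + N) / pochhammer v (n + N + 1)))"
    proof (rule sum_norm_le)
      fix n
      have "norm (?ft (n + N)) \<le> norm (disc_coeff (n + N) x) * fact_ratio (Re u) (n + N)"
        by (rule norm_factorial_term_le[OF u0])
      also have "\<dots> \<le> A * fact_ratio (Re u) (n + N)" by (intro mult_right_mono gA fact_ratio_nonneg u0)
      also have "\<dots> = A / \<omega> * (fact (n + N) / pochhammer v (n + N + 1))"
        by (simp add: fact_ratio_def v_def)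
      finally show "norm (?ft (n + N)) \<le> A / \<omega> * (fact (n + N) / pochhammer v (n + N + 1))" .
    qed
    also have "\<dots> = A / \<omega> * (\<Sum>n<m. fact (n + N) / pochhammer v (n + N + 1))"
      by (rule sum_distrib_left[symmetric])
    also have "\<dots> \<le> A / \<omega> * (fact N / ((v - 1) * pochhammer v N))"
      using A0 \<omega>_pos by (intro mult_left_mono telescoping_factorial_bound v) auto
    finally show ?thesis .
  qed
  have "(\<lambda>n. ?ft (n + N)) sums (\<eta> u x - (\<Sum>n<N. ?ft n))"
    using \<eta>_sums[OF u0 x] by (rule sums_split_initial_segment)
  then have "(\<lambda>m. norm (\<Sum>n<m. ?ft (n + N))) \<longlonglongrightarrow> norm (\<eta> u x - (\<Sum>n<N. ?ft n))"
    unfolding sums_def by (rule tendsto_norm)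
  then have 1: "norm (\<eta> u x - (\<Sum>n<N. ?ft n)) \<le> A / \<omega> * (fact N / ((v - 1) * pochhammer v N))"
    by (rule LIMSEQ_le_const2) (use part in auto)
  have notin: "y \<notin> \<int>\<^sub>\<le>\<^sub>0" if "y > 0" for y :: real
    using that by (auto elim!: nonpos_Ints_cases)
  have G1: "Gamma v = (v - 1) * Gamma (v - 1)"
    using Gamma_plus1[OF notin[of "v - 1"]] v by simp
  have Gpos: "Gamma (v - 1) > 0" "Gamma (real N + v) > 0" using v by (auto intro!: Gamma_real_pos)
  have G2: "Gamma (real N + v) = pochhammer v N * Gamma v"
  proof -
    have "Gamma v \<noteq> 0" using Gamma_real_pos[of v] v by linarith
    then show ?thesis using pochhammer_Gamma[OF notin[of v], of N] v by (simp add: add.commute)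
  qed
  have "fact N / ((v - 1) * pochhammer v N) = Gamma (v - 1) * (fact N / Gamma (real N + v))"
  proof -
    have "A / (B * P) = g * (A / (P * (B * g)))" if "g \<noteq> 0" for A B P g :: real
      using that by simp
    then show ?thesis unfolding G2 G1 using Gpos(1) by simp
  qed
  also have "\<dots> \<le> Gamma (v - 1) * (real N + 1/2) powr (1 - v)"
  proof (rule mult_left_mono)
    have "fact N \<le> Gamma (real N + v) / (real N + 1/2) powr (v - 1)"
      using gamma_ratio_lower[OF v, of N] by (subst le_divide_eq) auto
    then have "fact N \<le> Gamma (real N + v) * (real N + 1/2) powr (1 - v)"
      by (simp add: powr_diff)
    then show "fact N / Gamma (real N + v) \<le> (real N + 1/2) powr (1 - v)"
      using Gpos(2) by (subst divide_le_eq) (auto simp: mult.commute)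
  qed (use Gpos in simp)
  finally have 2: "fact N / ((v - 1) * pochhammer v N) \<le> Gamma (v - 1) * (real N + 1/2) powr (1 - v)" .
  have "norm (\<eta> u x - (\<Sum>n<N. ?ft n)) \<le> A / \<omega> * (Gamma (v - 1) * (real N + 1/2) powr (1 - v))"
    using 1 mult_left_mono[OF 2, of "A / \<omega>"] A0 \<omega>_pos by auto
  also have "A / \<omega> = C_bound p \<Gamma> \<epsilon> \<rho> F r0 * exp (V \<sigma> x) / W x / 2 powr (\<sigma> / \<omega>) / (\<omega> - \<sigma>)"
  proof -
    have "Z / (1 - \<sigma> / \<omega>) / \<omega> = Z / ((1 - \<sigma> / \<omega>) * \<omega>)" for Z :: real by simp
    moreover have "(1 - \<sigma> / \<omega>) * \<omega> = \<omega> - \<sigma>" using \<omega>_pos by (simp add: left_diff_distrib)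
    ultimately show ?thesis unfolding A_def by (simp only:)
  qed
  finally show ?thesis by (simp add: v_def V_bound_eq_V[OF x] mult_ac)
qed

end

theorem theorem1p3:
  fixes p :: "'a::t2_space \<Rightarrow> complex"
    and G \<Delta> \<Gamma> :: "'a set"
    and \<phi> \<psi> \<Phi> :: "'a \<Rightarrow> complex"
    and \<eta> F :: "complex \<Rightarrow> 'a \<Rightarrow> complex"
    and \<epsilon> c \<rho> d \<omega> :: real
  assumes sign: "\<epsilon> = 1 \<or> \<epsilon> = -1"
    and G: "spread_domain p G"
    and hol: "xi_holomorphic_on p \<phi> G" "xi_holomorphic_on p \<psi> G"
    and \<Delta>: "subdomain \<Delta> G"
    and pos: "c > 0" "\<rho> > 0"
    and C1_or_C2: "cond_C1 p \<phi> \<psi> \<Delta> c \<rho> \<or> cond_C2 p \<phi> \<psi> \<Delta> c \<rho>"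
    and d: "d > 0"
    and \<omega>: "\<omega> > pi / (4 * d)"
    and \<Gamma>: "Gamma_domain p \<Delta> d \<epsilon> \<Gamma>"
    and \<eta>: "eta_function p \<phi> \<psi> \<Gamma> \<epsilon> \<Phi> \<eta>"
    and F: "borel_transform p \<phi> \<psi> \<Gamma> \<epsilon> d \<rho> \<eta> F"
  shows "(\<forall>\<sigma> u. \<sigma> > 0 \<longrightarrow> Re u > \<sigma> \<longrightarrow>
            (\<forall>x\<in>\<Gamma>. (\<lambda>n. factorial_term p \<phi> \<psi> \<Gamma> \<epsilon> \<omega> u n x) sums \<eta> u x) \<and>
            uniformly_convergent_on \<Gamma>
              (\<lambda>N x. \<Sum>n<N. norm (factorial_term p \<phi> \<psi> \<Gamma> \<epsilon> \<omega> u n x)) \<and>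
            uniform_limit \<Gamma> (\<lambda>N x. \<Sum>n<N. factorial_term p \<phi> \<psi> \<Gamma> \<epsilon> \<omega> u n x)
              (\<eta> u) sequentially)
       \<and> (\<forall>\<sigma> u x (N::nat). \<sigma> > 0 \<longrightarrow> \<omega> > \<sigma> \<longrightarrow> Re u > \<omega> \<longrightarrow> x \<in> \<Gamma> \<longrightarrow>
            norm (\<eta> u x - (\<Sum>n<N. factorial_term p \<phi> \<psi> \<Gamma> \<epsilon> \<omega> u n x))
              \<le> C_bound p \<Gamma> \<epsilon> \<rho> F (pi / (4 * \<omega>)) / 2 powr (\<sigma> / \<omega>)
                 * (Gamma (Re u / \<omega> - 1) / (\<omega> - \<sigma>))
                 * (exp (V_bound p G \<phi> \<psi> \<Gamma> \<epsilon> \<sigma> x) / weight p \<epsilon> \<rho> x)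
                 * (real N + 1/2) powr (1 - Re u / \<omega>))"
proof -
  interpret wkb_borel p G \<Delta> \<Gamma> \<phi> \<psi> \<epsilon> c \<rho> d \<eta> F \<omega>
    by unfold_locales fact+
  show ?thesis
    using \<eta>_sums uniform_convergence remainder_bound by (meson less_trans)
qed

end
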